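(* Let $M$ be an $n$-vertex degree-regular combinatorial $2$-manifold of Euler characteristic $0$. If $n=12$, $14$ or $15$, then $M$ is isomorphic to one of the following $17$ complexes: $T_{12,1,2}$, $T_{12,1,3}$, $T_{12,1,4}$, $T_{6,2,2}$, $T_{14,1,2}$, $T_{14,1,3}$, $T_{15,1,2}$, $T_{15,1,3}$, $T_{15,1,4}$, $T_{15,1,5}$, $Q_{7,2}$, $Q_{5,3}$, $B_{3,4}$, $B_{4,3}$, $B_{3,5}$, $B_{5,3}$, $K_{3,4}$. These $17$ combinatorial $2$-manifolds are pairwise non-isomorphic. The first $10$ in this list triangulate the torus and the remaining $7$ triangulate the Klein bottle. Among the last $7$, only $Q_{7,2}$ is weakly regular.
   Context: A combinatorial $2$-manifold is a $2$-dimensional simplicial complex whose geometric carrier is a closed surface; it triangulates a surface $P$ if its geometric carrier is homeomorphic to $P$. The degree of a vertex is the number of edges containing it. A combinatorial $2$-manifold is degree-regular if it is connected and all its vertices have the same degree; it is weakly regular if it is connected and its automorphism group (group of simplicial self-isomorphisms) acts transitively on its vertices. The Euler characteristic is $\chi(X)=f_0(X)-f_1(X)+f_2(X)$, where $f_i(X)$ is the number of $i$-simplices. Isomorphism means simplicial isomorphism. Each complex below is specified by its $2$-simplices (faces); its simplices are exactly the non-empty subsets of faces. A face $\{a,b,c\}$ is written $abc$. $T_{n,1,k}$ (for $n\geq 7$, $k\in\{2,\dots,\lfloor\frac{n-3}{2}\rfloor\}\cup\{\lceil\frac{n+1}{2}\rceil,\dots,n-3\}$): vertices $1,\dots,n$;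 faces $\{i,i+k,i+k+1\}$, $\{i,i+1,i+k+1\}$ for $1\leq i\leq n$ (addition modulo $n$). $T_{n,2,k}$ (for $n\geq 4$, $1\leq k\leq n-3$): vertices $u_1,\dots,u_n,v_1,\dots,v_n$; faces $u_iu_{i+1}v_{i+1}$, $u_iv_iv_{i+1}$, $u_{i+k}u_{i+k+1}v_i$, $u_{i+k+1}v_iv_{i+1}$ for $1\leq i\leq n$ (subscripts modulo $n$). $B_{m,n}$ (for $m,n\geq 3$): vertices $v_{i,j}$, $1\leq i\leq n$, $1\leq j\leq m$ (first subscripts modulo $n$); faces $v_{i,j}v_{i+1,j}v_{i+1,j+1}$, $v_{i,j}v_{i,j+1}v_{i+1,j+1}$ for $1\leq i\leq n$, $1\leq j\leq m-1$; and $v_{i,m}v_{n+2-i,1}v_{n+1-i,1}$, $v_{i,m}v_{i+1,m}v_{n+1-i,1}$ for $1\leq i\leq n$. $K_{m,2n}$ (for $m\geq 3$, $n\geq 2$): vertices $v_{i,j}$, $1\leq i\leq 2n$, $1\leq j\leq m$ (first subscripts modulo $2n$); faces $v_{i,j}v_{i,j+1}v_{i+1,j}$, $v_{i,j+1}v_{i+1,j}v_{i+1,j+1}$ for $1\leq i\leq n$, $1\leq j\leq m-1$; $v_{i,m}v_{i+1,m}v_{2n+2-i,1}$, $v_{i+1,m}v_{2n+2-i,1}v_{2n+1-i,1}$ for $1\leq i\leq n$; $v_{i,j}v_{i+1,j}v_{i+1,j+1}$, $v_{i,j}v_{i,j+1}v_{i+1,j+1}$ for $n+1\leq i\leq 2n$,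 $1\leq j\leq m-1$; and $v_{i,m}v_{i+1,m}v_{2n+1-i,1}$, $v_{i,m}v_{2n+2-i,1}v_{2n+1-i,1}$ for $n+1\leq i\leq 2n$. $Q_{2m+1,2}$ (for $m\geq 2$): vertices $1,\dots,4m+2$; faces $\{i,i+1,i+2\}$, $\{i,i+2,i+2m+2\}$ for $1\leq i\leq 4m+2$ (addition modulo $4m+2$). Thus $Q_{7,2}$ is the case $m=3$. $Q_{2m+1,n}$ (for $m\geq 2$, $n\geq 3$): vertices $u_{i,j}$ ($1\leq i\leq m+1$, $1\leq j\leq n$) and $v_{i,j}$ ($1\leq i\leq m$, $1\leq j\leq n$), second subscripts modulo $n$; faces $u_{i,j}u_{i+1,j}v_{i,j}$, $u_{i,j+1}u_{i+1,j+1}v_{i,j}$ for $1\leq i\leq m$, $1\leq j\leq n$; $v_{i,j}v_{i+1,j}u_{i+1,j}$, $v_{i,j}v_{i+1,j}u_{i+1,j+1}$ for $1\leq i\leq m-1$, $1\leq j\leq n$; and $u_{m+1,j}u_{1,n+2-j}v_{1,n+2-j}$, $u_{m+1,j+1}u_{1,n+2-j}v_{1,n+1-j}$, $u_{m+1,j}u_{1,n+2-j}v_{m,j}$, $u_{m+1,j+1}u_{1,n+2-j}v_{m,j}$ for $1\leq j\leq n$. Thus $Q_{5,3}$ is the case $m=2$, $n=3$. *)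

theory Defs
  imports "HOL-Analysis.Analysis"
begin

section \<open>Simplicial complexes and their carriers\<close>

text \<open>Complexes are finite and abstract: a complex is the set of its non-empty simplices.\<close>

definition abstract_complex :: "'a set set \<Rightarrow> bool" where
  "abstract_complex K \<longleftrightarrow>
     finite K \<and> (\<forall>s\<in>K. finite s \<and> s \<noteq> {}) \<and> (\<forall>s\<in>K. \<forall>t. t \<subseteq> s \<and> t \<noteq> {} \<longrightarrow> t \<in> K)"

definition generated_complex :: "'a set set \<Rightarrow> 'a set set" where
  "generated_complex F = {s. s \<noteq> {} \<and> (\<exists>f\<in>F. s \<subseteq> f)}"

definition vertices :: "'a set set \<Rightarrow> 'a set" where
  "vertices K = \<Union>K"

definition face_number :: "'a set set \<Rightarrow> nat \<Rightarrow> nat" where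
  "face_number K i = card {s \<in> K. card s = i + 1}"

definition euler_char :: "'a set set \<Rightarrow> int" where
  "euler_char K = int (face_number K 0) - int (face_number K 1) + int (face_number K 2)"

definition two_dimensional :: "'a set set \<Rightarrow> bool" where
  "two_dimensional K \<longleftrightarrow> (\<forall>s\<in>K. card s \<le> 3) \<and> (\<exists>s\<in>K. card s = 3)"

definition vertex_degree :: "'a set set \<Rightarrow> 'a \<Rightarrow> nat" where
  "vertex_degree K v = card {e \<in> K. card e = 2 \<and> v \<in> e}"

text \<open>Points of the carrier are given by barycentric coordinates. Only finitely many
  coordinates are ever non-zero, so the product topology is the usual one.\<close>

definition geometric_carrier :: "'a set set \<Rightarrow> ('a \<Rightarrow> real) topology" where
  "geometric_carrier K = subtopology (powertop_real UNIV)
     {x. (\<forall>v. 0 \<le> x v) \<and> {v. x v \<noteq> 0} \<in> K \<and> (\<Sum>v | x v \<noteq> 0. x v) = 1}"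

section \<open>Surfaces\<close>

text \<open>A closed surface is a compact 2-manifold without boundary, not necessarily connected.\<close>

definition closed_surface :: "'a topology \<Rightarrow> bool" where
  "closed_surface X \<longleftrightarrow>
     compact_space X \<and> Hausdorff_space X \<and> second_countable X \<and>
     (\<forall>x\<in>topspace X. \<exists>U W. openin X U \<and> x \<in> U \<and> openin (Euclidean_space 2) W \<and>
        subtopology X U homeomorphic_space subtopology (Euclidean_space 2) W)"

definition torus :: "(complex \<times> complex) topology" where
  "torus = prod_topology (top_of_set (sphere 0 1)) (top_of_set (sphere 0 1))"

definition quotient_topology :: "'a topology \<Rightarrow> ('a \<times> 'a) set \<Rightarrow> 'a set topology" where
  "quotient_topology X R = topology (\<lambda>U. U \<subseteq> topspace X // R \<and> openin X (\<Union>U))"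

definition unit_square :: "(real \<times> real) set" where
  "unit_square = {0..1} \<times> {0..1}"

text \<open>The Klein bottle is the unit square with the vertical sides glued by translation and
  the horizontal sides glued with a flip.\<close>

definition klein_gluing :: "((real \<times> real) \<times> (real \<times> real)) set" where
  "klein_gluing = {((0, y), (1, y)) | y. y \<in> {0..1}} \<union> {((x, 0), (1 - x, 1)) | x. x \<in> {0..1}}"

definition klein_rel :: "((real \<times> real) \<times> (real \<times> real)) set" where
  "klein_rel = (klein_gluing \<union> klein_gluing\<inverse>)\<^sup>* \<inter> (unit_square \<times> unit_square)"

definition klein_bottle :: "(real \<times> real) set topology" where
  "klein_bottle = quotient_topology (top_of_set unit_square) klein_rel"

lemma quotient_class_Union_iff:
  assumes "equiv A R" "U \<subseteq> A // R" "c \<in> A // R" "x \<in> c"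
  shows "x \<in> \<Union>U \<longleftrightarrow> c \<in> U"
proof
  assume "x \<in> \<Union>U"
  then obtain d where d: "d \<in> U" "x \<in> d" by blast
  with assms(2) have "d \<in> A // R" by blast
  from quotient_disj[OF assms(1) this assms(3)] d assms(4) have "d = c" by blast
  with d show "c \<in> U" by simp
qed (use assms(4) in blast)

lemma openin_quotient_topology:
  assumes "equiv (topspace X) R"
  shows "openin (quotient_topology X R) U \<longleftrightarrow> U \<subseteq> topspace X // R \<and> openin X (\<Union>U)"
proof -
  have "istopology (\<lambda>U. U \<subseteq> topspace X // R \<and> openin X (\<Union>U))"
    unfolding istopology_def
  proof (intro conjI allI impI)
    fix S T assume S: "S \<subseteq> topspace X // R \<and> openin X (\<Union>S)"
      and T: "T \<subseteq> topspace X // R \<and> openin X (\<Union>T)"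
    have "\<Union>(S \<inter> T) = \<Union>S \<inter> \<Union>T"
    proof
      show "\<Union>S \<inter> \<Union>T \<subseteq> \<Union>(S \<inter> T)"
        using S T quotient_class_Union_iff[OF assms] by blast
    qed blast
    then show "openin X (\<Union>(S \<inter> T))" using S T by auto
  next
    fix \<K> assume K: "\<forall>K\<in>\<K>. K \<subseteq> topspace X // R \<and> openin X (\<Union>K)"
    have "\<Union>(\<Union>\<K>) = \<Union>(Union ` \<K>)" by blast
    then show "openin X (\<Union>(\<Union>\<K>))" using K by (metis (no_types, lifting) imageE openin_Union)
  qed auto
  then show ?thesis by (simp add: quotient_topology_def topology_inverse')
qed

lemma topspace_quotient_topology:
  assumes "equiv (topspace X) R"
  shows "topspace (quotient_topology X R) = topspace X // R"
proof -
  have "openin (quotient_topology X R) (topspace X // R)"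
    by (simp add: openin_quotient_topology assms Union_quotient)
  then have "topspace X // R \<subseteq> topspace (quotient_topology X R)" by (rule openin_subset)
  moreover have "topspace (quotient_topology X R) \<subseteq> topspace X // R"
    using openin_topspace[of "quotient_topology X R"]
    unfolding openin_quotient_topology[OF assms] by (rule conjunct1)
  ultimately show ?thesis by (rule subset_antisym[rotated])
qed

lemma quotient_map_quotient_topology:
  assumes "equiv (topspace X) R"
  shows "quotient_map X (quotient_topology X R) (\<lambda>x. R `` {x})"
proof -
  have "{x \<in> topspace X. R `` {x} \<in> U} = \<Union>U" if "U \<subseteq> topspace X // R" for U
  proof -
    have "\<Union>U \<subseteq> topspace X" using that Union_quotient[OF assms] by blast
    moreover have "x \<in> \<Union>U \<longleftrightarrow> R `` {x} \<in> U" if "x \<in> topspace X" for x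
      by (rule quotient_class_Union_iff[OF assms \<open>U \<subseteq> _\<close> quotientI[OF that]
            equiv_class_self[OF assms that]])
    ultimately show ?thesis by blast
  qed
  then show ?thesis
    unfolding quotient_map_def topspace_quotient_topology[OF assms] openin_quotient_topology[OF assms]
    by (auto simp: quotient_def)
qed

lemma equiv_klein_rel: "equiv unit_square klein_rel"
proof -
  have "sym ((klein_gluing \<union> klein_gluing\<inverse>)\<^sup>*)" by (simp add: sym_rtrancl sym_Un_converse)
  then show ?thesis
    unfolding equiv_def klein_rel_def by (auto simp: refl_on_def sym_def trans_def)
qed

section \<open>Combinatorial 2-manifolds\<close>

definition combinatorial_2_manifold :: "'a set set \<Rightarrow> bool" where
  "combinatorial_2_manifold K \<longleftrightarrow>
     abstract_complex K \<and> two_dimensional K \<and> closed_surface (geometric_carrier K)"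

definition triangulates :: "'a set set \<Rightarrow> 'b topology \<Rightarrow> bool" where
  "triangulates K X \<longleftrightarrow> geometric_carrier K homeomorphic_space X"

definition simplicial_iso :: "('a \<Rightarrow> 'b) \<Rightarrow> 'a set set \<Rightarrow> 'b set set \<Rightarrow> bool" where
  "simplicial_iso f K L \<longleftrightarrow> bij_betw f (vertices K) (vertices L) \<and>
     (\<forall>s. s \<subseteq> vertices K \<longrightarrow> (s \<in> K \<longleftrightarrow> f ` s \<in> L))"

definition isomorphic_complexes :: "'a set set \<Rightarrow> 'b set set \<Rightarrow> bool" where
  "isomorphic_complexes K L \<longleftrightarrow> (\<exists>f. simplicial_iso f K L)"

definition degree_regular :: "'a set set \<Rightarrow> bool" where
  "degree_regular K \<longleftrightarrow> connected_space (geometric_carrier K) \<and>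
     (\<exists>d. \<forall>v\<in>vertices K. vertex_degree K v = d)"

definition weakly_regular :: "'a set set \<Rightarrow> bool" where
  "weakly_regular K \<longleftrightarrow> connected_space (geometric_carrier K) \<and>
     (\<forall>u\<in>vertices K. \<forall>v\<in>vertices K. \<exists>f. simplicial_iso f K K \<and> f u = v)"

section \<open>The families of complexes\<close>

text \<open>A common vertex type, so that members of different families can be listed together:
  plain labels \<open>i\<close>, and the vertices \<open>u\<^sub>i\<close>, \<open>v\<^sub>i\<close>, \<open>u\<^sub>i\<^sub>,\<^sub>j\<close>, \<open>v\<^sub>i\<^sub>,\<^sub>j\<close>.\<close>

datatype vertex =
  Vtx int | Vtx_u int | Vtx_v int | Vtx_uu int int | Vtx_vv int int

text \<open>Reduction of a subscript modulo \<open>n\<close> to the representative in \<open>{1..n}\<close>.\<close>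

definition cyc :: "int \<Rightarrow> int \<Rightarrow> int" where
  "cyc n i = (i - 1) mod n + 1"

text \<open>\<open>T\<^sub>n\<^sub>,\<^sub>1\<^sub>,\<^sub>k\<close>\<close>

definition T1_complex :: "int \<Rightarrow> int \<Rightarrow> vertex set set" where
  "T1_complex n k = (let w = (\<lambda>i. Vtx (cyc n i)) in generated_complex
     (\<Union>i\<in>{1..n}. {{w i, w (i + k), w (i + k + 1)}, {w i, w (i + 1), w (i + k + 1)}}))"

text \<open>\<open>T\<^sub>n\<^sub>,\<^sub>2\<^sub>,\<^sub>k\<close>\<close>

definition T2_complex :: "int \<Rightarrow> int \<Rightarrow> vertex set set" where
  "T2_complex n k = (let u = (\<lambda>i. Vtx_u (cyc n i)); v = (\<lambda>i. Vtx_v (cyc n i)) in generated_complex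
     (\<Union>i\<in>{1..n}. {{u i, u (i + 1), v (i + 1)}, {u i, v i, v (i + 1)},
        {u (i + k), u (i + k + 1), v i}, {u (i + k + 1), v i, v (i + 1)}}))"

text \<open>\<open>B\<^sub>m\<^sub>,\<^sub>n\<close>\<close>

definition B_complex :: "int \<Rightarrow> int \<Rightarrow> vertex set set" where
  "B_complex m n = (let v = (\<lambda>i j. Vtx_vv (cyc n i) j) in generated_complex
     ((\<Union>i\<in>{1..n}. \<Union>j\<in>{1..m - 1}.
         {{v i j, v (i + 1) j, v (i + 1) (j + 1)}, {v i j, v i (j + 1), v (i + 1) (j + 1)}}) \<union>
      (\<Union>i\<in>{1..n}.
         {{v i m, v (n + 2 - i) 1, v (n + 1 - i) 1}, {v i m, v (i + 1) m, v (n + 1 - i) 1}})))"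

text \<open>\<open>K\<^sub>m\<^sub>,\<^sub>2\<^sub>n\<close>; the second argument is \<open>n\<close>, not \<open>2n\<close>.\<close>

definition K_complex :: "int \<Rightarrow> int \<Rightarrow> vertex set set" where
  "K_complex m n = (let v = (\<lambda>i j. Vtx_vv (cyc (2 * n) i) j) in generated_complex
     ((\<Union>i\<in>{1..n}. \<Union>j\<in>{1..m - 1}.
         {{v i j, v i (j + 1), v (i + 1) j}, {v i (j + 1), v (i + 1) j, v (i + 1) (j + 1)}}) \<union>
      (\<Union>i\<in>{1..n}.
         {{v i m, v (i + 1) m, v (2 * n + 2 - i) 1},
          {v (i + 1) m, v (2 * n + 2 - i) 1, v (2 * n + 1 - i) 1}}) \<union>
      (\<Union>i\<in>{n + 1..2 * n}. \<Union>j\<in>{1..m - 1}.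
         {{v i j, v (i + 1) j, v (i + 1) (j + 1)}, {v i j, v i (j + 1), v (i + 1) (j + 1)}}) \<union>
      (\<Union>i\<in>{n + 1..2 * n}.
         {{v i m, v (i + 1) m, v (2 * n + 1 - i) 1},
          {v i m, v (2 * n + 2 - i) 1, v (2 * n + 1 - i) 1}})))"

text \<open>\<open>Q\<^sub>2\<^sub>m\<^sub>+\<^sub>1\<^sub>,\<^sub>2\<close>; the argument is \<open>m\<close>.\<close>

definition Q2_complex :: "int \<Rightarrow> vertex set set" where
  "Q2_complex m = (let w = (\<lambda>i. Vtx (cyc (4 * m + 2) i)) in generated_complex
     (\<Union>i\<in>{1..4 * m + 2}. {{w i, w (i + 1), w (i + 2)}, {w i, w (i + 2), w (i + 2 * m + 2)}}))"

text \<open>\<open>Q\<^sub>2\<^sub>m\<^sub>+\<^sub>1\<^sub>,\<^sub>n\<close> for \<open>n \<ge> 3\<close>; the arguments are \<open>m\<close> and \<open>n\<close>.\<close>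

definition Q_complex :: "int \<Rightarrow> int \<Rightarrow> vertex set set" where
  "Q_complex m n =
     (let u = (\<lambda>i j. Vtx_uu i (cyc n j)); v = (\<lambda>i j. Vtx_vv i (cyc n j)) in generated_complex
     ((\<Union>i\<in>{1..m}. \<Union>j\<in>{1..n}.
         {{u i j, u (i + 1) j, v i j}, {u i (j + 1), u (i + 1) (j + 1), v i j}}) \<union>
      (\<Union>i\<in>{1..m - 1}. \<Union>j\<in>{1..n}.
         {{v i j, v (i + 1) j, u (i + 1) j}, {v i j, v (i + 1) j, u (i + 1) (j + 1)}}) \<union>
      (\<Union>j\<in>{1..n}.
         {{u (m + 1) j, u 1 (n + 2 - j), v 1 (n + 2 - j)},
          {u (m + 1) (j + 1), u 1 (n + 2 - j), v 1 (n + 1 - j)},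
          {u (m + 1) j, u 1 (n + 2 - j), v m j},
          {u (m + 1) (j + 1), u 1 (n + 2 - j), v m j}})))"

end

theory Submission
  imports Defs
begin

text \<open>
  Let \<open>M\<close> be a degree-regular surface with \<open>\<chi>(M) = 0\<close>. Counting incidences, with every edge in two
  triangles, shows that every vertex has degree 6. So \<open>M\<close> looks everywhere like the triangular
  lattice of the plane, and the proof transfers all questions to that lattice.

  \<^bold>\<open>The covering.\<close> That every edge of a triangulated surface lies in exactly two triangles, and that the
  link of a vertex of degree 6 is one hexagon and not two triangles, is a matter of topology; both follow
  from invariance of domain (\<open>edge_second_triangle\<close>, \<open>edge_two_triangles\<close>, \<open>closed_triangle_link\<close>). Then the flags of
  \<open>M\<close> carry an action of the symmetry group of the lattice: rotation of a flag about its vertex and the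
  half turn about its edge satisfy the relations of the \<open>(2,3,6)\<close> rotation group, and in that group the two
  unit translations commute (\<open>fXY\<close>). Hence one can walk through \<open>M\<close> along the lattice and obtains a
  simplicial covering of \<open>M\<close> by the lattice whose fibres are the orbits of lattice symmetries
  (\<open>hex_cover_exists\<close>). This replaces the universal covering of the surface by an explicit map on
  \<open>\<int>\<^sup>2\<close>.

  \<^bold>\<open>The deck group.\<close> The group of lattice symmetries compatible with the covering acts freely even on
  neighbourhoods of points, so it contains no rotation and no reflection. Either it consists of
  translations, and Hermite normal form describes it by three numbers \<open>a, b, c\<close>; or it contains a glide
  reflection, and up to a rotation of the lattice it is generated by one glide reflection and one translation
  perpendicular to its axis (\<open>hex_cover_kernel\<close>). In the second case the axis is either parallel or perpendicular to
  edges. The number of vertices is \<open>a * c\<close>, respectively \<open>a * m\<close>. For 12, 14 and 15 vertices finitely many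
  groups remain; those for which the star of some vertex is not embedded are discarded, and lattices that differ by one
  of the 12 rotations and reflections are identified. Ten lattices and seven glide groups are left
  (\<open>small_covers\<close>). Explicit coverings with exactly these groups are tabulated for the seventeen complexes of the theorem
  (\<open>torus_models\<close>, \<open>klein_models\<close>), and two complexes that are covered with the same group are isomorphic.

  \<^bold>\<open>Distinguishing the complexes.\<close> An isomorphism lifts to an affine symmetry of the lattice that carries one deck group to the
  other (\<open>simplicial_iso_match\<close>). Whether such a symmetry exists is a finite question, and it settles
  both the pairwise non-isomorphism and the failure of weak regularity. For \<open>Q\<^bsub>7,2\<^esub>\<close>, the deck group is normalised by
  enough translations and half turns to make the automorphism group transitive (\<open>klein_transitive\<close>).

  \<^bold>\<open>Topology of the carriers.\<close> Extending a covering linearly over the triangles exhibits the geometric carrier as the quotient of the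
  plane by the deck group, which an affine change of coordinates turns into the standard group of the
  torus or of the Klein bottle (\<open>torus_model_quotient\<close>, \<open>klein_model_quotient\<close>). In particular the seventeen carriers are
  closed surfaces.
\<close>



section \<open>The triangular lattice\<close>

type_synonym lat = "int \<times> int"

text \<open>The lattice is \<open>\<int>\<^sup>2\<close> with the six edge directions
  \<open>\<plusminus>(1,0)\<close>, \<open>\<plusminus>(1,1)\<close>,
  \<open>\<plusminus>(0,1)\<close>, a linear image of the equilateral triangular lattice. In
  these coordinates \<open>rot6\<close> is the rotation by 60 degrees about the origin and
  \<open>mir\<close> the reflection that fixes \<open>(1,0)\<close>.\<close>
definition rot6 :: "lat \<Rightarrow> lat" where "rot6 z = (fst z - snd z, fst z)"
definition mir :: "lat \<Rightarrow> lat" where "mir z = (fst z - snd z, - snd z)"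
definition hexdir :: "nat \<Rightarrow> lat" where "hexdir k = (rot6 ^^ k) (1, 0)"

definition tri1 :: "lat \<Rightarrow> lat set" where "tri1 z = {z, z + (1, 0), z + (1, 1)}"
definition tri2 :: "lat \<Rightarrow> lat set" where "tri2 z = {z, z + (0, 1), z + (1, 1)}"

definition star :: "lat \<Rightarrow> lat set" where
  "star z = (+) z ` {(0, 0), (1, 0), (1, 1), (0, 1), (-1, 0), (-1, -1), (0, -1)}"

lemma rot6_simps [simp]: "rot6 (x, y) = (x - y, x)" by (simp add: rot6_def)
lemma mir_simps [simp]: "mir (x, y) = (x - y, - y)" by (simp add: mir_def)
lemma rot6_add: "rot6 (z + w) = rot6 z + rot6 w" by (simp add: rot6_def prod_eq_iff)
lemma mir_add: "mir (z + w) = mir z + mir w" by (simp add: mir_def prod_eq_iff)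
lemma rot6_diff: "rot6 (z - w) = rot6 z - rot6 w" by (simp add: rot6_def prod_eq_iff)
lemma mir_diff: "mir (z - w) = mir z - mir w" by (simp add: mir_def prod_eq_iff)
lemma rot6_6: "rot6 (rot6 (rot6 (rot6 (rot6 (rot6 z))))) = z" by (cases z) simp
lemma mir_mir: "mir (mir z) = z" by (cases z) simp

lemma funpow_rot6_add: "(rot6 ^^ k) (z + w) = (rot6 ^^ k) z + (rot6 ^^ k) w"
  by (induction k) (simp_all add: rot6_add)
lemma funpow_rot6_diff: "(rot6 ^^ k) (z - w) = (rot6 ^^ k) z - (rot6 ^^ k) w"
  by (induction k) (simp_all add: rot6_diff)

lemma rot6_funpow6: "rot6 ^^ 6 = id"
  by (rule ext) (simp add: eval_nat_numeral rot6_6)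

lemma rot6_funpow_mod: "rot6 ^^ k = rot6 ^^ (k mod 6)"
proof -
  have "rot6 ^^ (6 * j) = id" for j
  proof (induction j)
    case (Suc j)
    have "rot6 ^^ (6 * Suc j) = rot6 ^^ 6 \<circ> rot6 ^^ (6 * j)" by (simp only: mult_Suc_right funpow_add)
    then show ?case using Suc by (simp only: rot6_funpow6 id_o)
  qed simp
  then have "rot6 ^^ (k mod 6 + 6 * (k div 6)) = rot6 ^^ (k mod 6)"
    by (simp only: funpow_add o_id)
  then show ?thesis by (simp only: mod_mult_div_eq)
qed

lemma less6_cases: "(k::nat) < 6 \<Longrightarrow> (k = 0 \<Longrightarrow> P) \<Longrightarrow> (k = 1 \<Longrightarrow> P) \<Longrightarrow> (k = 2 \<Longrightarrow> P) \<Longrightarrow>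
   (k = 3 \<Longrightarrow> P) \<Longrightarrow> (k = 4 \<Longrightarrow> P) \<Longrightarrow> (k = 5 \<Longrightarrow> P) \<Longrightarrow> P"
  by (cases "k = 0"; cases "k = 1"; cases "k = 2"; cases "k = 3"; cases "k = 4"; cases "k = 5") auto

lemma hexdir_mod: "hexdir k = hexdir (k mod 6)"
  unfolding hexdir_def using rot6_funpow_mod by metis

lemma hexdir_values:
  "hexdir 0 = (1, 0)" "hexdir (Suc 0) = (1, 1)" "hexdir 1 = (1, 1)" "hexdir 2 = (0, 1)"
  "hexdir 3 = (-1, 0)" "hexdir 4 = (-1, -1)" "hexdir 5 = (0, -1)"
  by (simp_all add: hexdir_def eval_nat_numeral)

lemma hexdir_cases:
  obtains "hexdir k = (1, 0)" "k mod 6 = 0" | "hexdir k = (1, 1)" "k mod 6 = 1"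
   | "hexdir k = (0, 1)" "k mod 6 = 2" | "hexdir k = (-1, 0)" "k mod 6 = 3"
   | "hexdir k = (-1, -1)" "k mod 6 = 4" | "hexdir k = (0, -1)" "k mod 6 = 5"
proof -
  have "k mod 6 < 6" by simp
  then show ?thesis using that hexdir_mod[of k] by (elim less6_cases) (auto simp: hexdir_values)
qed

lemma hexdir_eq_iff: "hexdir i = hexdir j \<longleftrightarrow> i mod 6 = j mod 6"
  by (cases i rule: hexdir_cases; cases j rule: hexdir_cases) auto

lemma star_altdef: "star z = insert z (range (\<lambda>k. z + hexdir k))"
proof
  show "star z \<subseteq> insert z (range (\<lambda>k. z + hexdir k))"
  proof
    fix w assume "w \<in> star z"
    then have "w \<in> {z, z + hexdir 0, z + hexdir 1, z + hexdir 2, z + hexdir 3, z + hexdir 4, z + hexdir 5}"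
      by (auto simp: star_def hexdir_values zero_prod_def[symmetric])
    then show "w \<in> insert z (range (\<lambda>k. z + hexdir k))" by blast
  qed
  show "insert z (range (\<lambda>k. z + hexdir k)) \<subseteq> star z"
  proof
    fix w assume "w \<in> insert z (range (\<lambda>k. z + hexdir k))"
    then consider "w = z" | k where "w = z + hexdir k" by auto
    then show "w \<in> star z"
    proof cases
      case 1 then show ?thesis by (auto simp: star_def zero_prod_def[symmetric])
    next
      case 2 then show ?thesis by (cases k rule: hexdir_cases) (simp_all add: star_def)
    qed
  qed
qed

lemma hexdir_Suc: "hexdir (Suc k) = rot6 (hexdir k)" by (simp add: hexdir_def)

text \<open>The point group of the lattice, of order 12.\<close>
definition dihedral :: "(lat \<Rightarrow> lat) set" where
  "dihedral = {A. \<exists>k. A = rot6 ^^ k \<or> A = rot6 ^^ k \<circ> mir}"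

definition lattice_triangles :: "lat set set" where
  "lattice_triangles = range tri1 \<union> range tri2"

text \<open>Seen from one of its corners, every triangle is spanned by two consecutive edge directions.
  This is the form that matches links of vertices in a surface.\<close>
lemma lattice_triangles_altdef: "lattice_triangles = {{z, z + hexdir k, z + hexdir (Suc k)} | z k. True}"
proof
  show "lattice_triangles \<subseteq> {{z, z + hexdir k, z + hexdir (Suc k)} | z k. True}"
  proof
    fix t assume "t \<in> lattice_triangles"
    then consider z where "t = tri1 z" | z where "t = tri2 z" by (auto simp: lattice_triangles_def)
    then show "t \<in> {{z, z + hexdir k, z + hexdir (Suc k)} | z k. True}"
    proof cases
      case 1
      then have "t = {z, z + hexdir 0, z + hexdir (Suc 0)}" by (simp add: tri1_def hexdir_values)
      then show ?thesis by blast
    next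
      case 2
      then have "t = {z, z + hexdir 1, z + hexdir (Suc 1)}"
        by (auto simp: tri2_def hexdir_values numeral_2_eq_2[symmetric])
      then show ?thesis by blast
    qed
  qed
  show "{{z, z + hexdir k, z + hexdir (Suc k)} | z k. True} \<subseteq> lattice_triangles"
  proof clarify
    fix z :: lat and k
    have *: "tri1 z \<in> lattice_triangles" "tri2 z \<in> lattice_triangles" for z :: lat
      by (auto simp: lattice_triangles_def)
    obtain x y where z: "z = (x, y)" by force
    show "{z, z + hexdir k, z + hexdir (Suc k)} \<in> lattice_triangles"
      unfolding hexdir_Suc
      apply (cases k rule: hexdir_cases)
      subgoal using *(1)[of z] by (simp add: tri1_def)
      subgoal using *(2)[of z] by (simp add: tri2_def insert_commute)
      subgoal using *(1)[of "z + (-1, 0)"] by (simp add: tri1_def z insert_commute)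
      subgoal using *(2)[of "z + (-1, -1)"] by (simp add: tri2_def z insert_commute)
      subgoal using *(1)[of "z + (-1, -1)"] by (simp add: tri1_def z insert_commute)
      subgoal using *(2)[of "z + (0, -1)"] by (simp add: tri2_def z insert_commute)
      done
  qed
qed

section \<open>Hexagonal complexes and their flags\<close>

lemma mod6_add_cancel: "(i + j) mod 6 = (i + k) mod (6::nat) \<longleftrightarrow> j mod 6 = k mod 6"
proof
  assume "(i + j) mod 6 = (i + k) mod 6"
  then have "(i + j + 5 * i) mod 6 = (i + k + 5 * i) mod 6" by (rule mod_add_cong) simp
  moreover have "i + j + 5 * i = j + i * 6" "i + k + 5 * i = k + i * 6" by simp_all
  ultimately show "j mod 6 = k mod 6" by (simp only: mod_mult_self1)
qed (rule mod_add_cong, simp_all)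

lemma mod6_mult5_cancel: "(5 * j) mod 6 = (5 * k) mod (6::nat) \<longleftrightarrow> j mod 6 = k mod 6"
proof
  assume "(5 * j) mod 6 = (5 * k) mod 6"
  then have "(5 * (5 * j)) mod 6 = (5 * (5 * k)) mod 6" by (metis mod_mult_right_eq)
  moreover have "5 * (5 * j) = j + (4 * j) * 6" "5 * (5 * k) = k + (4 * k) * 6" by simp_all
  ultimately show "j mod 6 = k mod 6" by (simp only: mod_mult_self1)
qed (metis mod_mult_right_eq)

text \<open>The link of each vertex is a hexagon. It is presented as a sequence of period 6, so that
  rotating and reversing the hexagon are substitutions in the index and no cyclic indexing is
  needed.\<close>
locale hexagonal =
  fixes T :: "'v set set"
  assumes card3: "t \<in> T \<Longrightarrow> card t = 3"
    and link_ex: "a \<in> \<Union>T \<Longrightarrow> \<exists>x::nat \<Rightarrow> 'v. (\<forall>i j. x i = x j \<longleftrightarrow> i mod 6 = j mod 6) \<and>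
                   {t \<in> T. a \<in> t} = range (\<lambda>i. {a, x i, x (Suc i)})"
begin

definition link :: "'v \<Rightarrow> (nat \<Rightarrow> 'v) \<Rightarrow> bool" where
  "link a x \<longleftrightarrow> (\<forall>i j. x i = x j \<longleftrightarrow> i mod 6 = j mod 6) \<and>
                   {t \<in> T. a \<in> t} = range (\<lambda>i. {a, x i, x (Suc i)})"

lemma link_eq: "link a x \<Longrightarrow> x i = x j \<longleftrightarrow> i mod 6 = j mod 6" by (simp add: link_def)
lemma link_tri: "link a x \<Longrightarrow> {a, x i, x (Suc i)} \<in> T" unfolding link_def by blast
lemma link_triD: "link a x \<Longrightarrow> t \<in> T \<Longrightarrow> a \<in> t \<Longrightarrow> \<exists>i. t = {a, x i, x (Suc i)}"
  unfolding link_def by blast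

lemma tri_distinct: "{a, b, c} \<in> T \<Longrightarrow> a \<noteq> b \<and> a \<noteq> c \<and> b \<noteq> c"
  using card3[of "{a, b, c}"] by (auto simp: card_insert_if split: if_splits)

lemma link_shift: "link a x \<Longrightarrow> link a (\<lambda>k. x (i + k))"
proof -
  assume l: "link a x"
  have "range (\<lambda>k. {a, x (i + k), x (i + Suc k)}) = range (\<lambda>i. {a, x i, x (Suc i)})"
  proof
    show "range (\<lambda>i. {a, x i, x (Suc i)}) \<subseteq> range (\<lambda>k. {a, x (i + k), x (i + Suc k)})"
    proof clarify
      fix j
      have "i + (j + 5 * i) = j + i * 6" "i + Suc (j + 5 * i) = Suc j + i * 6" by simp_all
      then have "(i + (j + 5 * i)) mod 6 = j mod 6" "(i + Suc (j + 5 * i)) mod 6 = Suc j mod 6"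
        by (metis mod_mult_self1)+
      then have "x (i + (j + 5 * i)) = x j" "x (i + Suc (j + 5 * i)) = x (Suc j)"
        using link_eq[OF l] by blast+
      then have "{a, x j, x (Suc j)} = (\<lambda>k. {a, x (i + k), x (i + Suc k)}) (j + 5 * i)" by simp
      then show "{a, x j, x (Suc j)} \<in> range (\<lambda>k. {a, x (i + k), x (i + Suc k)})"
        by (rule range_eqI)
    qed
    have "{a, x (i + k), x (i + Suc k)} = {a, x (i + k), x (Suc (i + k))}" for k by simp
    then show "range (\<lambda>k. {a, x (i + k), x (i + Suc k)}) \<subseteq> range (\<lambda>i. {a, x i, x (Suc i)})"
      by blast
  qed
  then show ?thesis using l by (simp add: link_def mod6_add_cancel)
qed

text \<open>Multiplication by 5 is negation modulo 6 and stays within the natural numbers.\<close>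
lemma link_reverse: "link a x \<Longrightarrow> link a (\<lambda>k. x (5 * k))"
proof -
  assume l: "link a x"
  have "range (\<lambda>k. {a, x (5 * k), x (5 * Suc k)}) = range (\<lambda>i. {a, x i, x (Suc i)})"
  proof
    have "{a, x (5 * k), x (5 * Suc k)} = {a, x (5 * Suc k), x (Suc (5 * Suc k))}" for k
    proof -
      have "Suc (5 * Suc k) = 5 * k + 1 * 6" by simp
      then have "(5 * k) mod 6 = Suc (5 * Suc k) mod 6" by (metis mod_mult_self1)
      then have "x (5 * k) = x (Suc (5 * Suc k))" using link_eq[OF l] by blast
      then show ?thesis by auto
    qed
    then show "range (\<lambda>k. {a, x (5 * k), x (5 * Suc k)}) \<subseteq> range (\<lambda>i. {a, x i, x (Suc i)})" by blast
    show "range (\<lambda>i. {a, x i, x (Suc i)}) \<subseteq> range (\<lambda>k. {a, x (5 * k), x (5 * Suc k)})"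
    proof clarify
      fix j
      have "5 * (5 * Suc j) = Suc j + (4 * Suc j) * 6" "5 * Suc (5 * Suc j) = j + (4 * j + 5) * 6" by simp_all
      then have "(5 * (5 * Suc j)) mod 6 = Suc j mod 6" "(5 * Suc (5 * Suc j)) mod 6 = j mod 6"
        by (metis mod_mult_self1)+
      then have "x (5 * (5 * Suc j)) = x (Suc j)" "x (5 * Suc (5 * Suc j)) = x j"
        using link_eq[OF l] by blast+
      then have "{a, x j, x (Suc j)} = (\<lambda>k. {a, x (5 * k), x (5 * Suc k)}) (5 * Suc j)" by auto
      then show "{a, x j, x (Suc j)} \<in> range (\<lambda>k. {a, x (5 * k), x (5 * Suc k)})"
        by (rule range_eqI)
    qed
  qed
  then show ?thesis using l by (simp add: link_def mod6_mult5_cancel)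
qed

lemma flag_link:
  assumes "{a, b, c} \<in> T"
  obtains x where "link a x" "x 0 = b" "x 1 = c"
proof -
  have "a \<in> \<Union>T" using assms by blast
  then obtain x where l: "link a x" using link_ex unfolding link_def by blast
  obtain i where i: "{a, b, c} = {a, x i, x (Suc i)}" using link_triD[OF l assms] by blast
  have "a \<noteq> b" "a \<noteq> c" "b \<noteq> c" "a \<noteq> x i" "a \<noteq> x (Suc i)"
    using tri_distinct[OF assms] tri_distinct[OF link_tri[OF l, of i]] by auto
  with i consider "b = x i \<and> c = x (Suc i)" | "b = x (Suc i) \<and> c = x i"
    by (metis doubleton_eq_iff insert_ident insertE singletonD)
  then show thesis
  proof cases
    case 1
    then show thesis using that[OF link_shift[OF l, of i]] by simp
  next
    case 2
    have "link a (\<lambda>k. x (Suc i + 5 * k))" using link_reverse[OF link_shift[OF l, of "Suc i"]] .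
    moreover have "(Suc i + 5 * 1) mod 6 = i mod 6" by presburger
    then have "x (Suc i + 5 * 1) = x i" using link_eq[OF l] by blast
    ultimately show thesis using that 2 by (metis add.right_neutral mult_0_right)
  qed
qed

lemma link_third:
  assumes "link a x" "{a, x (Suc i), d} \<in> T"
  shows "d = x i \<or> d = x (Suc (Suc i))"
proof -
  obtain j where j: "{a, x (Suc i), d} = {a, x j, x (Suc j)}" using link_triD[OF assms] by blast
  have "a \<noteq> x (Suc i)" "a \<noteq> d" "x (Suc i) \<noteq> d" "a \<noteq> x j" "a \<noteq> x (Suc j)"
    using tri_distinct[OF assms(2)] tri_distinct[OF link_tri[OF assms(1), of j]] by auto
  with j consider "x (Suc i) = x j \<and> d = x (Suc j)" | "x (Suc i) = x (Suc j) \<and> d = x j"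
    by (metis doubleton_eq_iff insert_ident insertE singletonD)
  then show ?thesis
  proof cases
    case 1
    then have "Suc (Suc i) mod 6 = Suc j mod 6" using link_eq[OF assms(1)] by (metis mod_Suc_eq)
    then show ?thesis using 1 link_eq[OF assms(1)] by auto
  next
    case 2
    then have "i mod 6 = j mod 6" using link_eq[OF assms(1)] mod6_add_cancel[of 1 i j] by simp
    then show ?thesis using 2 link_eq[OF assms(1)] by auto
  qed
qed

text \<open>The apex of the other triangle on the edge \<open>ab\<close> of the triangle
  \<open>abc\<close>.\<close>
definition opp :: "'v \<Rightarrow> 'v \<Rightarrow> 'v \<Rightarrow> 'v" where
  "opp a b c = (THE d. d \<noteq> c \<and> {a, b, d} \<in> T)"

lemma opp_eqI:
  assumes "{a, b, c} \<in> T" "{a, b, d} \<in> T" "c \<noteq> d"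
  shows "opp a b c = d"
proof -
  obtain x where l: "link a x" "x 0 = b" "x 1 = c" using flag_link[OF assms(1)] .
  have b: "b = x (Suc 5)" using link_eq[OF l(1), of 0 "Suc 5"] l(2) by simp
  have *: "e = x 5 \<or> e = x (Suc (Suc 5))" if "{a, b, e} \<in> T" for e
    using link_third[OF l(1), of 5 e] that b by simp
  have "x (Suc (Suc 5)) = c" using link_eq[OF l(1), of 1 "Suc (Suc 5)"] l(3) by simp
  then have "e = x 5" if "{a, b, e} \<in> T" "e \<noteq> c" for e using * that by blast
  then show ?thesis unfolding opp_def using assms by (metis (mono_tags, lifting) the_equality)
qed

lemma opp_link:
  assumes "link a x"
  shows "opp a (x (Suc i)) (x i) = x (Suc (Suc i))" "opp a (x i) (x (Suc i)) = x (i + 5)"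
proof -
  have t: "{a, x (Suc i), x i} \<in> T" "{a, x (Suc i), x (Suc (Suc i))} \<in> T"
    using link_tri[OF assms, of i] link_tri[OF assms, of "Suc i"] by (simp_all add: insert_commute)
  have "i mod 6 \<noteq> Suc (Suc i) mod 6" by presburger
  then show "opp a (x (Suc i)) (x i) = x (Suc (Suc i))"
    using opp_eqI[OF t] link_eq[OF assms] by blast
  have "Suc (i + 5) mod 6 = i mod 6" by presburger
  then have e: "x (Suc (i + 5)) = x i" using link_eq[OF assms] by blast
  have t: "{a, x i, x (Suc i)} \<in> T" "{a, x i, x (i + 5)} \<in> T"
    using link_tri[OF assms, of i] link_tri[OF assms, of "i + 5"] e by (simp_all add: insert_commute)
  have "Suc i mod 6 \<noteq> (i + 5) mod 6" by presburger
  then show "opp a (x i) (x (Suc i)) = x (i + 5)"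
    using opp_eqI[OF t] link_eq[OF assms] by blast
qed

lemma opp_sym: "opp a b c = opp b a c" by (simp add: opp_def insert_commute)

lemma opp_tri:
  assumes "{a, b, c} \<in> T"
  shows "{a, b, opp a b c} \<in> T" "opp a b c \<noteq> c" "opp a b (opp a b c) = c"
proof -
  obtain x where l: "link a x" "x 0 = b" "x 1 = c" using flag_link[OF assms] .
  have o: "opp a b c = x 5" using opp_link(2)[OF l(1), of 0] l by simp
  have b: "x (Suc 5) = b" using link_eq[OF l(1), of 0 "Suc 5"] l(2) by simp
  show t: "{a, b, opp a b c} \<in> T" using link_tri[OF l(1), of 5] b o by (simp add: insert_commute)
  show n: "opp a b c \<noteq> c" using link_eq[OF l(1), of 5 1] l(3) o by simp
  show "opp a b (opp a b c) = c" using opp_eqI[OF t assms n] .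
qed

definition flag :: "'v \<times> 'v \<times> 'v \<Rightarrow> bool" where
  "flag f \<longleftrightarrow> (case f of (a, b, c) \<Rightarrow> {a, b, c} \<in> T)"

text \<open>The three generators of the symmetry group of the lattice, acting on flags: rotation about the
  vertex, half turn about the midpoint of the edge, reflection in the edge. A triple determines
  an orientation of its triangle, and \<open>frot\<close> turns in the corresponding sense. They
  fix all triples that are not flags, so that the relations between them are unconditional
  equations, usable for rewriting.\<close>
definition frot :: "'v \<times> 'v \<times> 'v \<Rightarrow> 'v \<times> 'v \<times> 'v" where
  "frot f = (if flag f then case f of (a, b, c) \<Rightarrow> (a, c, opp a c b) else f)"
definition fturn :: "'v \<times> 'v \<times> 'v \<Rightarrow> 'v \<times> 'v \<times> 'v" where
  "fturn f = (if flag f then case f of (a, b, c) \<Rightarrow> (b, a, opp a b c) else f)"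
definition fmir :: "'v \<times> 'v \<times> 'v \<Rightarrow> 'v \<times> 'v \<times> 'v" where
  "fmir f = (if flag f then case f of (a, b, c) \<Rightarrow> (a, b, opp a b c) else f)"

lemma flag_simp [simp]: "flag (a, b, c) \<longleftrightarrow> {a, b, c} \<in> T" by (simp add: flag_def)

lemma flag_frot [simp]: "flag (frot f) = flag f"
  using opp_tri(1) by (cases f) (auto simp: frot_def insert_commute)
lemma flag_fturn [simp]: "flag (fturn f) = flag f"
  using opp_tri(1) by (cases f) (auto simp: fturn_def insert_commute)
lemma flag_fmir [simp]: "flag (fmir f) = flag f"
  using opp_tri(1) by (cases f) (auto simp: fmir_def insert_commute)

lemma frot_link: "link a x \<Longrightarrow> frot (a, x i, x (Suc i)) = (a, x (Suc i), x (Suc (Suc i)))"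
  using link_tri opp_link by (auto simp: frot_def)

lemma frot_funpow_link: "link a x \<Longrightarrow> (frot ^^ k) (a, x i, x (Suc i)) = (a, x (i + k), x (Suc (i + k)))"
  by (induction k) (simp_all add: frot_link)

lemma frot6: "frot (frot (frot (frot (frot (frot f))))) = f"
proof (cases "flag f")
  case True
  obtain a b c where f: "f = (a, b, c)" by (cases f)
  then have tri: "{a, b, c} \<in> T" using True by simp
  obtain x where l: "link a x" "x 0 = b" "x 1 = c" using flag_link[OF tri] .
  have "(frot ^^ 6) (a, x 0, x (Suc 0)) = (a, x (0 + 6), x (Suc (0 + 6)))" using frot_funpow_link[OF l(1)] .
  moreover have "x (0 + 6) = x 0" "x (Suc (0 + 6)) = x (Suc 0)" using link_eq[OF l(1)] by simp_all
  ultimately show ?thesis using f l by (simp add: eval_nat_numeral)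
qed (simp add: frot_def)

lemma fturn2: "fturn (fturn f) = f"
proof (cases "flag f")
  case True
  obtain a b c where f: "f = (a, b, c)" by (cases f)
  then show ?thesis using True opp_tri[of a b c] by (simp add: fturn_def insert_commute opp_sym)
qed (simp add: fturn_def)

lemma fmir_fturn: "fmir (fturn f) = fturn (fmir f)"
proof (cases "flag f")
  case True
  obtain a b c where f: "f = (a, b, c)" by (cases f)
  then show ?thesis using True opp_tri[of a b c] by (simp add: fmir_def fturn_def insert_commute opp_sym)
qed (simp add: fmir_def fturn_def)

lemma fturn_frot: "{a, b, c} \<in> T \<Longrightarrow> fturn (frot (a, b, c)) = (c, a, b)"
  using opp_tri[of a c b] by (simp add: fturn_def frot_def insert_commute opp_sym)

text \<open>A product of a rotation by 60 degrees and a half turn is a rotation by 120 degrees about the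
  centre of the triangle. Together with \<open>frot6\<close> and \<open>fturn2\<close> this
  presents the rotation group of the lattice.\<close>
lemma fturn_frot3: "fturn (frot (fturn (frot (fturn (frot f))))) = f"
proof (cases "flag f")
  case True
  obtain a b c where f: "f = (a, b, c)" by (cases f)
  then show ?thesis using True by (simp add: fturn_frot insert_commute)
qed (simp add: fturn_def frot_def)

lemma frot_fmir_frot: "frot (fmir (frot f)) = fmir f"
proof (cases "flag f")
  case True
  obtain a b c where f: "f = (a, b, c)" by (cases f)
  then have tri: "{a, b, c} \<in> T" using True by simp
  obtain x where l: "link a x" "x 0 = b" "x 1 = c" using flag_link[OF tri] .
  have t: "{a, x 1, x 2} \<in> T" "{a, x 0, x 1} \<in> T"
    using link_tri[OF l(1), of 1] link_tri[OF l(1), of 0] by (simp_all add: numeral_2_eq_2)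
  have o: "opp a (x 0) (x 1) = x 5" "opp a (x 1) (x 2) = x 0" "opp a (x (Suc 0)) (x 0) = x 2"
    using opp_link(2)[OF l(1), of 0] opp_link(2)[OF l(1), of 1] opp_link(1)[OF l(1), of 0]
       link_eq[OF l(1), of 6 0] by (simp_all add: numeral_2_eq_2)
  show ?thesis using t o l f by (simp add: frot_def fmir_def insert_commute)
qed (simp add: fmir_def frot_def)

text \<open>The relation \<open>(t r)\<^sup>3 = 1\<close>, solved for \<open>t r t\<close>. Inverses of
  rotations are written as fifth powers.\<close>
lemma fturn_frot_fturn: "fturn (frot (fturn f)) = frot (frot (frot (frot (frot (fturn (frot (frot (frot (frot (frot f))))))))))"
proof -
  have "fturn (frot (fturn (frot g))) = frot (frot (frot (frot (frot (fturn g)))))" for g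
    using fturn_frot3[of g] by (metis fturn2 frot6)
  from this[of "frot (frot (frot (frot (frot f))))"] show ?thesis by (simp add: frot6)
qed

text \<open>The unit translations in the directions \<open>(1,0)\<close> and \<open>(1,1)\<close>: turn to
  the neighbour ahead, which leaves the flag looking backwards, and rotate until it looks in the
  old direction again. For \<open>fY\<close> the flag is first rotated by one step. The primed
  versions are the inverses.\<close>
definition fX where "fX f = frot (frot (frot (fturn f)))"
definition fY where "fY f = frot (frot (fturn (frot f)))"
definition fX' where "fX' f = fturn (frot (frot (frot f)))"
definition fY' where "fY' f = frot (frot (frot (frot (frot (fturn (frot (frot (frot (frot f)))))))))"

lemma fXX' [simp]: "fX (fX' f) = f" "fX' (fX f) = f" by (simp_all add: fX_def fX'_def frot6 fturn2)
lemma fYY' [simp]: "fY (fY' f) = f" "fY' (fY f) = f" by (simp_all add: fY_def fY'_def frot6 fturn2)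

lemma fturn_frot2_fturn: "fturn (frot (frot (fturn f))) =
   frot (frot (frot (frot (frot (fturn (frot (frot (frot (frot (fturn (frot (frot (frot (frot (frot f)))))))))))))))"
proof -
  have "fturn (frot (frot (fturn f))) = fturn (frot (fturn (fturn (frot (fturn f)))))"
    by (simp only: fturn2)
  also have "\<dots> = frot (frot (frot (frot (frot (fturn (frot (frot (frot (frot (fturn (frot (frot (frot (frot (frot f)))))))))))))))"
    by (simp only: fturn_frot_fturn frot6)
  finally show ?thesis .
qed

text \<open>Commutation of the two translations is a consequence of the relations alone. It is what makes
  a walk through the surface depend only on its displacement.\<close>
lemma fXY: "fX (fY f) = fY (fX f)"
proof -
  have "frot (frot (frot (fturn (frot (frot (fturn (frot f))))))) = frot (frot (fturn (frot (frot (frot (frot (fturn f)))))))"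
    by (subst fturn_frot2_fturn) (simp only: frot6)
  then show ?thesis unfolding fX_def fY_def .
qed

lemma flag_fX [simp]: "flag (fX f) = flag f" "flag (fY f) = flag f" "flag (fX' f) = flag f" "flag (fY' f) = flag f"
  by (simp_all only: fX_def fY_def fX'_def fY'_def flag_frot flag_fturn)

end


declare split_paired_All [simp del] split_paired_Ex [simp del]

context hexagonal begin

section \<open>Developing maps\<close>

text \<open>A developing map rolls the lattice over the surface and records, for each lattice point, the
  flag on which the lattice point and its edge in direction \<open>(1,0)\<close> come to lie.\<close>
definition developing :: "(lat \<Rightarrow> 'v \<times> 'v \<times> 'v) \<Rightarrow> bool" where
  "developing D \<longleftrightarrow> (\<forall>z. flag (D z) \<and> D (z + (1, 0)) = fX (D z) \<and> D (z + (1, 1)) = fY (D z))"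

lemma developing_steps:
  assumes "developing D"
  shows "D (z + (1, 0)) = fX (D z)" "D (z + (1, 1)) = fY (D z)"
    "D (z + (-1, 0)) = fX' (D z)" "D (z + (-1, -1)) = fY' (D z)"
    "D (z + (0, 1)) = fX' (fY (D z))" "D (z + (0, -1)) = fY' (fX (D z))"
proof -
  show X: "D (z + (1, 0)) = fX (D z)" and Y: "D (z + (1, 1)) = fY (D z)" for z
    using assms unfolding developing_def by blast+
  show X': "D (z + (-1, 0)) = fX' (D z)" for z
  proof -
    have e: "z + (-1, 0) + (1, 0) = z" by (simp add: prod_eq_iff)
    show ?thesis using X[of "z + (-1, 0)"] unfolding e by simp
  qed
  show Y': "D (z + (-1, -1)) = fY' (D z)" for z
  proof -
    have e: "z + (-1, -1) + (1, 1) = z" by (simp add: prod_eq_iff)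
    show ?thesis using Y[of "z + (-1, -1)"] unfolding e by simp
  qed
  have e: "z + (0, 1) = z + (1, 1) + (-1, 0)" "z + (0, -1) = z + (1, 0) + (-1, -1)"
    by (simp_all add: prod_eq_iff)
  show "D (z + (0, 1)) = fX' (fY (D z))" "D (z + (0, -1)) = fY' (fX (D z))"
    unfolding e by (simp_all only: X Y X' Y')
qed

text \<open>Two equal flags spread over the whole lattice, because every lattice point is reached by unit
  steps.\<close>
lemma developing_unique:
  assumes "developing D" "developing E" "D a = E a"
  shows "D = E"
proof -
  define f where "f i j = a + (i, 0) + (j, j)" for i j :: int
  have s: "f (i + 1) j = f i j + (1, 0)" "f (i - 1) j = f i j + (-1, 0)"
     "f i (j + 1) = f i j + (1, 1)" "f i (j - 1) = f i j + (-1, -1)" for i j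
    by (simp_all add: f_def prod_eq_iff)
  have 1: "D (f i 0) = E (f i 0)" for i
  proof (induction i rule: int_induct[where k = 0])
    case base then show ?case using assms(3) by (simp add: f_def zero_prod_def[symmetric])
  next
    case (step1 i) then show ?case using developing_steps[OF assms(1)] developing_steps[OF assms(2)] by (simp add: s)
  next
    case (step2 i) then show ?case using developing_steps[OF assms(1)] developing_steps[OF assms(2)] by (simp add: s)
  qed
  have 2: "D (f i j) = E (f i j)" for i j
  proof (induction j rule: int_induct[where k = 0])
    case base then show ?case by (rule 1)
  next
    case (step1 j) then show ?case using developing_steps[OF assms(1)] developing_steps[OF assms(2)] by (simp add: s)
  next
    case (step2 j) then show ?case using developing_steps[OF assms(1)] developing_steps[OF assms(2)] by (simp add: s)
  qed
  show ?thesis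
  proof
    fix z
    have "z = f ((fst z - fst a) - (snd z - snd a)) (snd z - snd a)" by (simp add: f_def prod_eq_iff)
    then show "D z = E z" using 2 by metis
  qed
qed

text \<open>Integer powers of a bijection with inverse \<open>G\<close>.\<close>
definition zpow :: "('b \<Rightarrow> 'b) \<Rightarrow> ('b \<Rightarrow> 'b) \<Rightarrow> int \<Rightarrow> 'b \<Rightarrow> 'b" where
  "zpow F G i = (if 0 \<le> i then F ^^ nat i else G ^^ nat (- i))"

lemma zpow_Suc:
  assumes "\<And>x. F (G x) = x"
  shows "zpow F G (i + 1) x = F (zpow F G i x)"
proof (cases "0 \<le> i")
  case True
  then have "nat (i + 1) = Suc (nat i)" by simp
  then show ?thesis using True by (simp add: zpow_def)
next
  case False
  then have "nat (- i) = Suc (nat (- (i + 1)))" by simp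
  then show ?thesis using False assms by (auto simp: zpow_def)
qed

lemma zpow_commute:
  assumes "\<And>x. H (F x) = F (H x)" "\<And>x. H (G x) = G (H x)"
  shows "H (zpow F G i x) = zpow F G i (H x)"
proof -
  have "H ((F ^^ k) x) = (F ^^ k) (H x)" "H ((G ^^ k) x) = (G ^^ k) (H x)" for k
    by (induction k) (simp_all add: assms)
  then show ?thesis by (simp add: zpow_def)
qed

lemma fX'Y: "fX' (fY f) = fY (fX' f)"
  using fXY[of "fX' f"] by (metis fXX')

lemma zpow_flag:
  assumes "\<And>x. flag (F x) = flag x" "\<And>x. flag (G x) = flag x"
  shows "flag (zpow F G i x) = flag x"
proof -
  have "flag ((F ^^ k) x) = flag x" "flag ((G ^^ k) x) = flag x" for k
    by (induction k) (simp_all add: assms)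
  then show ?thesis by (simp add: zpow_def)
qed

text \<open>Any flag starts a developing map: \<open>D (i, j)\<close> applies the power \<open>i -
  j\<close> of \<open>fX\<close> and the power \<open>j\<close> of \<open>fY\<close>.
  Consistency is the commutation \<open>fXY\<close>.\<close>
lemma developing_exists:
  assumes "flag f"
  obtains D where "developing D" "D 0 = f"
proof
  define D where "D z = zpow fX fX' (fst z - snd z) (zpow fY fY' (snd z) f)" for z
  show "developing D"
    unfolding developing_def
  proof (intro allI conjI)
    fix z
    show "flag (D z)" unfolding D_def by (simp add: zpow_flag assms)
    have "fst (z + (1, 0)) - snd (z + (1, 0)) = (fst z - snd z) + 1" "snd (z + (1, 0)) = snd z" by simp_all
    then show "D (z + (1, 0)) = fX (D z)" unfolding D_def by (simp only: zpow_Suc[of fX fX', OF fXX'(1)])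
    have "fst (z + (1, 1)) - snd (z + (1, 1)) = fst z - snd z" "snd (z + (1, 1)) = snd z + 1" by simp_all
    moreover have "fY (zpow fX fX' i g) = zpow fX fX' i (fY g)" for i g
      by (rule zpow_commute) (simp_all add: fXY fX'Y)
    ultimately show "D (z + (1, 1)) = fY (D z)" unfolding D_def by (simp only: zpow_Suc[of fY fY', OF fYY'(1)])
  qed
  show "D 0 = f" by (simp add: D_def zpow_def)
qed

lemma fturn_frot5_fturn: "fturn (frot (frot (frot (frot (frot (fturn f)))))) = frot (fturn (frot f))"
proof -
  have "fturn (frot (fturn (frot (fturn (frot f))))) = f" by (rule fturn_frot3)
  then have "frot (frot (frot (frot (frot (fturn f))))) = frot (frot (frot (frot (frot (fturn (fturn (frot (fturn (frot (fturn (frot f)))))))))))"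
    by simp
  also have "\<dots> = fturn (frot (fturn (frot f)))" by (simp only: fturn2 frot6)
  finally show ?thesis by (simp add: fturn2)
qed

lemma fX'Y_altdef: "fX' (fY f) = frot (fturn (frot (frot f)))"
  unfolding fX'_def fY_def by (simp only: fturn_frot5_fturn)

text \<open>Rotating the lattice and correcting each flag by the rotation gives another developing map;
  this and \<open>developing_fmir\<close> are the sources of deck transformations.\<close>
lemma developing_frot:
  assumes "developing D"
  shows "developing (\<lambda>z. frot (D (rot6 z + w)))"
  unfolding developing_def
proof (intro allI conjI)
  fix z
  show "flag (frot (D (rot6 z + w)))" using assms unfolding developing_def flag_frot flag_fmir by blast
  have e: "rot6 (z + (1, 0)) + w = rot6 z + w + (1, 1)" "rot6 (z + (1, 1)) + w = rot6 z + w + (0, 1)"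
    by (simp_all add: rot6_add prod_eq_iff)
  show "frot (D (rot6 (z + (1, 0)) + w)) = fX (frot (D (rot6 z + w)))"
    unfolding e developing_steps[OF assms] by (simp add: fX_def fY_def)
  show "frot (D (rot6 (z + (1, 1)) + w)) = fY (frot (D (rot6 z + w)))"
    unfolding e developing_steps[OF assms] fX'Y_altdef by (simp add: fY_def)
qed

lemma fmir_frot: "fmir (frot f) = frot (frot (frot (frot (frot (fmir f)))))"
  using frot_fmir_frot[of f] by (metis frot6)

lemma fY'X_altdef: "fY' (fX f) = frot (frot (frot (frot (fturn (frot (frot (frot (frot (frot f)))))))))"
  unfolding fY'_def fX_def by (simp only: frot6 fturn_frot_fturn)

lemma developing_fmir:
  assumes "developing D"
  shows "developing (\<lambda>z. fmir (D (mir z + w)))"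
  unfolding developing_def
proof (intro allI conjI)
  fix z
  show "flag (fmir (D (mir z + w)))" using assms unfolding developing_def flag_frot flag_fmir by blast
  have e: "mir (z + (1, 0)) + w = mir z + w + (1, 0)" "mir (z + (1, 1)) + w = mir z + w + (0, -1)"
    by (simp_all add: mir_add prod_eq_iff)
  show "fmir (D (mir (z + (1, 0)) + w)) = fX (fmir (D (mir z + w)))"
    unfolding e developing_steps[OF assms] by (simp only: fX_def fmir_frot fmir_fturn frot6)
  show "fmir (D (mir (z + (1, 1)) + w)) = fY (fmir (D (mir z + w)))"
    unfolding e developing_steps[OF assms] fY'X_altdef by (simp only: fY_def fmir_frot fmir_fturn frot6)
qed


lemma fst_frot_funpow [simp]: "fst ((frot ^^ k) f) = fst f"
proof -
  have "fst (frot f) = fst f" for f by (cases f) (simp add: frot_def)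
  then show ?thesis by (induction k) simp_all
qed

lemma fst_frot [simp]: "fst (frot f) = fst f" by (cases f) (simp add: frot_def)
lemma fst_fmir [simp]: "fst (fmir f) = fst f" by (cases f) (simp add: fmir_def)

lemma developing_frot_funpow:
  assumes "developing D"
  shows "developing (\<lambda>z. (frot ^^ k) (D ((rot6 ^^ k) (z - a) + b)))"
proof (induction k)
  case 0
  have e: "z + c - a + b = z - a + b + c" for z c :: lat by simp
  show ?case unfolding developing_def funpow_0 e developing_steps[OF assms]
    using assms unfolding developing_def by blast
next
  case (Suc k)
  have e: "(rot6 ^^ k) (rot6 z + (a - rot6 a) - a) + b = (rot6 ^^ Suc k) (z - a) + b" for z
  proof -
    have "rot6 z + (a - rot6 a) - a = rot6 (z - a)" by (simp add: rot6_diff)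
    then show ?thesis by (simp only: funpow_Suc_right o_def)
  qed
  show ?case using developing_frot[OF Suc, of "a - rot6 a"] unfolding e by simp
qed

text \<open>Flags at the same vertex with the same orientation differ by a rotation; by uniqueness the two
  developing maps differ by the corresponding rotation of the lattice.\<close>
lemma developing_match_direct:
  assumes "developing D" "developing E" "link v x" "D a = (v, x i, x (Suc i))" "E b = (v, x 0, x (Suc 0))"
  shows "fst (D (a + u)) = fst (E (b + (rot6 ^^ i) u))"
proof -
  have "(rot6 ^^ i) 0 = 0" using funpow_rot6_diff[of i 0 0] by simp
  then have "(frot ^^ i) (E ((rot6 ^^ i) (a - a) + b)) = D a"
    using assms frot_funpow_link[OF assms(3), of i 0] by simp
  then have "(\<lambda>z. (frot ^^ i) (E ((rot6 ^^ i) (z - a) + b))) = D"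
    using developing_unique[OF developing_frot_funpow[OF assms(2)] assms(1)] by blast
  then have "D (a + u) = (frot ^^ i) (E ((rot6 ^^ i) (a + u - a) + b))" by metis
  then show ?thesis by (simp add: add.commute)
qed

end

lemma mir_rot6: "mir (rot6 z) = (rot6 ^^ 5) (mir z)"
  by (cases z) (simp add: eval_nat_numeral)

lemma mir_rot6_funpow: "mir ((rot6 ^^ j) z) = (rot6 ^^ (5 * j)) (mir z)"
proof (induction j)
  case (Suc j)
  have "mir ((rot6 ^^ Suc j) z) = (rot6 ^^ 5) ((rot6 ^^ (5 * j)) (mir z))"
    using Suc by (simp add: mir_rot6)
  also have "\<dots> = (rot6 ^^ (5 + 5 * j)) (mir z)" unfolding funpow_add by simp
  finally show ?case by simp
qed simp

lemma mir_hexdir: "mir (hexdir j) = hexdir (5 * j)"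
proof -
  have "mir (hexdir 0) = hexdir 0" by (simp add: hexdir_values)
  then show ?thesis using mir_rot6_funpow[of j "(1, 0)"] by (simp add: hexdir_def)
qed

lemma dihedral_intros: "rot6 ^^ k \<in> dihedral" "rot6 ^^ k \<circ> mir \<in> dihedral" "mir \<circ> rot6 ^^ k \<in> dihedral"
proof -
  show "rot6 ^^ k \<in> dihedral" "rot6 ^^ k \<circ> mir \<in> dihedral" by (auto simp: dihedral_def)
  have "mir \<circ> rot6 ^^ k = rot6 ^^ (5 * k) \<circ> mir" by (rule ext) (simp add: mir_rot6_funpow)
  then show "mir \<circ> rot6 ^^ k \<in> dihedral" by (auto simp: dihedral_def)
qed

lemma dihedral_cases:
  assumes "A \<in> dihedral"
  obtains k where "A = rot6 ^^ k" | k where "A = rot6 ^^ k \<circ> mir"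
  using assms by (auto simp: dihedral_def)

lemma dihedral_add: "A \<in> dihedral \<Longrightarrow> A (z + w) = A z + A w"
  by (elim dihedral_cases) (simp_all add: funpow_rot6_add mir_add)
lemma dihedral_diff: "A \<in> dihedral \<Longrightarrow> A (z - w) = A z - A w"
  by (elim dihedral_cases) (simp_all add: funpow_rot6_diff mir_diff)
lemma dihedral_zero: "A \<in> dihedral \<Longrightarrow> A 0 = 0"
  using dihedral_diff[of A 0 0] by simp

lemma dihedral_comp: "A \<in> dihedral \<Longrightarrow> B \<in> dihedral \<Longrightarrow> A \<circ> B \<in> dihedral"
proof (elim dihedral_cases)
  fix k l assume "A = rot6 ^^ k" "B = rot6 ^^ l"
  then show ?thesis using dihedral_intros(1)[of "k + l"] by (simp add: funpow_add)
next
  fix k l assume "A = rot6 ^^ k" "B = rot6 ^^ l \<circ> mir"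
  then show ?thesis using dihedral_intros(2)[of "k + l"] by (simp add: funpow_add o_assoc)
next
  fix k l assume "A = rot6 ^^ k \<circ> mir" "B = rot6 ^^ l"
  then have "A \<circ> B = rot6 ^^ (k + 5 * l) \<circ> mir"
    by (intro ext) (simp add: funpow_add mir_rot6_funpow)
  then show ?thesis by (simp add: dihedral_intros)
next
  fix k l assume "A = rot6 ^^ k \<circ> mir" "B = rot6 ^^ l \<circ> mir"
  then have "A \<circ> B = rot6 ^^ (k + 5 * l)"
    by (intro ext) (simp add: funpow_add mir_rot6_funpow mir_mir)
  then show ?thesis by (simp add: dihedral_intros)
qed

lemma dihedral_inverse:
  assumes "A \<in> dihedral"
  obtains B where "B \<in> dihedral" "A \<circ> B = id" "B \<circ> A = id"
proof -
  have r: "rot6 ^^ (5 * k) \<circ> rot6 ^^ k = id" "rot6 ^^ k \<circ> rot6 ^^ (5 * k) = id" for k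
  proof -
    have "rot6 ^^ (5 * k + k) = id" "rot6 ^^ (k + 5 * k) = id"
      using rot6_funpow_mod[of "6 * k"] by (simp_all add: id_def)
    then show "rot6 ^^ (5 * k) \<circ> rot6 ^^ k = id" "rot6 ^^ k \<circ> rot6 ^^ (5 * k) = id"
      by (simp_all only: funpow_add)
  qed
  have m: "mir \<circ> mir = id" by (rule ext) (simp add: mir_mir)
  show thesis using assms
  proof (cases A rule: dihedral_cases)
    case (1 k)
    then show thesis using that[of "rot6 ^^ (5 * k)"] r by (simp add: dihedral_intros)
  next
    case (2 k)
    have "rot6 ^^ k \<circ> mir \<circ> (mir \<circ> rot6 ^^ (5 * k)) = id" "mir \<circ> rot6 ^^ (5 * k) \<circ> (rot6 ^^ k \<circ> mir) = id"
      using m r[of k] by (metis comp_assoc comp_id id_comp)+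
    then show thesis using that[of "mir \<circ> rot6 ^^ (5 * k)"] 2 by (simp add: dihedral_intros)
  qed
qed

lemma dihedral_hexdir:
  assumes "A \<in> dihedral"
  shows "\<exists>i. A (hexdir j) = hexdir i \<and> A (hexdir (Suc j)) = hexdir (Suc i) \<or>
             A (hexdir j) = hexdir (Suc i) \<and> A (hexdir (Suc j)) = hexdir i"
  using assms
proof (cases A rule: dihedral_cases)
  case (1 k)
  have "A (hexdir j) = hexdir (k + j)" for j by (simp add: 1 hexdir_def funpow_add)
  then show ?thesis by (metis add_Suc_right)
next
  case (2 k)
  have A: "A (hexdir j) = hexdir (k + 5 * j)" for j
    using mir_hexdir[of j] by (simp add: 2 hexdir_def funpow_add)
  have "k + 5 * j + 6 = Suc (k + 5 * Suc j)" by simp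
  then have "(k + 5 * j) mod 6 = Suc (k + 5 * Suc j) mod 6" by (metis mod_add_self2)
  then have "A (hexdir j) = hexdir (Suc (k + 5 * Suc j))" using A hexdir_eq_iff by metis
  then show ?thesis using A by blast
qed

lemma triangle_at:
  assumes "t \<in> lattice_triangles" "w \<in> t"
  obtains k where "t = {w, w + hexdir k, w + hexdir (Suc k)}"
proof -
  consider z where "t = tri1 z" | z where "t = tri2 z" using assms(1) by (auto simp: lattice_triangles_def)
  then show thesis
  proof cases
    case 1
    then consider "w = z" | "w = z + (1, 0)" | "w = z + (1, 1)" using assms(2) by (auto simp: tri1_def)
    then show thesis
    proof cases
      case a: 1 show thesis by (rule that[of 0]) (use a 1 in \<open>simp add: tri1_def hexdir_values\<close>)
    next
      case a: 2 show thesis by (rule that[of 2])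
        (use a 1 in \<open>cases z; simp add: tri1_def hexdir_values hexdir_Suc insert_commute\<close>)
    next
      case a: 3 show thesis by (rule that[of 4])
        (use a 1 in \<open>cases z; simp add: tri1_def hexdir_values hexdir_Suc insert_commute\<close>)
    qed
  next
    case 2
    then consider "w = z" | "w = z + (0, 1)" | "w = z + (1, 1)" using assms(2) by (auto simp: tri2_def)
    then show thesis
    proof cases
      case a: 1 show thesis by (rule that[of 1])
         (use a 2 in \<open>cases z; simp add: tri2_def hexdir_values hexdir_Suc insert_commute\<close>)
    next
      case a: 2
      have "hexdir (Suc 5) = (1, 0)" using hexdir_mod[of 6] by (simp add: hexdir_values)
      then show thesis by (intro that[of 5])
        (use a 2 in \<open>cases z; simp add: tri2_def hexdir_values insert_commute\<close>)
    next
      case a: 3 show thesis by (rule that[of 3])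
        (use a 2 in \<open>cases z; simp add: tri2_def hexdir_values hexdir_Suc insert_commute\<close>)
    qed
  qed
qed

lemma triangle_in: "{w, w + hexdir k, w + hexdir (Suc k)} \<in> lattice_triangles"
  unfolding lattice_triangles_altdef by blast

context hexagonal begin

text \<open>Any two flags at a common vertex differ by a rotation, possibly after a reflection.\<close>
lemma developing_match:
  assumes "developing D" "developing E" "fst (D a) = fst (E b)"
  obtains A where "A \<in> dihedral" "\<And>u. fst (D (a + u)) = fst (E (b + A u))"
proof -
  obtain v p q where E: "E b = (v, p, q)" by (cases "E b")
  obtain r s where D: "D a = (v, r, s)" using assms(3) E by (cases "D a") simp
  have fE: "flag (E b)" and fD: "flag (D a)" using assms unfolding developing_def by blast+
  then have tE: "{v, p, q} \<in> T" and tD: "{v, r, s} \<in> T" using E D by simp_all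
  obtain x where x: "link v x" "x 0 = p" "x 1 = q" using flag_link[OF tE] .
  obtain i where i: "{v, r, s} = {v, x i, x (Suc i)}" using link_triD[OF x(1) tD] by blast
  have "v \<noteq> r" "v \<noteq> s" "r \<noteq> s" "v \<noteq> x i" "v \<noteq> x (Suc i)"
    using tri_distinct[OF tD] tri_distinct[OF link_tri[OF x(1), of i]] by auto
  with i consider "r = x i \<and> s = x (Suc i)" | "r = x (Suc i) \<and> s = x i"
    by (metis doubleton_eq_iff insert_ident insertE singletonD)
  then show thesis
  proof cases
    case 1
    show thesis
    proof (rule that[of "rot6 ^^ i"])
      show "fst (D (a + u)) = fst (E (b + (rot6 ^^ i) u))" for u
        by (rule developing_match_direct[OF assms(1,2) x(1)]) (use 1 x D E in simp_all)
    qed (rule dihedral_intros)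
  next
    case 2
    define y where "y k = x (5 * k)" for k
    have y: "link v y" using link_reverse[OF x(1)] by (simp add: y_def[abs_def])
    define F where "F z = fmir (E (mir z + (b - mir b)))" for z
    have F: "developing F" using developing_fmir[OF assms(2)] by (simp add: F_def[abs_def])
    have o: "opp v (x 0) (x 1) = x 5" using opp_link(2)[OF x(1), of 0] by simp
    have Fb: "F b = (v, y 0, y (Suc 0))" using E tE x o by (simp add: F_def fmir_def y_def)
    define j where "j = 5 * Suc i"
    have "5 * j = Suc i + (4 * Suc i) * 6" "5 * Suc j = i + (4 * i + 5) * 6" by (simp_all add: j_def)
    then have "5 * j mod 6 = Suc i mod 6" "5 * Suc j mod 6 = i mod 6" by (metis mod_mult_self1)+
    then have "y j = x (Suc i)" "y (Suc j) = x i" unfolding y_def using link_eq[OF x(1)] by blast+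
    then have Da: "D a = (v, y j, y (Suc j))" using 2 D by simp
    show thesis
    proof (rule that[of "mir \<circ> rot6 ^^ j"])
      fix u
      have "fst (D (a + u)) = fst (F (b + (rot6 ^^ j) u))"
        by (rule developing_match_direct[OF assms(1) F y Da Fb])
      also have "\<dots> = fst (E (b + mir ((rot6 ^^ j) u)))" by (simp add: F_def mir_add add_ac)
      finally show "fst (D (a + u)) = fst (E (b + (mir \<circ> rot6 ^^ j) u))" by simp
    qed (rule dihedral_intros)
  qed
qed

text \<open>A simplicial map that is injective on vertex stars. Such maps are exactly the underlying maps
  of developing maps (\<open>developing_star_flag\<close> and
  \<open>local_map_developing\<close>).\<close>
definition local_map :: "(lat \<Rightarrow> 'v) \<Rightarrow> bool" where
  "local_map \<phi> \<longleftrightarrow> (\<forall>t\<in>lattice_triangles. \<phi> ` t \<in> T) \<and> (\<forall>z. inj_on \<phi> (star z))"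

definition star_flag :: "(lat \<Rightarrow> 'v) \<Rightarrow> lat \<Rightarrow> nat \<Rightarrow> 'v \<times> 'v \<times> 'v" where
  "star_flag \<phi> w k = (\<phi> w, \<phi> (w + hexdir k), \<phi> (w + hexdir (Suc k)))"

lemma local_map_tri: "local_map \<phi> \<Longrightarrow> {\<phi> w, \<phi> (w + hexdir k), \<phi> (w + hexdir (Suc k))} \<in> T"
proof -
  assume "local_map \<phi>"
  then have "\<phi> ` {w, w + hexdir k, w + hexdir (Suc k)} \<in> T" using triangle_in by (simp only: local_map_def)
  then show ?thesis by simp
qed

lemma local_map_inj: "local_map \<phi> \<Longrightarrow> \<phi> (w + hexdir i) = \<phi> (w + hexdir j) \<longleftrightarrow> i mod 6 = j mod 6"
proof -
  assume "local_map \<phi>"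
  then have "inj_on \<phi> (star w)" by (simp add: local_map_def)
  moreover have "w + hexdir i \<in> star w" "w + hexdir j \<in> star w" by (auto simp: star_altdef)
  ultimately show ?thesis by (simp add: inj_on_eq_iff hexdir_eq_iff)
qed

lemma mod6_Suc2: "(k::nat) mod 6 \<noteq> Suc (Suc k) mod 6" by presburger

lemma frot_star_flag: "local_map \<phi> \<Longrightarrow> frot (star_flag \<phi> w k) = star_flag \<phi> w (Suc k)"
  using local_map_tri[of \<phi> w k] local_map_tri[of \<phi> w "Suc k"]
    opp_eqI[of "\<phi> w" "\<phi> (w + hexdir (Suc k))" "\<phi> (w + hexdir k)" "\<phi> (w + hexdir (Suc (Suc k)))"]
    local_map_inj[of \<phi> w k "Suc (Suc k)"] mod6_Suc2[of k]
  by (simp add: star_flag_def frot_def insert_commute)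

lemma star_flag_mod: "k mod 6 = l mod 6 \<Longrightarrow> star_flag \<phi> w k = star_flag \<phi> w l"
  using hexdir_eq_iff[of k l] mod6_add_cancel[of 1 k l] hexdir_eq_iff[of "Suc k" "Suc l"]
  by (simp add: star_flag_def)

lemma fturn_star_flag:
  assumes "local_map \<phi>"
  shows "fturn (star_flag \<phi> w k) = star_flag \<phi> (w + hexdir k) (Suc (Suc (Suc k)))"
proof -
  have e: "hexdir k + hexdir (Suc (Suc (Suc k))) = 0"
    "hexdir k + hexdir (Suc (Suc (Suc (Suc k)))) = hexdir (Suc (Suc (Suc (Suc (Suc k)))))"
    unfolding hexdir_Suc by (cases k rule: hexdir_cases; simp add: zero_prod_def)+
  have m: "hexdir (Suc (Suc (Suc (Suc (Suc (Suc k)))))) = hexdir k" unfolding hexdir_eq_iff by presburger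
  have "{\<phi> w, \<phi> (w + hexdir k), \<phi> (w + hexdir (Suc (Suc (Suc (Suc (Suc k))))))} \<in> T"
    using local_map_tri[OF assms, of w "Suc (Suc (Suc (Suc (Suc k))))"] unfolding m by (simp add: insert_commute)
  moreover have "Suc (Suc (Suc (Suc (Suc k)))) mod 6 \<noteq> Suc k mod 6" by presburger
  ultimately have "opp (\<phi> w) (\<phi> (w + hexdir k)) (\<phi> (w + hexdir (Suc k))) = \<phi> (w + hexdir (Suc (Suc (Suc (Suc (Suc k))))))"
    using opp_eqI[OF local_map_tri[OF assms, of w k]] local_map_inj[OF assms] by metis
  then show ?thesis using local_map_tri[OF assms, of w k]
    by (simp add: star_flag_def fturn_def add.assoc e)
qed

lemma developing_star_flag:
  assumes "local_map \<phi>"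
  shows "developing (\<lambda>z. star_flag \<phi> z 0)"
  unfolding developing_def
proof (intro allI conjI)
  fix z
  show "flag (star_flag \<phi> z 0)" using local_map_tri[OF assms] by (simp add: star_flag_def)
  have 6: "star_flag \<phi> w (Suc (Suc (Suc (Suc (Suc (Suc 0)))))) = star_flag \<phi> w 0" for w
    by (rule star_flag_mod) simp
  show "star_flag \<phi> (z + (1, 0)) 0 = fX (star_flag \<phi> z 0)"
    unfolding fX_def fturn_star_flag[OF assms] frot_star_flag[OF assms] 6 hexdir_values(1) ..
  show "star_flag \<phi> (z + (1, 1)) 0 = fY (star_flag \<phi> z 0)"
    unfolding fY_def fturn_star_flag[OF assms] frot_star_flag[OF assms] 6 hexdir_values(2) ..
qed

lemma frot_funpow_mod: "(frot ^^ k) f = (frot ^^ (k mod 6)) f"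
proof -
  have 6: "(frot ^^ 6) g = g" for g by (simp add: eval_nat_numeral frot6)
  have "(frot ^^ (6 * j)) g = g" for j g
  proof (induction j)
    case (Suc j)
    have "(frot ^^ (6 * Suc j)) g = (frot ^^ 6) ((frot ^^ (6 * j)) g)" by (simp only: mult_Suc_right funpow_add o_def)
    then show ?case using Suc 6 by simp
  qed simp
  then have "(frot ^^ (k mod 6 + 6 * (k div 6))) f = (frot ^^ (k mod 6)) f" by (simp only: funpow_add o_def)
  then show ?thesis by (simp only: mod_mult_div_eq)
qed

text \<open>Rotating the flag of \<open>D\<close> at \<open>z\<close> runs through the images of the six
  neighbours of \<open>z\<close>. Hence \<open>D\<close> is injective on the star of
  \<open>z\<close>, since consecutive rotations enumerate the link.\<close>
lemma developing_neighbour: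
  assumes "developing D"
  shows "(frot ^^ k) (D z) = (fst (D z), fst (D (z + hexdir k)), fst (D (z + hexdir (Suc k))))"
proof -
  have f: "flag (D z)" for z using assms unfolding developing_def by blast
  have s: "fst (snd g) = fst (fturn g)" if "flag g" for g using that by (cases g) (simp add: fturn_def)
  have fl: "flag ((frot ^^ k) (D z))" for k by (induction k) (simp_all add: f)
  have p: "(frot ^^ 2) g = frot (frot g)" "(frot ^^ 3) g = frot (frot (frot g))"
    "(frot ^^ 4) g = frot (frot (frot (frot g)))" "(frot ^^ 5) g = frot (frot (frot (frot (frot g))))" for g
    by (simp_all add: eval_nat_numeral)
  have 1: "fst (snd ((frot ^^ k) (D z))) = fst (D (z + hexdir k))" for k
  proof -
    have "fst (snd ((frot ^^ k) (D z))) = fst (fturn ((frot ^^ (k mod 6)) (D z)))"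
      using frot_funpow_mod[of k "D z"] s[OF fl[of k]] by metis
    also have "\<dots> = fst (D (z + hexdir k))"
      by (cases k rule: hexdir_cases)
         (simp_all add: developing_steps[OF assms] fX'Y_altdef fY'X_altdef p, simp_all add: fX_def fY_def fX'_def fY'_def)
    finally show ?thesis .
  qed
  have "snd (snd g) = fst (snd (frot g))" if "flag g" for g using that by (cases g) (simp add: frot_def)
  from this[OF fl[of k]] have 2: "snd (snd ((frot ^^ k) (D z))) = fst (D (z + hexdir (Suc k)))"
    using 1[of "Suc k"] by simp
  show ?thesis using 1 2 by (simp add: prod_eq_iff)
qed

lemma local_map_developing:
  assumes "developing D"
  shows "local_map (\<lambda>z. fst (D z))"
  unfolding local_map_def
proof (intro conjI ballI allI)
  have f: "flag (D z)" for z using assms unfolding developing_def by blast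
  have tri: "{fst (D z), fst (D (z + hexdir k)), fst (D (z + hexdir (Suc k)))} \<in> T" for z k
  proof -
    have "flag ((frot ^^ k) (D z))" by (induction k) (simp_all add: f)
    then show ?thesis by (simp add: developing_neighbour[OF assms])
  qed
  show "(\<lambda>z. fst (D z)) ` t \<in> T" if "t \<in> lattice_triangles" for t
    using that tri by (auto simp: lattice_triangles_altdef)
  fix z
  obtain v p q where D: "D z = (v, p, q)" by (cases "D z")
  obtain x where x: "link v x" "x 0 = p" "x 1 = q" using f[of z] flag_link[of v p q] D by auto
  have k: "fst (D (z + hexdir k)) = x k" for k
    using developing_neighbour[OF assms, of k z] frot_funpow_link[OF x(1), of k 0] D x by simp
  have "fst (D z) \<noteq> x k" for k using tri[of z k] k tri_distinct by metis
  then show "inj_on (\<lambda>z. fst (D z)) (star z)"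
    unfolding star_altdef inj_on_def using k link_eq[OF x(1)] hexdir_eq_iff by (auto dest!: sym[of "x _"])
qed

end

lemma hexdir_neq_0: "hexdir k \<noteq> 0"
  by (cases k rule: hexdir_cases) (simp_all add: zero_prod_def)

section \<open>Coverings by the triangular lattice\<close>

text \<open>The third clause says that points in one fibre are related by a lattice symmetry under which
  the map is invariant, that is, by a deck transformation. So fibres are orbits, and the complex
  is determined by the deck group.\<close>
definition hex_cover :: "(lat \<Rightarrow> 'v) \<Rightarrow> 'v set set \<Rightarrow> bool" where
  "hex_cover \<phi> K \<longleftrightarrow> K = generated_complex ((`) \<phi> ` lattice_triangles) \<and> (\<forall>z. inj_on \<phi> (star z)) \<and>
     (\<forall>z w. \<phi> z = \<phi> w \<longrightarrow> (\<exists>A\<in>dihedral. \<forall>u. \<phi> (z + u) = \<phi> (w + A u)))"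

text \<open>The image of a developing map is closed under passing to adjacent vertices, because it
  contains the link of each of its vertices; connectedness makes it everything. The third clause
  of \<open>hex_cover\<close> is \<open>developing_match\<close>.\<close>
lemma (in hexagonal) hex_cover_exists:
  assumes "T \<noteq> {}"
    and conn: "\<And>S. S \<noteq> {} \<Longrightarrow> S \<subseteq> \<Union>T \<Longrightarrow> (\<And>a b t. a \<in> S \<Longrightarrow> t \<in> T \<Longrightarrow> a \<in> t \<Longrightarrow> b \<in> t \<Longrightarrow> b \<in> S) \<Longrightarrow> S = \<Union>T"
  obtains \<phi> where "hex_cover \<phi> (generated_complex T)"
proof -
  obtain t where t: "t \<in> T" using assms(1) by blast
  obtain a b c where "t = {a, b, c}" using card3[OF t] by (auto simp: card_Suc_eq eval_nat_numeral)
  then have "flag (a, b, c)" using t by simp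
  then obtain D where D: "developing D" "D 0 = (a, b, c)" using developing_exists by blast
  define \<phi> where "\<phi> z = fst (D z)" for z
  have loc: "local_map \<phi>" using local_map_developing[OF D(1)] by (simp add: \<phi>_def[abs_def])
  have fl: "flag (D z)" for z using D(1) unfolding developing_def by blast
  have at: "\<exists>k. t = \<phi> ` {z, z + hexdir k, z + hexdir (Suc k)}" if t: "t \<in> T" "\<phi> z \<in> t" for t z
  proof -
    obtain v p q where Dz: "D z = (v, p, q)" by (cases "D z")
    obtain x where x: "link v x" "x 0 = p" "x 1 = q" using fl[of z] flag_link[of v p q] Dz by auto
    have k: "\<phi> (z + hexdir k) = x k" for k
      using developing_neighbour[OF D(1), of k z] frot_funpow_link[OF x(1), of k 0] Dz x by (simp add: \<phi>_def)
    have "\<phi> z = v" using Dz by (simp add: \<phi>_def)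
    then obtain i where "t = {v, x i, x (Suc i)}" using link_triD[OF x(1) t(1)] t(2) by auto
    then show ?thesis using k \<open>\<phi> z = v\<close> by auto
  qed
  have "range \<phi> = \<Union>T"
  proof (rule conn)
    show "range \<phi> \<subseteq> \<Union>T" using local_map_tri[OF loc] by blast
    show "b \<in> range \<phi>" if "a \<in> range \<phi>" "t \<in> T" "a \<in> t" "b \<in> t" for a b t
      using that at by blast
  qed simp
  then have "(`) \<phi> ` lattice_triangles = T"
  proof (intro subset_antisym subsetI)
    fix t assume r: "range \<phi> = \<Union>T" and "t \<in> T"
    then obtain v where v: "v \<in> t" using card3[of t] by fastforce
    then have "v \<in> range \<phi>" unfolding r using \<open>t \<in> T\<close> by (rule UnionI[rotated])
    then obtain z where "\<phi> z \<in> t" using v by (elim rangeE) simp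
    from at[OF \<open>t \<in> T\<close> this] obtain k where "t = \<phi> ` {z, z + hexdir k, z + hexdir (Suc k)}" ..
    then show "t \<in> (`) \<phi> ` lattice_triangles" using triangle_in by (rule image_eqI)
  next
    fix t assume "t \<in> (`) \<phi> ` lattice_triangles"
    then show "t \<in> T" using loc unfolding local_map_def by blast
  qed
  moreover have "\<exists>A\<in>dihedral. \<forall>u. \<phi> (z + u) = \<phi> (w + A u)" if "\<phi> z = \<phi> w" for z w
    using developing_match[OF D(1) D(1), of z w] that unfolding \<phi>_def by metis
  ultimately have "hex_cover \<phi> (generated_complex T)"
    using loc by (simp add: hex_cover_def local_map_def)
  then show thesis by (rule that)
qed

text \<open>All triangles at the vertex \<open>\<phi> z\<close> are images of triangles at
  \<open>z\<close>: a triangle at another point of the fibre is carried to \<open>z\<close> by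
  the deck transformation.\<close>
lemma hex_cover_hexagonal:
  assumes "hex_cover \<phi> K"
  shows "hexagonal ((`) \<phi> ` lattice_triangles)"
proof
  have inj: "inj_on \<phi> (star z)" for z using assms by (simp add: hex_cover_def)
  have st: "z \<in> star z" "z + hexdir k \<in> star z" for z k by (auto simp: star_altdef)
  have ne: "\<phi> z \<noteq> \<phi> (z + hexdir k)" for z k
    using inj_on_eq_iff[OF inj st(1) st(2), of z k] by (simp add: hexdir_neq_0)
  have eq: "\<phi> (z + hexdir i) = \<phi> (z + hexdir j) \<longleftrightarrow> i mod 6 = j mod 6" for z i j
    using inj_on_eq_iff[OF inj st(2) st(2), of z i j] by (simp add: hexdir_eq_iff)
  have ms: "k mod 6 \<noteq> Suc k mod 6" for k :: nat by presburger
  show "card t = 3" if t: "t \<in> (`) \<phi> ` lattice_triangles" for t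
  proof -
    obtain s where s: "t = \<phi> ` s" "s \<in> lattice_triangles" using t by blast
    obtain z k where "s = {z, z + hexdir k, z + hexdir (Suc k)}"
      using s(2) unfolding lattice_triangles_altdef by blast
    then have "t = {\<phi> z, \<phi> (z + hexdir k), \<phi> (z + hexdir (Suc k))}" using s(1) by simp
    moreover have "\<phi> (z + hexdir k) \<noteq> \<phi> (z + hexdir (Suc k))" using eq ms by blast
    ultimately show ?thesis using ne by simp
  qed
  fix a assume "a \<in> \<Union>((`) \<phi> ` lattice_triangles)"
  then obtain z where z: "a = \<phi> z" by blast
  have "{t \<in> (`) \<phi> ` lattice_triangles. a \<in> t} = range (\<lambda>i. {a, \<phi> (z + hexdir i), \<phi> (z + hexdir (Suc i))})"
  proof (intro subset_antisym subsetI)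
    fix t assume "t \<in> {t \<in> (`) \<phi> ` lattice_triangles. a \<in> t}"
    then obtain s w where s: "t = \<phi> ` s" "s \<in> lattice_triangles" "w \<in> s" "a = \<phi> w" by blast
    obtain k where k: "s = {w, w + hexdir k, w + hexdir (Suc k)}" using triangle_at[OF s(2,3)] .
    obtain A where A: "A \<in> dihedral" "\<And>u. \<phi> (w + u) = \<phi> (z + A u)"
      using assms s(4) z unfolding hex_cover_def by metis
    have "t = {a, \<phi> (z + A (hexdir k)), \<phi> (z + A (hexdir (Suc k)))}" using s k A(2) by simp
    then show "t \<in> range (\<lambda>i. {a, \<phi> (z + hexdir i), \<phi> (z + hexdir (Suc i))})"
      using dihedral_hexdir[OF A(1), of k] by auto
  next
    fix t assume "t \<in> range (\<lambda>i. {a, \<phi> (z + hexdir i), \<phi> (z + hexdir (Suc i))})"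
    then obtain i where "t = \<phi> ` {z, z + hexdir i, z + hexdir (Suc i)}" using z by auto
    then show "t \<in> {t \<in> (`) \<phi> ` lattice_triangles. a \<in> t}" using triangle_in[of z i] z by blast
  qed
  then show "\<exists>x::nat \<Rightarrow> 'a. (\<forall>i j. x i = x j \<longleftrightarrow> i mod 6 = j mod 6) \<and>
      {t \<in> (`) \<phi> ` lattice_triangles. a \<in> t} = range (\<lambda>i. {a, x i, x (Suc i)})"
    using eq by (intro exI[of _ "\<lambda>i. \<phi> (z + hexdir i)"]) simp
qed

lemma generated_complex_triangles:
  assumes "\<And>t. t \<in> T \<Longrightarrow> card t = 3"
  shows "{s \<in> generated_complex T. card s = 3} = T"
proof -
  have sub: "s = t" if "s \<subseteq> t" "card s = 3" "t \<in> T" for s t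
    using that assms[of t] by (intro card_subset_eq) (simp_all add: card_ge_0_finite)
  have ne: "t \<noteq> {}" if "t \<in> T" for t using assms[OF that] by auto
  show ?thesis
  proof (intro subset_antisym subsetI)
    fix s assume "s \<in> {s \<in> generated_complex T. card s = 3}"
    then obtain t where "t \<in> T" "s \<subseteq> t" "card s = 3" unfolding generated_complex_def by blast
    then show "s \<in> T" using sub[of s t] by simp
  next
    fix t assume "t \<in> T"
    then show "t \<in> {s \<in> generated_complex T. card s = 3}"
      unfolding generated_complex_def using assms ne by blast
  qed
qed

lemma hex_cover_triangles:
  assumes "hex_cover \<phi> K"
  shows "(`) \<phi> ` lattice_triangles = {s \<in> K. card s = 3}"
proof -
  have "K = generated_complex ((`) \<phi> ` lattice_triangles)" using assms by (simp add: hex_cover_def)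
  then show ?thesis
    using generated_complex_triangles[OF hexagonal.card3[OF hex_cover_hexagonal[OF assms]]] by simp
qed

text \<open>The covering of a given complex is unique up to lattice symmetries. In particular
  automorphisms of the complex lift.\<close>
lemma hex_cover_match:
  assumes "hex_cover \<phi> K" "hex_cover \<psi> K" "\<phi> a = \<psi> b"
  obtains A where "A \<in> dihedral" "\<And>u. \<phi> (a + u) = \<psi> (b + A u)"
proof -
  define T where "T = {s \<in> K. card s = 3}"
  have T: "(`) \<phi> ` lattice_triangles = T" "(`) \<psi> ` lattice_triangles = T"
    unfolding T_def using assms(1,2) by (simp_all only: hex_cover_triangles)
  interpret hexagonal T using hex_cover_hexagonal[OF assms(1)] unfolding T(1) .
  have "\<forall>t\<in>lattice_triangles. \<phi> ` t \<in> T" "\<forall>t\<in>lattice_triangles. \<psi> ` t \<in> T"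
    using T by blast+
  then have "local_map \<phi>" "local_map \<psi>"
    using assms(1,2) unfolding local_map_def hex_cover_def by simp_all
  then have D: "developing (\<lambda>z. star_flag \<phi> z 0)" "developing (\<lambda>z. star_flag \<psi> z 0)"
    by (simp_all add: developing_star_flag)
  have f: "fst (star_flag \<theta> z 0) = \<theta> z" for \<theta> :: "lat \<Rightarrow> 'a" and z by (simp add: star_flag_def)
  show thesis
  proof (rule developing_match[OF D, of a b], unfold f)
    show "\<phi> a = \<psi> b" by (rule assms(3))
    fix A assume "A \<in> dihedral" "\<And>u. \<phi> (a + u) = \<psi> (b + A u)"
    then show thesis by (rule that)
  qed
qed


section \<open>Symmetries of a covering\<close>

text \<open>The affine map \<open>u \<mapsto> A u + t\<close> is a deck transformation.\<close>
definition symm :: "(lat \<Rightarrow> 'v) \<Rightarrow> (lat \<Rightarrow> lat) \<Rightarrow> lat \<Rightarrow> bool" where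
  "symm \<phi> A t \<longleftrightarrow> A \<in> dihedral \<and> (\<forall>u. \<phi> (A u + t) = \<phi> u)"

lemma cover_symm:
  assumes "hex_cover \<phi> K" "\<phi> z = \<phi> w"
  obtains A t where "symm \<phi> A t" "A z + t = w"
proof -
  obtain A where A: "A \<in> dihedral" "\<And>u. \<phi> (z + u) = \<phi> (w + A u)"
    using assms unfolding hex_cover_def by blast
  have "\<phi> (A u + (w - A z)) = \<phi> u" for u
  proof -
    have e: "A u + (w - A z) = w + A (u - z)" using A(1) by (simp add: dihedral_diff)
    show ?thesis unfolding e using A(2)[of "u - z"] by simp
  qed
  then show thesis using that[of A "w - A z"] A(1) by (simp add: symm_def)
qed

lemma symm_comp:
  assumes "symm \<phi> A s" "symm \<phi> B t"
  shows "symm \<phi> (A \<circ> B) (A t + s)"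
  unfolding symm_def
proof (intro conjI allI)
  show "A \<circ> B \<in> dihedral" using assms by (simp add: symm_def dihedral_comp)
  fix u
  have e: "(A \<circ> B) u + (A t + s) = A (B u + t) + s" using assms by (simp add: symm_def dihedral_add add.assoc)
  show "\<phi> ((A \<circ> B) u + (A t + s)) = \<phi> u" unfolding e using assms by (simp add: symm_def)
qed

lemma dihedral_fixes:
  assumes "A \<in> dihedral" "A (1, 0) = (1, 0)" "A (1, 1) = (1, 1)"
  shows "A = id"
  using assms(1)
proof (cases A rule: dihedral_cases)
  case (1 k)
  have "hexdir k = hexdir 0" using assms(2) 1 by (simp add: hexdir_def)
  then have "k mod 6 = 0" by (simp add: hexdir_eq_iff)
  then show ?thesis using rot6_funpow_mod[of k] 1 by (simp add: id_def)
next
  case (2 k)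
  have "hexdir k = hexdir 0" using assms(2) 2 by (simp add: hexdir_def)
  then have "k mod 6 = 0" by (simp add: hexdir_eq_iff)
  then show ?thesis using rot6_funpow_mod[of k] 2 assms(3) by simp
qed

text \<open>A deck transformation that moves \<open>z\<close> into its own star fixes \<open>z\<close>, by
  injectivity on stars, and then also all neighbours of \<open>z\<close>.\<close>
lemma symm_free:
  assumes K: "hex_cover \<phi> K" and s: "symm \<phi> A t" and st: "A z + t \<in> star z"
  shows "A = id" "t = 0"
proof -
  have A: "A \<in> dihedral" and inv: "\<And>u. \<phi> (A u + t) = \<phi> u" using s by (auto simp: symm_def)
  have inj: "inj_on \<phi> (star z)" using K by (simp add: hex_cover_def)
  have fix0: "A z + t = z" using inj_onD[OF inj inv st] by (simp add: star_altdef)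
  have "A (hexdir k) = hexdir k" for k
  proof -
    obtain i where i: "A (hexdir k) = hexdir i" using dihedral_hexdir[OF A, of k] by blast
    have "A (z + hexdir k) + t = z + hexdir i" using fix0 i dihedral_add[OF A] by (metis add.assoc add.commute)
    then have "\<phi> (z + hexdir i) = \<phi> (z + hexdir k)" using inv by metis
    then have "z + hexdir i = z + hexdir k" by (rule inj_onD[OF inj]) (auto simp: star_altdef)
    then show ?thesis using i by simp
  qed
  from this[of 0] this[of 1] show "A = id" using dihedral_fixes[OF A] by (simp add: hexdir_values)
  then show "t = 0" using fix0 by simp
qed

text \<open>A nontrivial rotation of the lattice is centred at a vertex, at the midpoint of an edge or at
  the centre of a triangle. It thus carries some vertex to itself or to a neighbour, which
  \<open>symm_free\<close> excludes.\<close>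
lemma symm_rotation:
  assumes K: "hex_cover \<phi> K" and s: "symm \<phi> (rot6 ^^ k) t"
  shows "rot6 ^^ k = id"
proof -
  have ex: "\<exists>z. (rot6 ^^ k) z + t \<in> star z" if "k < 6" "k \<noteq> 0" for k
  proof -
    obtain p q where t: "t = (p, q)" by force
    have "\<exists>y. p + q - 3 * y = -1 \<or> p + q - 3 * y = 0 \<or> p + q - 3 * y = 1" by presburger
    then have m: "\<exists>y. p + q - 3 * y \<in> {-1, 0, 1}" by simp
    consider "k = 1" | "k = 2" | "k = 3" | "k = 4" | "k = 5" using \<open>k < 6\<close> \<open>k \<noteq> 0\<close> by linarith
    then show ?thesis
    proof cases
      case 1 then show ?thesis by (intro exI[of _ "(p - q, p)"]) (simp add: t star_def)
    next
      case 2
      obtain y where y: "p + q - 3 * y \<in> {-1, 0, 1}" using m by blast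
      have "(rot6 ^^ k) (2 * y - q, y) + t = (2 * y - q, y) + (p + q - 3 * y, 0)"
        by (simp add: 2 t numeral_2_eq_2)
      also have "\<dots> \<in> star (2 * y - q, y)" unfolding star_def by (rule imageI) (use y in auto)
      finally show ?thesis by blast
    next
      case 3
      have "\<exists>x. p - 2 * x = 0 \<or> p - 2 * x = 1" "\<exists>y. q - 2 * y = 0 \<or> q - 2 * y = 1" by presburger+
      then obtain x y where xy: "p - 2 * x = 0 \<or> p - 2 * x = 1" "q - 2 * y = 0 \<or> q - 2 * y = 1" by blast
      have "(rot6 ^^ k) (x, y) + t = (x, y) + (p - 2 * x, q - 2 * y)" by (simp add: 3 t numeral_3_eq_3)
      also have "\<dots> \<in> star (x, y)" unfolding star_def by (rule imageI) (use xy in auto)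
      finally show ?thesis by blast
    next
      case 4
      obtain x where x: "p + q - 3 * x \<in> {-1, 0, 1}" using m by blast
      have "(rot6 ^^ k) (x, 2 * x - p) + t = (x, 2 * x - p) + (0, p + q - 3 * x)"
        by (simp add: 4 t eval_nat_numeral)
      also have "\<dots> \<in> star (x, 2 * x - p)" unfolding star_def by (rule imageI) (use x in auto)
      finally show ?thesis by blast
    next
      case 5 then show ?thesis by (intro exI[of _ "(q, q - p)"]) (simp add: t star_def eval_nat_numeral)
    qed
  qed
  have s': "symm \<phi> (rot6 ^^ (k mod 6)) t" using s rot6_funpow_mod[of k] by simp
  have "rot6 ^^ (k mod 6) = id"
  proof (cases "k mod 6 = 0")
    case False
    then obtain z where "(rot6 ^^ (k mod 6)) z + t \<in> star z" using ex[of "k mod 6"] by auto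
    then show ?thesis using symm_free(1)[OF K s'] by blast
  qed (simp add: id_def)
  then show ?thesis using rot6_funpow_mod[of k] by simp
qed

section \<open>Reparametrisation and isomorphism\<close>

lemma dihedral_triangles:
  assumes "A \<in> dihedral" "t \<in> lattice_triangles"
  shows "(\<lambda>z. A z + v) ` t \<in> lattice_triangles"
proof -
  obtain z k where t: "t = {z, z + hexdir k, z + hexdir (Suc k)}"
    using assms(2) unfolding lattice_triangles_altdef by blast
  have "(\<lambda>z. A z + v) ` t = {A z + v, A z + v + A (hexdir k), A z + v + A (hexdir (Suc k))}"
    by (simp add: t dihedral_add[OF assms(1)] add_ac)
  moreover obtain i where "A (hexdir k) = hexdir i \<and> A (hexdir (Suc k)) = hexdir (Suc i) \<or>
      A (hexdir k) = hexdir (Suc i) \<and> A (hexdir (Suc k)) = hexdir i"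
    using dihedral_hexdir[OF assms(1), of k] by blast
  ultimately have "(\<lambda>z. A z + v) ` t = {A z + v, A z + v + hexdir i, A z + v + hexdir (Suc i)}"
    by (elim disjE) (simp_all add: insert_commute)
  then show ?thesis using triangle_in by simp
qed

lemma dihedral_triangles_image:
  assumes "A \<in> dihedral"
  shows "(`) (\<lambda>z. A z + v) ` lattice_triangles = lattice_triangles"
proof (intro subset_antisym subsetI)
  fix t assume t: "t \<in> lattice_triangles"
  obtain B where B: "B \<in> dihedral" "A \<circ> B = id" using dihedral_inverse[OF assms] by metis
  have "A (B z + - B v) + v = z" for z
    using B(2) dihedral_diff[OF assms, of "B z" "B v"] by (simp add: o_def id_def fun_eq_iff)
  then have "t = (\<lambda>z. A z + v) ` (\<lambda>z. B z + - B v) ` t" by (simp add: image_image)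
  then show "t \<in> (`) (\<lambda>z. A z + v) ` lattice_triangles"
    using dihedral_triangles[OF B(1) t, of "- B v"] by (rule image_eqI)
qed (use dihedral_triangles[OF assms] in blast)

lemma dihedral_star:
  assumes "A \<in> dihedral"
  shows "(\<lambda>z. A z + v) ` star z \<subseteq> star (A z + v)"
proof -
  have "A (z + hexdir k) + v \<in> star (A z + v)" for k
  proof -
    obtain i where "A (hexdir k) = hexdir i" using dihedral_hexdir[OF assms, of k] by blast
    then have "A (z + hexdir k) + v = A z + v + hexdir i" by (simp add: dihedral_add[OF assms] add_ac)
    then show ?thesis by (simp add: star_altdef)
  qed
  then show ?thesis by (auto simp: star_altdef[of z]) (simp add: star_altdef)
qed

lemma dihedral_inj: "A \<in> dihedral \<Longrightarrow> inj A"
proof -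
  assume "A \<in> dihedral"
  then obtain B where "B \<circ> A = id" using dihedral_inverse by metis
  then show "inj A" by (metis inj_on_id inj_on_imageI2)
qed

lemma hex_cover_reparam:
  assumes K: "hex_cover \<phi> K" and B: "B \<in> dihedral"
  shows "hex_cover (\<lambda>z. \<phi> (B z + v)) K"
  unfolding hex_cover_def
proof (intro conjI allI impI)
  have "(`) (\<lambda>z. \<phi> (B z + v)) ` lattice_triangles = (`) \<phi> ` (`) (\<lambda>z. B z + v) ` lattice_triangles"
    by (simp add: image_image)
  then show "K = generated_complex ((`) (\<lambda>z. \<phi> (B z + v)) ` lattice_triangles)"
    using K unfolding dihedral_triangles_image[OF B] hex_cover_def by simp
  show "inj_on (\<lambda>z. \<phi> (B z + v)) (star z)" for z
  proof -
    have "inj_on (\<lambda>z. B z + v) (star z)" using dihedral_inj[OF B] by (auto simp: inj_on_def)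
    moreover have "inj_on \<phi> ((\<lambda>z. B z + v) ` star z)"
      using K dihedral_star[OF B] unfolding hex_cover_def by (metis inj_on_subset)
    ultimately show ?thesis using comp_inj_on by (fastforce simp: o_def)
  qed
  fix z w assume "\<phi> (B z + v) = \<phi> (B w + v)"
  then obtain A where A: "A \<in> dihedral" "\<And>u. \<phi> (B z + v + u) = \<phi> (B w + v + A u)"
    using K unfolding hex_cover_def by metis
  obtain C where C: "C \<in> dihedral" "B \<circ> C = id" using dihedral_inverse[OF B] by metis
  then have BC: "B (C u) = u" for u by (simp add: o_def id_def fun_eq_iff)
  show "\<exists>A\<in>dihedral. \<forall>u. \<phi> (B (z + u) + v) = \<phi> (B (w + A u) + v)"
  proof (intro bexI[of _ "C \<circ> A \<circ> B"] allI)
    fix u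
    show "\<phi> (B (z + u) + v) = \<phi> (B (w + (C \<circ> A \<circ> B) u) + v)"
      using A(2)[of "B u"] by (simp add: dihedral_add[OF B] BC add_ac)
  qed (intro dihedral_comp A B C)
qed

lemma hex_cover_vertices:
  assumes "hex_cover \<phi> K"
  shows "vertices K = range \<phi>"
proof
  have K: "K = generated_complex ((`) \<phi> ` lattice_triangles)" using assms by (simp add: hex_cover_def)
  show "vertices K \<subseteq> range \<phi>" unfolding vertices_def by (subst K) (auto simp: generated_complex_def)
  have "{\<phi> z} \<in> K" for z
  proof -
    have "\<phi> ` {z, z + hexdir 0, z + hexdir (Suc 0)} \<in> (`) \<phi> ` lattice_triangles" by (rule imageI triangle_in)+
    moreover have "{\<phi> z} \<subseteq> \<phi> ` {z, z + hexdir 0, z + hexdir (Suc 0)}" by simp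
    ultimately have "{\<phi> z} \<in> generated_complex ((`) \<phi> ` lattice_triangles)"
      unfolding generated_complex_def by blast
    then show ?thesis using K by simp
  qed
  then show "range \<phi> \<subseteq> vertices K" unfolding vertices_def by blast
qed

text \<open>Both complexes are the quotient of the lattice by the same equivalence relation.\<close>
lemma hex_cover_isomorphism:
  assumes K: "hex_cover \<phi> K" and L: "hex_cover \<psi> L" and eq: "\<And>z w. \<phi> z = \<phi> w \<longleftrightarrow> \<psi> z = \<psi> w"
  obtains f where "simplicial_iso f K L" "\<And>z. f (\<phi> z) = \<psi> z"
proof -
  define f where "f v = \<psi> (SOME z. \<phi> z = v)" for v
  have f: "f (\<phi> z) = \<psi> z" for z
  proof -
    have "\<phi> (SOME w. \<phi> w = \<phi> z) = \<phi> z" by (rule someI_ex) blast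
    then show ?thesis by (simp add: f_def eq)
  qed
  have bij: "bij_betw f (vertices K) (vertices L)"
    unfolding hex_cover_vertices[OF K] hex_cover_vertices[OF L] bij_betw_def inj_on_def image_image f
    using eq by (auto simp: f)
  have inj: "inj_on f (range \<phi>)" using bij unfolding hex_cover_vertices[OF K] bij_betw_def by blast
  have Ke: "K = generated_complex ((`) \<phi> ` lattice_triangles)" and Le: "L = generated_complex ((`) \<psi> ` lattice_triangles)"
    using K L by (simp_all add: hex_cover_def)
  have im: "f ` \<phi> ` t = \<psi> ` t" for t by (simp add: image_image f)
  have "s \<in> K \<longleftrightarrow> f ` s \<in> L" if s: "s \<subseteq> vertices K" for s
  proof
    assume "s \<in> K"
    then obtain t where "t \<in> lattice_triangles" "s \<subseteq> \<phi> ` t" "s \<noteq> {}"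
      unfolding Ke generated_complex_def by blast
    then show "f ` s \<in> L" unfolding Le generated_complex_def using im[of t] by blast
  next
    assume "f ` s \<in> L"
    then obtain t where t: "t \<in> lattice_triangles" "f ` s \<subseteq> \<psi> ` t" "s \<noteq> {}"
      unfolding Le generated_complex_def by blast
    then have "f ` s \<subseteq> f ` \<phi> ` t" by (simp add: im)
    then have "s \<subseteq> \<phi> ` t" using inj_on_image_subset_iff[OF inj, of s "\<phi> ` t"] s hex_cover_vertices[OF K] by blast
    then show "s \<in> K" unfolding Ke generated_complex_def using t by blast
  qed
  then have "simplicial_iso f K L" using bij unfolding simplicial_iso_def by blast
  then show thesis using f by (rule that)
qed

lemma hex_cover_isomorphic:
  assumes "hex_cover \<phi> K" "hex_cover \<psi> L" "\<And>z w. \<phi> z = \<phi> w \<longleftrightarrow> \<psi> z = \<psi> w"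
  shows "isomorphic_complexes K L"
  using hex_cover_isomorphism[OF assms] unfolding isomorphic_complexes_def by metis

lemma hex_cover_iso_image:
  assumes K: "hex_cover \<phi> K" and f: "simplicial_iso f K L"
  shows "hex_cover (f \<circ> \<phi>) L"
proof -
  have bij: "bij_betw f (vertices K) (vertices L)" and iff: "\<And>s. s \<subseteq> vertices K \<Longrightarrow> s \<in> K \<longleftrightarrow> f ` s \<in> L"
    using f by (auto simp: simplicial_iso_def)
  have V: "vertices K = range \<phi>" by (rule hex_cover_vertices[OF K])
  have inj: "inj_on f (range \<phi>)" using bij unfolding V bij_betw_def by blast
  have Ke: "K = generated_complex ((`) \<phi> ` lattice_triangles)" using K by (simp add: hex_cover_def)
  have 1: "L = generated_complex ((`) (f \<circ> \<phi>) ` lattice_triangles)"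
  proof (intro subset_antisym subsetI)
    fix s assume s: "s \<in> L"
    have sV: "s \<subseteq> vertices L" using s by (auto simp: vertices_def)
    define r where "r = {v \<in> vertices K. f v \<in> s}"
    have "s \<subseteq> f ` vertices K" using sV bij by (simp add: bij_betw_def)
    then have r: "r \<subseteq> vertices K" "f ` r = s" unfolding r_def by blast+
    then have "r \<in> K" using iff s by blast
    then obtain t where t: "t \<in> lattice_triangles" "r \<subseteq> \<phi> ` t" "r \<noteq> {}" using Ke unfolding generated_complex_def by blast
    then have "s \<noteq> {}" "s \<subseteq> (f \<circ> \<phi>) ` t" using r(2) unfolding image_comp[symmetric] by blast+
    then show "s \<in> generated_complex ((`) (f \<circ> \<phi>) ` lattice_triangles)"
      unfolding generated_complex_def using t by blast
  next
    fix s assume "s \<in> generated_complex ((`) (f \<circ> \<phi>) ` lattice_triangles)"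
    then obtain t where t: "t \<in> lattice_triangles" "s \<subseteq> (f \<circ> \<phi>) ` t" "s \<noteq> {}"
      unfolding generated_complex_def by blast
    define r where "r = {v \<in> \<phi> ` t. f v \<in> s}"
    have r: "r \<subseteq> \<phi> ` t" "f ` r = s" using t(2) unfolding r_def image_comp[symmetric] by blast+
    then have "r \<noteq> {}" using t(3) by blast
    then have "r \<in> K" using r t Ke unfolding generated_complex_def by blast
    moreover have "r \<subseteq> vertices K" using r V by blast
    ultimately show "s \<in> L" using iff r(2) by blast
  qed
  have 2: "inj_on (f \<circ> \<phi>) (star z)" for z
  proof (rule comp_inj_on)
    show "inj_on \<phi> (star z)" using K by (simp add: hex_cover_def)
    show "inj_on f (\<phi> ` star z)" using inj by (rule inj_on_subset) blast
  qed
  have 3: "\<exists>A\<in>dihedral. \<forall>u. (f \<circ> \<phi>) (z + u) = (f \<circ> \<phi>) (w + A u)" if "(f \<circ> \<phi>) z = (f \<circ> \<phi>) w" for z w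
  proof -
    have "\<phi> z = \<phi> w" using that inj by (auto dest: inj_onD)
    then obtain A where "A \<in> dihedral" "\<forall>u. \<phi> (z + u) = \<phi> (w + A u)" using K unfolding hex_cover_def by blast
    then show ?thesis by auto
  qed
  show ?thesis unfolding hex_cover_def
    by (intro conjI allI impI) (rule 1, rule 2, rule 3)
qed

text \<open>Lifting an isomorphism: \<open>f \<circ> \<phi>\<close> and \<open>\<psi>\<close> are
  coverings of \<open>L\<close>, hence differ by a lattice symmetry, which then carries the
  fibres of \<open>\<phi>\<close> to those of \<open>\<psi>\<close>.\<close>
lemma simplicial_iso_match:
  assumes K: "hex_cover \<phi> K" and L: "hex_cover \<psi> L" and f: "simplicial_iso f K L" and "f (\<phi> a) = \<psi> b"
  obtains A where "A \<in> dihedral" "\<And>u v. \<phi> (a + u) = \<phi> (a + v) \<longleftrightarrow> \<psi> (b + A u) = \<psi> (b + A v)"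
proof -
  have "(f \<circ> \<phi>) a = \<psi> b" using assms(4) by simp
  then obtain A where A: "A \<in> dihedral" "\<And>u. (f \<circ> \<phi>) (a + u) = \<psi> (b + A u)"
    using hex_cover_match[OF hex_cover_iso_image[OF K f] L] by metis
  have "inj_on f (range \<phi>)"
    using f hex_cover_vertices[OF K] by (auto simp: simplicial_iso_def bij_betw_def)
  then have "\<phi> (a + u) = \<phi> (a + v) \<longleftrightarrow> \<psi> (b + A u) = \<psi> (b + A v)" for u v
    using A(2)[of u] A(2)[of v] inj_on_eq_iff[of f "range \<phi>" "\<phi> (a + u)" "\<phi> (a + v)"] by simp
  then show thesis using A(1) that by blast
qed


section \<open>Lattices in the plane and their normal forms\<close>

text \<open>Reduction of a lattice point to the box \<open>[0,a) \<times> [0,c)\<close> modulo the lattice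
  spanned by \<open>(a,0)\<close> and \<open>(b,c)\<close>: the second generator brings the
  height into range, then the first one the abscissa. \<open>tlat\<close> is membership in that
  lattice.\<close>
definition tred :: "int \<Rightarrow> int \<Rightarrow> int \<Rightarrow> lat \<Rightarrow> lat" where
  "tred a b c z = ((fst z - (snd z div c) * b) mod a, snd z mod c)"

definition tlat :: "int \<Rightarrow> int \<Rightarrow> int \<Rightarrow> lat \<Rightarrow> bool" where
  "tlat a b c z \<longleftrightarrow> c dvd snd z \<and> a dvd (fst z - (snd z div c) * b)"

text \<open>The reflection of the lattice in the line \<open>y = 2x\<close>, which is perpendicular to the
  edge direction \<open>(1,0)\<close> in the equilateral picture.\<close>
definition kflip :: "lat \<Rightarrow> lat" where "kflip z = (snd z - fst z, snd z)"

text \<open>Reduction to the box \<open>[0,a) \<times> [0,m)\<close> modulo the group generated by the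
  translation by \<open>(a,0)\<close> and the glide reflection \<open>z \<mapsto> kflip z +
  (0,m)\<close>. The square of the glide reflection is the translation by \<open>(m,2m)\<close>,
  so an even number \<open>q\<close> of glide steps shifts by \<open>(q div 2) * m\<close>, and
  an odd number also reflects.\<close>
definition kred :: "int \<Rightarrow> int \<Rightarrow> lat \<Rightarrow> lat" where
  "kred a m z = (let q = snd z div m; r = snd z mod m in
     (if even q then (fst z - (q div 2) * m) mod a else (r - fst z + (q div 2) * m) mod a, r))"

lemma tlat_iff: "0 < c \<Longrightarrow> tlat a b c z \<longleftrightarrow> (\<exists>i j. z = (i * a + j * b, j * c))"
proof
  assume "0 < c" "tlat a b c z"
  then obtain j where j: "snd z = c * j" by (auto simp: tlat_def dvd_def)
  moreover have "a dvd fst z - j * b" using \<open>tlat a b c z\<close> \<open>0 < c\<close> j by (simp add: tlat_def)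
  then obtain i where "fst z - j * b = a * i" by (auto simp: dvd_def)
  ultimately have "z = (i * a + j * b, j * c)" using \<open>0 < c\<close> by (auto simp: prod_eq_iff algebra_simps)
  then show "\<exists>i j. z = (i * a + j * b, j * c)" by blast
next
  assume "0 < c" "\<exists>i j. z = (i * a + j * b, j * c)"
  then show "tlat a b c z" by (auto simp: tlat_def)
qed

lemma tred_eq_iff:
  assumes "0 < c"
  shows "tred a b c z = tred a b c w \<longleftrightarrow> tlat a b c (z - w)"
proof -
  have "tlat a b c (z - w)" if "tred a b c z = tred a b c w"
  proof -
    have m: "c dvd snd z - snd w" and x: "a dvd (fst z - (snd z div c) * b) - (fst w - (snd w div c) * b)"
      using that by (auto simp: tred_def mod_eq_dvd_iff)
    from m obtain j where j: "snd z - snd w = c * j" by (auto simp: dvd_def)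
    then have "snd z = snd w + j * c" by (simp add: algebra_simps)
    then have "snd z div c = snd w div c + j" using assms by simp
    moreover have "(snd z - snd w) div c = j" using j assms by simp
    ultimately have d: "(snd z - snd w) div c = snd z div c - snd w div c" by simp
    have e: "(fst z - (snd z div c) * b) - (fst w - (snd w div c) * b) = fst (z - w) - (snd (z - w) div c) * b"
      by (simp only: fst_diff snd_diff d) (simp add: algebra_simps)
    have "a dvd fst (z - w) - (snd (z - w) div c) * b" using x unfolding e .
    then show ?thesis unfolding tlat_def using m by simp
  qed
  moreover have "tred a b c z = tred a b c w" if l: "tlat a b c (z - w)"
  proof -
    obtain i j where ij: "z - w = (i * a + j * b, j * c)" using l tlat_iff[OF assms] by blast
    then have z: "z = (fst w + i * a + j * b, snd w + j * c)" by (simp add: prod_eq_iff algebra_simps)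
    have 1: "snd z div c = snd w div c + j" "snd z mod c = snd w mod c" "fst z = fst w + i * a + j * b"
      using assms by (simp_all add: z)
    have e: "fst w + i * a + j * b - (snd w div c + j) * b = (fst w - (snd w div c) * b) + i * a"
      by (simp add: algebra_simps)
    show ?thesis unfolding tred_def 1 e by simp
  qed
  ultimately show ?thesis by blast
qed

lemma tred_box: "0 < a \<Longrightarrow> 0 < c \<Longrightarrow> tred a b c z \<in> {0..<a} \<times> {0..<c}"
  by (simp add: tred_def)
lemma tred_id: "z \<in> {0..<a} \<times> {0..<c} \<Longrightarrow> tred a b c z = z"
  by (cases z) (simp add: tred_def)

lemma kred_box: "0 < a \<Longrightarrow> 0 < c \<Longrightarrow> kred a c z \<in> {0..<a} \<times> {0..<c}"
  by (simp add: kred_def Let_def)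
lemma kred_id: "z \<in> {0..<a} \<times> {0..<c} \<Longrightarrow> kred a c z = z"
  by (cases z) (simp add: kred_def Let_def)

lemma kred_even: "0 \<le> r \<Longrightarrow> r < m \<Longrightarrow> kred a m (x, 2 * k * m + r) = ((x - k * m) mod a, r)"
proof -
  assume r: "0 \<le> r" "r < m"
  then have "(2 * k * m + r) div m = 2 * k" "(2 * k * m + r) mod m = r" by simp_all
  then show ?thesis by (simp add: kred_def Let_def)
qed

lemma kred_odd: "0 \<le> r \<Longrightarrow> r < m \<Longrightarrow> kred a m (x, (2 * k + 1) * m + r) = ((r - x + k * m) mod a, r)"
proof -
  assume r: "0 \<le> r" "r < m"
  then have "((2 * k + 1) * m + r) div m = 2 * k + 1" "((2 * k + 1) * m + r) mod m = r" by simp_all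
  then show ?thesis by (simp add: kred_def Let_def)
qed

text \<open>The orbit relation of the group of \<open>kred\<close>, with its elements listed:
  \<open>j\<close> double glide steps and \<open>i\<close> horizontal translations, possibly
  followed by one glide reflection.\<close>
definition krel :: "int \<Rightarrow> int \<Rightarrow> lat \<Rightarrow> lat \<Rightarrow> bool" where
  "krel a m z w \<longleftrightarrow> (\<exists>i j. w = z + (j * m + i * a, 2 * j * m) \<or> w = kflip z + (j * m + i * a, m + 2 * j * m))"

lemma klein_height_cases:
  assumes "0 < (m::int)"
  obtains k r where "y = 2 * k * m + r" "0 \<le> r" "r < m" | k r where "y = (2 * k + 1) * m + r" "0 \<le> r" "r < m"
proof -
  have y: "y = (y div m) * m + y mod m" "0 \<le> y mod m" "y mod m < m" using assms by simp_all
  show thesis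
  proof (cases "even (y div m)")
    case True
    then obtain k where "y div m = 2 * k" by (elim evenE)
    then show thesis using that(1)[of k "y mod m"] y by simp
  next
    case False
    then obtain k where "y div m = 2 * k + 1" by (elim oddE)
    then show thesis using that(2)[of k "y mod m"] y by simp
  qed
qed

lemma mod_eq_ex: "(x::int) mod a = y mod a \<longleftrightarrow> (\<exists>i. y = x + i * a)"
  unfolding mod_eq_dvd_iff dvd_def by (metis add_diff_cancel_left' diff_add_cancel diff_minus_eq_add
      minus_diff_eq mult.commute mult_minus_left add.commute)

lemma kred_eq_iff:
  assumes m: "0 < m"
  shows "kred a m z = kred a m w \<longleftrightarrow> krel a m z w"
proof
  obtain x y x' y' where zw: "z = (x, y)" "w = (x', y')" by force
  assume eq: "kred a m z = kred a m w"
  show "krel a m z w"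
  proof (cases y rule: klein_height_cases[OF m])
    case y: (1 k r)
    show ?thesis
    proof (cases y' rule: klein_height_cases[OF m])
      case y': (1 k' r')
      have "(x - k * m) mod a = (x' - k' * m) mod a" "r = r'"
        using eq y y' kred_even[of r m a x k] kred_even[of r' m a x' k'] by (auto simp: zw)
      moreover from this obtain i where "x' - k' * m = x - k * m + i * a" using mod_eq_ex by metis
      ultimately have "w = z + ((k' - k) * m + i * a, 2 * (k' - k) * m)"
        using y y' by (simp add: zw algebra_simps)
      then show ?thesis unfolding krel_def by blast
    next
      case y': (2 k' r')
      have "(x - k * m) mod a = (r' - x' + k' * m) mod a" "r = r'"
        using eq y y' kred_even[of r m a x k] kred_odd[of r' m a x' k'] by (auto simp: zw)
      moreover from this obtain i where "r' - x' + k' * m = x - k * m + i * a" using mod_eq_ex by metis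
      ultimately have "w = kflip z + ((k' - k) * m + (- i) * a, m + 2 * (k' - k) * m)"
        using y y' by (simp add: zw kflip_def algebra_simps)
      then show ?thesis unfolding krel_def by blast
    qed
  next
    case y: (2 k r)
    show ?thesis
    proof (cases y' rule: klein_height_cases[OF m])
      case y': (1 k' r')
      have "(r - x + k * m) mod a = (x' - k' * m) mod a" "r = r'"
        using eq y y' kred_odd[of r m a x k] kred_even[of r' m a x' k'] by (auto simp: zw)
      moreover from this obtain i where "x' - k' * m = r - x + k * m + i * a" using mod_eq_ex by metis
      ultimately have "w = kflip z + ((k' - k - 1) * m + i * a, m + 2 * (k' - k - 1) * m)"
        using y y' by (simp add: zw kflip_def algebra_simps)
      then show ?thesis unfolding krel_def by blast
    next
      case y': (2 k' r')
      have "(r - x + k * m) mod a = (r' - x' + k' * m) mod a" "r = r'"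
        using eq y y' kred_odd[of r m a x k] kred_odd[of r' m a x' k'] by (auto simp: zw)
      moreover from this obtain i where "r' - x' + k' * m = r - x + k * m + i * a" using mod_eq_ex by metis
      ultimately have "w = z + ((k' - k) * m + (- i) * a, 2 * (k' - k) * m)"
        using y y' by (simp add: zw algebra_simps)
      then show ?thesis unfolding krel_def by blast
    qed
  qed
next
  obtain x y where z: "z = (x, y)" by force
  assume "krel a m z w"
  then obtain i j where "w = z + (j * m + i * a, 2 * j * m) \<or> w = kflip z + (j * m + i * a, m + 2 * j * m)"
    unfolding krel_def by blast
  then show "kred a m z = kred a m w"
  proof
    assume w: "w = z + (j * m + i * a, 2 * j * m)"
    show ?thesis
    proof (cases y rule: klein_height_cases[OF m])
      case (1 k r)
      then have "w = (x + j * m + i * a, 2 * (k + j) * m + r)" by (simp add: w z algebra_simps)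
      moreover have "x + j * m + i * a - (k + j) * m = (x - k * m) + i * a" by (simp add: algebra_simps)
      then have "(x + j * m + i * a - (k + j) * m) mod a = (x - k * m) mod a" by (simp only: mod_mult_self1)
      ultimately show ?thesis using 1 kred_even[of r m a x k] kred_even[of r m a "x + j * m + i * a" "k + j"] by (simp add: z)
    next
      case (2 k r)
      then have "w = (x + j * m + i * a, (2 * (k + j) + 1) * m + r)" by (simp add: w z algebra_simps)
      moreover have "r - (x + j * m + i * a) + (k + j) * m = (r - x + k * m) + (- i) * a" by (simp add: algebra_simps)
      then have "(r - (x + j * m + i * a) + (k + j) * m) mod a = (r - x + k * m) mod a" by (simp only: mod_mult_self1)
      ultimately show ?thesis using 2 kred_odd[of r m a x k] kred_odd[of r m a "x + j * m + i * a" "k + j"] by (simp add: z)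
    qed
  next
    assume w: "w = kflip z + (j * m + i * a, m + 2 * j * m)"
    show ?thesis
    proof (cases y rule: klein_height_cases[OF m])
      case (1 k r)
      then have "w = (y - x + j * m + i * a, (2 * (k + j) + 1) * m + r)" by (simp add: w z kflip_def algebra_simps)
      moreover have "r - (y - x + j * m + i * a) + (k + j) * m = (x - k * m) + (- i) * a" by (simp add: 1 algebra_simps)
      then have "(r - (y - x + j * m + i * a) + (k + j) * m) mod a = (x - k * m) mod a" by (simp only: mod_mult_self1)
      ultimately show ?thesis using 1 kred_even[of r m a x k] kred_odd[of r m a "y - x + j * m + i * a" "k + j"] by (simp add: z)
    next
      case (2 k r)
      then have "w = (y - x + j * m + i * a, 2 * (k + j + 1) * m + r)" by (simp add: w z kflip_def algebra_simps)
      moreover have "y - x + j * m + i * a - (k + j + 1) * m = (r - x + k * m) + i * a" by (simp add: 2 algebra_simps)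
      then have "(y - x + j * m + i * a - (k + j + 1) * m) mod a = (r - x + k * m) mod a" by (simp only: mod_mult_self1)
      ultimately show ?thesis using 2 kred_odd[of r m a x k] kred_even[of r m a "y - x + j * m + i * a" "k + j + 1"] by (simp add: z)
    qed
  qed
qed

section \<open>Classification of the kernels\<close>

lemma card_range_box:
  fixes a c :: int
  assumes "\<And>z w. \<theta> z = \<theta> w \<longleftrightarrow> \<rho> z = \<rho> w" and "\<And>z. \<rho> z \<in> {0..<a} \<times> {0..<c}"
    and "\<And>z. z \<in> {0..<a} \<times> {0..<c} \<Longrightarrow> \<rho> z = z"
  shows "card (range \<theta>) = nat (a * c)"
proof -
  have pos: "0 < a" "0 < c" using assms(2)[of 0] by auto
  have "\<theta> z = \<theta> (\<rho> z)" for z using assms(1)[of z "\<rho> z"] assms(3)[OF assms(2)[of z]] by simp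
  then have "range \<theta> = \<theta> ` ({0..<a} \<times> {0..<c})" using assms(2) by blast
  moreover have "inj_on \<theta> ({0..<a} \<times> {0..<c})"
  proof (rule inj_onI)
    fix z w assume "z \<in> {0..<a} \<times> {0..<c}" "w \<in> {0..<a} \<times> {0..<c}" "\<theta> z = \<theta> w"
    then show "z = w" using assms(1)[of z w] assms(3)[of z] assms(3)[of w] by simp
  qed
  moreover have "card ({0..<a} \<times> {0..<c}) = nat (a * c)"
    using pos by (simp add: card_cartesian_product nat_mult_distrib)
  ultimately show ?thesis by (simp add: card_image)
qed

text \<open>Source of nontrivial periods: infinitely many points on a line have finitely many images.\<close>
lemma pigeonhole_sequence:
  assumes "finite (range \<theta>)"
  obtains i j :: nat where "i < j" "\<theta> (f i) = \<theta> (f j)"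
proof -
  have "\<not> inj (\<lambda>i. \<theta> (f i))"
  proof
    assume "inj (\<lambda>i. \<theta> (f i))"
    then have "infinite (range (\<lambda>i. \<theta> (f i)))" using finite_imageD by blast
    moreover have "range (\<lambda>i. \<theta> (f i)) \<subseteq> range \<theta>" by blast
    ultimately show False using assms finite_subset by blast
  qed
  then obtain i j where "\<theta> (f i) = \<theta> (f j)" "i \<noteq> j" by (auto simp: inj_on_def)
  then show thesis using that[of i j] that[of j i] by (cases "i < j") auto
qed

lemma least_positive:
  assumes "P (k::int)" "0 < k"
  obtains a where "0 < a" "P a" "\<And>x. 0 < x \<Longrightarrow> P x \<Longrightarrow> a \<le> x"
proof -
  define n where "n = (LEAST n. 0 < n \<and> P (int n))"
  have "0 < nat k \<and> P (int (nat k))" using assms by simp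
  then have n: "0 < n \<and> P (int n)" unfolding n_def by (rule LeastI)
  show thesis
  proof (rule that[of "int n"])
    show "int n \<le> x" if "0 < x" "P x" for x
    proof -
      have "0 < nat x \<and> P (int (nat x))" using that by simp
      then have "n \<le> nat x" unfolding n_def by (rule Least_le)
      then show ?thesis using that by simp
    qed
  qed (use n in auto)
qed

lemma subgroup_int_multiple:
  assumes "0 < (a::int)" "P a" "\<And>x. 0 < x \<Longrightarrow> P x \<Longrightarrow> a \<le> x"
    and "\<And>x. P x \<Longrightarrow> P (x + a)" "\<And>x. P x \<Longrightarrow> P (x - a)" "P x"
  shows "a dvd x"
proof -
  have "P (x + q * a)" for q
  proof (induction q rule: int_induct[where k = 0])
    case base then show ?case using assms(6) by simp
  next
    case (step1 q) then show ?case using assms(4)[of "x + q * a"] by (simp add: algebra_simps)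
  next
    case (step2 q) then show ?case using assms(5)[of "x + q * a"] by (simp add: algebra_simps)
  qed
  from this[of "- (x div a)"] have "P (x mod a)" by (simp add: minus_div_mult_eq_mod)
  moreover have "0 \<le> x mod a" "x mod a < a" using assms(1) by simp_all
  ultimately have "x mod a = 0" using assms(3)[of "x mod a"] by force
  then show ?thesis by (simp add: dvd_eq_mod_eq_0)
qed

definition period :: "(lat \<Rightarrow> 'v) \<Rightarrow> lat \<Rightarrow> bool" where
  "period \<theta> t \<longleftrightarrow> (\<forall>u. \<theta> (u + t) = \<theta> u)"

lemma period_add: "period \<theta> s \<Longrightarrow> period \<theta> t \<Longrightarrow> period \<theta> (s + t)"
  by (simp add: period_def add.assoc[symmetric])
lemma period_uminus: "period \<theta> s \<Longrightarrow> period \<theta> (- s)"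
proof -
  assume s: "period \<theta> s"
  have "\<theta> (u + - s) = \<theta> u" for u
  proof -
    have "u + - s + s = u" by simp
    then show ?thesis using s unfolding period_def by metis
  qed
  then show ?thesis by (simp add: period_def)
qed
lemma period_diff: "period \<theta> s \<Longrightarrow> period \<theta> t \<Longrightarrow> period \<theta> (s - t)"
  using period_add[of \<theta> s "- t"] period_uminus[of \<theta> t] by simp

text \<open>Hermite normal form of the period lattice: \<open>a\<close> is the least positive horizontal
  period and \<open>c\<close> the least positive height of a period. Finiteness of the image
  provides both.\<close>
lemma torus_kernel:
  assumes per: "\<And>z w. \<theta> z = \<theta> w \<longleftrightarrow> period \<theta> (w - z)" and fin: "finite (range \<theta>)"
  obtains a b c where "0 < a" "0 < c" "0 \<le> b" "b < a" "\<And>z w. \<theta> z = \<theta> w \<longleftrightarrow> tred a b c z = tred a b c w"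
proof -
  obtain i j :: nat where "i < j" "\<theta> (int i, 0) = \<theta> (int j, 0)"
    using pigeonhole_sequence[OF fin, of "\<lambda>i. (int i, 0)"] by blast
  then have "period \<theta> (int j - int i, 0)" "0 < int j - int i" using per[of "(int i, 0)" "(int j, 0)"] by simp_all
  then obtain a where a: "0 < a" "period \<theta> (a, 0)" "\<And>x. 0 < x \<Longrightarrow> period \<theta> (x, 0) \<Longrightarrow> a \<le> x"
    using least_positive[of "\<lambda>x. period \<theta> (x, 0)"] by metis
  obtain i j :: nat where "i < j" "\<theta> (0, int i) = \<theta> (0, int j)"
    using pigeonhole_sequence[OF fin, of "\<lambda>i. (0, int i)"] by blast
  then have "\<exists>x. period \<theta> (x, int j - int i)" "0 < int j - int i" using per[of "(0, int i)" "(0, int j)"] by auto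
  then obtain c where c: "0 < c" "\<exists>x. period \<theta> (x, c)" "\<And>y. 0 < y \<Longrightarrow> \<exists>x. period \<theta> (x, y) \<Longrightarrow> c \<le> y"
    using least_positive[of "\<lambda>y. \<exists>x. period \<theta> (x, y)"] by metis
  then obtain b' where b': "period \<theta> (b', c)" by blast
  define b where "b = b' mod a"
  have adv: "a dvd x" if "period \<theta> (x, 0)" for x
  proof (rule subgroup_int_multiple[of a "\<lambda>x. period \<theta> (x, 0)"])
    show "period \<theta> (x + a, 0)" if "period \<theta> (x, 0)" for x using period_add[OF that a(2)] by simp
    show "period \<theta> (x - a, 0)" if "period \<theta> (x, 0)" for x using period_diff[OF that a(2)] by simp
  qed (use a that in auto)
  have cdv: "c dvd y" if "period \<theta> (x, y)" for x y
  proof (rule subgroup_int_multiple[of c "\<lambda>y. \<exists>x. period \<theta> (x, y)"])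
    show "\<exists>x. period \<theta> (x, y + c)" if "\<exists>x. period \<theta> (x, y)" for y
      using that period_add[OF _ b'] by fastforce
    show "\<exists>x. period \<theta> (x, y - c)" if "\<exists>x. period \<theta> (x, y)" for y
      using that period_diff[OF _ b'] by fastforce
  qed (use c that in auto)
  have mult: "period \<theta> (i * x, i * y)" if "period \<theta> (x, y)" for i x y
  proof (induction i rule: int_induct[where k = 0])
    case base show ?case by (simp add: period_def zero_prod_def[symmetric])
  next
    case (step1 i) then show ?case using period_add[OF _ that, of "(i * x, i * y)"] by (simp add: algebra_simps)
  next
    case (step2 i) then show ?case using period_diff[OF _ that, of "(i * x, i * y)"] by (simp add: algebra_simps)
  qed
  have b: "period \<theta> (b, c)"
    using period_diff[OF b' mult[OF a(2), of "b' div a"]] by (simp add: b_def minus_div_mult_eq_mod)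
  have iff: "period \<theta> z \<longleftrightarrow> tlat a b c z" for z
  proof
    assume p: "period \<theta> z"
    then obtain j where j: "snd z = j * c" using cdv[of "fst z" "snd z"] by (auto simp: dvd_def mult.commute)
    have "period \<theta> (fst z - j * b, 0)" using period_diff[OF p mult[OF b, of j]] j by (cases z) simp
    then obtain i where "fst z - j * b = i * a" using adv by (auto simp: dvd_def mult.commute)
    then have "z = (i * a + j * b, j * c)" using j by (simp add: prod_eq_iff)
    then show "tlat a b c z" using tlat_iff[OF c(1)] by blast
  next
    assume "tlat a b c z"
    then obtain i j where "z = (i * a + j * b, j * c)" using tlat_iff[OF c(1)] by blast
    then show "period \<theta> z" using period_add[OF mult[OF a(2), of i] mult[OF b, of j]] by simp
  qed
  show thesis
  proof (rule that[of a c b])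
    show "\<theta> z = \<theta> w \<longleftrightarrow> tred a b c z = tred a b c w" for z w
      using per[of w z] iff tred_eq_iff[OF c(1)] by metis
  qed (use a c b_def in auto)
qed

definition glide :: "(lat \<Rightarrow> 'v) \<Rightarrow> lat \<Rightarrow> bool" where
  "glide \<theta> t \<longleftrightarrow> (\<forall>u. \<theta> (kflip u + t) = \<theta> u)"

lemma kflip_add: "kflip (u + v) = kflip u + kflip v" by (simp add: kflip_def prod_eq_iff)
lemma kflip_diff: "kflip (u - v) = kflip u - kflip v" by (simp add: kflip_def prod_eq_iff)
lemma kflip_kflip [simp]: "kflip (kflip u) = u" by (simp add: kflip_def)
lemma kflip_simp [simp]: "kflip (x, y) = (y - x, y)" by (simp add: kflip_def)

lemma glide_glide: "glide \<theta> s \<Longrightarrow> glide \<theta> t \<Longrightarrow> period \<theta> (kflip s + t)"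
proof -
  assume s: "glide \<theta> s" and t: "glide \<theta> t"
  have "\<theta> (u + (kflip s + t)) = \<theta> u" for u
  proof -
    have e: "u + (kflip s + t) = kflip (kflip u + s) + t" by (simp add: kflip_add add.assoc)
    show ?thesis unfolding e using s t by (simp add: glide_def)
  qed
  then show ?thesis by (simp add: period_def)
qed

lemma glide_period: "glide \<theta> s \<Longrightarrow> period \<theta> t \<Longrightarrow> glide \<theta> (s + t)"
  by (simp add: period_def glide_def add.assoc[symmetric])

lemma glide_inverse: "glide \<theta> t \<Longrightarrow> glide \<theta> (- kflip t)"
proof -
  assume t: "glide \<theta> t"
  have "\<theta> (kflip u + - kflip t) = \<theta> u" for u
  proof -
    have e: "kflip (kflip u + - kflip t) + t = u" by (simp add: kflip_diff)
    show ?thesis using t unfolding glide_def by (metis e)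
  qed
  then show ?thesis by (simp add: glide_def)
qed

lemma period_mult:
  assumes "period \<theta> (x, y)"
  shows "period \<theta> (i * x, i * y)"
proof (induction i rule: int_induct[where k = 0])
  case base show ?case by (simp add: period_def zero_prod_def[symmetric])
next
  case (step1 i) then show ?case using period_add[OF _ assms, of "(i * x, i * y)"] by (simp add: algebra_simps)
next
  case (step2 i) then show ?case using period_diff[OF _ assms, of "(i * x, i * y)"] by (simp add: algebra_simps)
qed

text \<open>The heights of all periods and glides form a cyclic group, generated by \<open>m\<close>. A
  period of height \<open>m\<close> would cancel against some glide and leave a reflection of
  height 0, which has fixed points and is excluded; so \<open>m\<close> is the height of a glide
  \<open>(g,m)\<close>, periods have even multiples of \<open>m\<close> as heights, and glides
  odd multiples. With \<open>a\<close> the least horizontal period this lists the whole group.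
  Moving the origin by \<open>(0,-g)\<close> normalises \<open>g\<close> to 0.\<close>
lemma klein_kernel:
  assumes per: "\<And>z w. \<theta> z = \<theta> w \<longleftrightarrow> period \<theta> (w - z) \<or> glide \<theta> (w - kflip z)"
    and fin: "finite (range \<theta>)" and ex: "\<exists>t. glide \<theta> t" and free: "\<And>s. \<not> glide \<theta> (s, 0)"
  obtains a m v where "0 < a" "0 < m" "\<And>z w. \<theta> (z + v) = \<theta> (w + v) \<longleftrightarrow> kred a m z = kred a m w"
proof -
  define H where "H y \<longleftrightarrow> (\<exists>x. period \<theta> (x, y) \<or> glide \<theta> (x, y))" for y
  obtain t where t: "glide \<theta> t" using ex by blast
  have t0: "snd t \<noteq> 0" using free t by (metis prod.collapse)
  have "H (snd t)" using t unfolding H_def by (metis prod.collapse)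
  have "glide \<theta> (fst (- kflip t), - snd t)" using glide_inverse[OF t] by (simp add: kflip_def)
  then have "H (- snd t)" unfolding H_def by blast
  then have "\<exists>k. H k \<and> 0 < k" using \<open>H (snd t)\<close> t0 by (cases "0 < snd t") (auto intro: exI[of _ "snd t"] exI[of _ "- snd t"])
  then obtain m where m: "0 < m" "H m" "\<And>y. 0 < y \<Longrightarrow> H y \<Longrightarrow> m \<le> y"
    using least_positive[of H] by metis
  have Hadd: "H (x + y)" if hx: "H x" and hy: "H y" for x y
  proof -
    obtain p q where p: "period \<theta> (p, x) \<or> glide \<theta> (p, x)" and q: "period \<theta> (q, y) \<or> glide \<theta> (q, y)"
      using hx hy unfolding H_def by blast
    have "period \<theta> (p + q, x + y)" if "period \<theta> (p, x)" "period \<theta> (q, y)" using period_add[OF that] by simp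
    moreover have "glide \<theta> (p + q, x + y)" if "glide \<theta> (p, x)" "period \<theta> (q, y)" using glide_period[OF that] by simp
    moreover have "glide \<theta> (q + p, x + y)" if "glide \<theta> (q, y)" "period \<theta> (p, x)" using glide_period[OF that] by (simp add: add.commute)
    moreover have "period \<theta> (x - p + q, x + y)" if "glide \<theta> (p, x)" "glide \<theta> (q, y)" using glide_glide[OF that] by simp
    ultimately show ?thesis unfolding H_def using p q by blast
  qed
  have Hneg: "H (- x)" if hx: "H x" for x
  proof -
    obtain p where p: "period \<theta> (p, x) \<or> glide \<theta> (p, x)" using hx unfolding H_def by blast
    have "period \<theta> (- p, - x)" if "period \<theta> (p, x)" using period_uminus[OF that] by simp
    moreover have "glide \<theta> (- (x - p), - x)" if "glide \<theta> (p, x)" using glide_inverse[OF that] by (simp add: kflip_def)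
    ultimately show ?thesis unfolding H_def using p by blast
  qed
  have Hdvd: "m dvd y" if "H y" for y
    by (rule subgroup_int_multiple[of m H]) (use m that Hadd Hneg[OF m(2)] Hadd[of _ "- m"] in \<open>auto simp flip: add_uminus_conv_diff\<close>)
  obtain g where g: "glide \<theta> (g, m)"
  proof -
    obtain p where p: "period \<theta> (p, m) \<or> glide \<theta> (p, m)" using m(2) unfolding H_def by blast
    show thesis
    proof (cases "glide \<theta> (p, m)")
      case True then show thesis by (rule that)
    next
      case False
      then have p: "period \<theta> (p, m)" using p by blast
      obtain j where j: "snd t = j * m" using Hdvd[OF \<open>H (snd t)\<close>] by (auto simp: dvd_def mult.commute)
      have "glide \<theta> (t + - (j * p, j * m))" by (rule glide_period[OF t period_uminus[OF period_mult[OF p]]])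
      then have "glide \<theta> (fst t - j * p, 0)" using j by (cases t) simp
      then show thesis using free by blast
    qed
  qed
  have gg: "period \<theta> (m, 2 * m)" using glide_glide[OF g g] by simp
  have gj: "period \<theta> (j * m, 2 * j * m)" for j using period_mult[OF gg, of j] by (simp add: algebra_simps)
  obtain i j :: nat where ij: "i < j" "\<theta> (int i, 0) = \<theta> (int j, 0)"
    using pigeonhole_sequence[OF fin, of "\<lambda>i. (int i, 0)"] by blast
  then have "period \<theta> (int j - int i, 0)" using per[of "(int i, 0)" "(int j, 0)"] free by simp
  then obtain a where a: "0 < a" "period \<theta> (a, 0)" "\<And>x. 0 < x \<Longrightarrow> period \<theta> (x, 0) \<Longrightarrow> a \<le> x"
    using least_positive[of "\<lambda>x. period \<theta> (x, 0)" "int j - int i"] ij(1) by auto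
  have adv: "a dvd x" if "period \<theta> (x, 0)" for x
  proof (rule subgroup_int_multiple[of a "\<lambda>x. period \<theta> (x, 0)"])
    show "period \<theta> (x + a, 0)" if "period \<theta> (x, 0)" for x using period_add[OF that a(2)] by simp
    show "period \<theta> (x - a, 0)" if "period \<theta> (x, 0)" for x using period_diff[OF that a(2)] by simp
  qed (use a that in auto)
  have odd_period: False if "period \<theta> (x, (2 * j + 1) * m)" for x j
  proof -
    have "period \<theta> ((x, (2 * j + 1) * m) - (j * m, 2 * j * m))" by (rule period_diff[OF that gj])
    then have "period \<theta> (x - j * m, m)" by (simp add: algebra_simps)
    from glide_period[OF g period_uminus[OF this]] have "glide \<theta> (g + (j * m - x), 0)" by simp
    then show False using free by blast
  qed
  have period_iff: "period \<theta> z \<longleftrightarrow> (\<exists>i j. z = (j * m + i * a, 2 * j * m))" for z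
  proof
    assume p: "period \<theta> z"
    then have "H (snd z)" unfolding H_def by (metis prod.collapse)
    then obtain q where q: "snd z = q * m" using Hdvd by (auto simp: dvd_def mult.commute)
    have "even q"
    proof (rule ccontr)
      assume "odd q"
      then obtain j where "q = 2 * j + 1" by (elim oddE)
      then show False using odd_period[of "fst z" j] p q by (metis prod.collapse)
    qed
    then obtain j where j: "q = 2 * j" by (elim evenE)
    have "period \<theta> (z - (j * m, 2 * j * m))" by (rule period_diff[OF p gj])
    then have "period \<theta> (fst z - j * m, 0)" using q j by (cases z) simp
    then obtain i where "fst z - j * m = i * a" using adv by (auto simp: dvd_def mult.commute)
    then have "z = (j * m + i * a, 2 * j * m)" using q j by (simp add: prod_eq_iff)
    then show "\<exists>i j. z = (j * m + i * a, 2 * j * m)" by blast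
  next
    assume "\<exists>i j. z = (j * m + i * a, 2 * j * m)"
    then obtain i j where "z = (j * m + i * a, 2 * j * m)" by blast
    then show "period \<theta> z" using period_add[OF gj[of j] period_mult[OF a(2), of i]] by simp
  qed
  have glide_iff: "glide \<theta> z \<longleftrightarrow> (\<exists>i j. z = (g, m) + (j * m + i * a, 2 * j * m))" for z
  proof
    assume z: "glide \<theta> z"
    have "period \<theta> (kflip (- kflip (g, m)) + z)" by (rule glide_glide[OF glide_inverse[OF g] z])
    moreover have "kflip (- kflip (g, m)) = - (g, m)" by simp
    ultimately obtain i j where "- (g, m) + z = (j * m + i * a, 2 * j * m)" using period_iff by metis
    then have "z = (g, m) + (j * m + i * a, 2 * j * m)" by (metis add.assoc add_0 add.right_inverse)
    then show "\<exists>i j. z = (g, m) + (j * m + i * a, 2 * j * m)" by blast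
  next
    assume "\<exists>i j. z = (g, m) + (j * m + i * a, 2 * j * m)"
    then obtain i j where z: "z = (g, m) + (j * m + i * a, 2 * j * m)" by blast
    have "period \<theta> (j * m + i * a, 2 * j * m)" using period_iff by blast
    then show "glide \<theta> z" unfolding z by (rule glide_period[OF g])
  qed
  show thesis
  proof (rule that[of a m "(0, - g)"])
    fix z w :: lat
    have 1: "w + (0, - g) - (z + (0, - g)) = w - z" by (simp add: prod_eq_iff)
    have 2: "w + (0, - g) - kflip (z + (0, - g)) = w - kflip z + (g, 0)" by (simp add: kflip_def prod_eq_iff)
    have "glide \<theta> (w - kflip z + (g, 0)) \<longleftrightarrow> (\<exists>i j. w = kflip z + (j * m + i * a, m + 2 * j * m))"
      unfolding glide_iff by (auto simp: prod_eq_iff algebra_simps)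
    moreover have "period \<theta> (w - z) \<longleftrightarrow> (\<exists>i j. w = z + (j * m + i * a, 2 * j * m))"
      unfolding period_iff by (auto simp: prod_eq_iff algebra_simps)
    ultimately show "\<theta> (z + (0, - g)) = \<theta> (w + (0, - g)) \<longleftrightarrow> kred a m z = kred a m w"
      unfolding per 1 2 kred_eq_iff[OF m(1)] krel_def by blast
  qed (use a m in auto)
qed

text \<open>Change of coordinates that turns the reflection \<open>(x,y) \<mapsto> (y,x)\<close>, whose
  axis is parallel to the edges in direction \<open>(1,1)\<close>, into \<open>kflip\<close>.
  Every reflection in the point group is conjugate under rotations either to this one or to
  \<open>kflip\<close>.\<close>
definition shear :: "lat \<Rightarrow> lat" where "shear z = (fst z, fst z + snd z)"

lemma id_dihedral: "id \<in> dihedral"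
  using dihedral_intros(1)[of 0] by (simp add: id_def)

text \<open>Deck transformations other than translations are glide reflections, by
  \<open>symm_rotation\<close>. A product of two of them with different axis directions would
  have a nontrivial rotation part, so all glides share one linear part, which is conjugated into
  one of the two standard positions; a sheared coordinate system makes the two positions
  formally equal.\<close>
theorem hex_cover_kernel:
  assumes K: "hex_cover \<phi> K" and fin: "finite (vertices K)"
  shows "(\<exists>a b c. 0 < a \<and> 0 < c \<and> 0 \<le> b \<and> b < a \<and> nat (a * c) = card (vertices K) \<and>
            (\<forall>z w. \<phi> z = \<phi> w \<longleftrightarrow> tred a b c z = tred a b c w)) \<or>
         (\<exists>B v P a m. B \<in> dihedral \<and> (P = id \<or> P = shear) \<and> 0 < a \<and> 0 < m \<and> nat (a * m) = card (vertices K) \<and>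
            (\<forall>z w. \<phi> (B z + v) = \<phi> (B w + v) \<longleftrightarrow> kred a m (P z) = kred a m (P w)))"
proof (cases "\<forall>A t. symm \<phi> A t \<longrightarrow> A = id")
  case True
  have per: "\<phi> z = \<phi> w \<longleftrightarrow> period \<phi> (w - z)" for z w
  proof
    assume "\<phi> z = \<phi> w"
    then obtain A t where A: "symm \<phi> A t" "A z + t = w" using cover_symm[OF K] by metis
    then have "A = id" using True by blast
    then show "period \<phi> (w - z)" using A by (auto simp: symm_def period_def)
  next
    assume "period \<phi> (w - z)"
    then have "\<phi> (z + (w - z)) = \<phi> z" unfolding period_def by blast
    then show "\<phi> z = \<phi> w" by simp
  qed
  have "finite (range \<phi>)" using fin hex_cover_vertices[OF K] by simp
  then obtain a b c where abc: "0 < a" "0 < c" "0 \<le> b" "b < a" "\<And>z w. \<phi> z = \<phi> w \<longleftrightarrow> tred a b c z = tred a b c w"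
    using torus_kernel[OF per] by metis
  have "card (range \<phi>) = nat (a * c)"
    by (rule card_range_box[OF abc(5) tred_box[OF abc(1,2)] tred_id])
  then show ?thesis using abc hex_cover_vertices[OF K] by metis
next
  case False
  then obtain A0 t0 where A0: "symm \<phi> A0 t0" "A0 \<noteq> id" by blast
  then obtain k where k: "A0 = rot6 ^^ k \<circ> mir"
    using symm_rotation[OF K] unfolding symm_def by (metis dihedral_cases)
  \<comment> \<open>Rotating by \<open>j\<close> steps shifts the exponent of a reflection by \<open>2 j\<close>; so \<open>k\<close> is normalised to 2 or 3,
     according to its parity. There \<open>rot6 ^^ 2 \<circ> mir\<close> swaps the coordinates and \<open>rot6 ^^ 3 \<circ> mir\<close> is \<open>kflip\<close>.\<close>
  define j where "j = k div 2 + 2"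
  define e where "e = 2 + k mod 2"
  define B where "B = rot6 ^^ j"
  define As where "As = rot6 ^^ e \<circ> mir"
  define P where "P = (if even k then shear else id)"
  define Q :: "lat \<Rightarrow> lat" where "Q = (if even k then (\<lambda>z. (fst z, snd z - fst z)) else id)"
  have As: "As (x, y) = (if even k then (y, x) else (y - x, y))" for x y
  proof -
    have "even k \<Longrightarrow> e = 2" "odd k \<Longrightarrow> e = 3" by (simp_all add: e_def odd_iff_mod_2_eq_one)
    then show ?thesis by (auto simp: As_def numeral_2_eq_2 numeral_3_eq_3)
  qed
  have PQ: "P (Q z) = z" "Q (P z) = z" for z by (simp_all add: P_def Q_def shear_def)
  have PAs: "P (As z) = kflip (P z)" for z by (cases z) (simp add: P_def As shear_def kflip_def)
  have lin: "P (z + w) = P z + P w" "P (z - w) = P z - P w" "Q (z + w) = Q z + Q w" "Q (z - w) = Q z - Q w" for z w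
    by (simp_all add: P_def Q_def shear_def prod_eq_iff)
  have QAs: "Q (kflip z) = As (Q z)" for z using PAs[of "Q z"] PQ by metis
  have AsAs: "As (As z) = z" for z by (cases z) (simp add: As)
  have As_ne: "As \<noteq> id"
  proof
    assume "As = id"
    then have "As (1, 0) = (1, 0)" by simp
    then show False using As[of 1 0] by (simp split: if_splits)
  qed
  have Bd: "B \<in> dihedral" and Asd: "As \<in> dihedral" by (simp_all add: B_def As_def dihedral_intros)
  have conj: "A0 (B u) = B (As u)" for u
  proof -
    have "k + 5 * (d + 2) = (d + 2 + (2 + r)) + (d + 1) * 6" if "k = 2 * d + r" for d r using that by simp
    from this[of "k div 2" "k mod 2"]
    have "k + 5 * j = (j + e) + (k div 2 + 1) * 6" unfolding j_def e_def by simp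
    then have "(k + 5 * j) mod 6 = (j + e) mod 6" by (metis mod_mult_self1)
    then have r: "rot6 ^^ (k + 5 * j) = rot6 ^^ (j + e)" using rot6_funpow_mod by metis
    have "A0 (B u) = (rot6 ^^ (k + 5 * j)) (mir u)" by (simp add: k B_def mir_rot6_funpow funpow_add)
    also have "\<dots> = B (As u)" unfolding r by (simp add: B_def As_def funpow_add)
    finally show ?thesis .
  qed
  define \<phi>' where "\<phi>' z = \<phi> (B z)" for z
  have K': "hex_cover \<phi>' K" using hex_cover_reparam[OF K Bd, of 0] by (simp add: \<phi>'_def[abs_def])
  obtain C where C: "B \<circ> C = id" using dihedral_inverse[OF Bd] by metis
  have sAs: "symm \<phi>' As (C t0)"
    unfolding symm_def
  proof (intro conjI allI)
    fix u
    have "B (C t0) = t0" using C by (simp add: fun_eq_iff)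
    then have "B (As u + C t0) = A0 (B u) + t0" by (simp add: dihedral_add[OF Bd] conj)
    then show "\<phi>' (As u + C t0) = \<phi>' u" using A0(1) by (simp add: \<phi>'_def symm_def)
  qed (rule Asd)
  have only: "A = id \<or> A = As" if A: "symm \<phi>' A t" for A t
  proof -
    have "A \<in> dihedral" using A by (simp add: symm_def)
    then show ?thesis
    proof (cases A rule: dihedral_cases)
      case (1 i) then show ?thesis using symm_rotation[OF K'] A by blast
    next
      case (2 i)
      have eq: "A \<circ> As = rot6 ^^ (i + 5 * e)" by (rule ext) (simp add: 2 As_def mir_rot6_funpow mir_mir funpow_add)
      have "A \<circ> As = id" using symm_comp[OF A sAs] symm_rotation[OF K'] unfolding eq by blast
      then have "A z = As z" for z using AsAs[of z] by (metis comp_apply id_apply)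
      then show ?thesis by blast
    qed
  qed
  define \<theta> where "\<theta> z = \<phi>' (Q z)" for z
  have glide_symm: "glide \<theta> (P t) \<longleftrightarrow> symm \<phi>' As t" for t
  proof
    assume g: "glide \<theta> (P t)"
    show "symm \<phi>' As t" unfolding symm_def
    proof (intro conjI allI)
      fix u
      have "\<theta> (kflip (P u) + P t) = \<theta> (P u)" using g by (simp add: glide_def)
      then show "\<phi>' (As u + t) = \<phi>' u" by (simp add: \<theta>_def lin QAs PQ)
    qed (rule Asd)
  next
    assume "symm \<phi>' As t"
    then show "glide \<theta> (P t)" by (simp add: glide_def symm_def \<theta>_def lin QAs PQ)
  qed
  have per: "\<theta> z = \<theta> w \<longleftrightarrow> period \<theta> (w - z) \<or> glide \<theta> (w - kflip z)" for z w
  proof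
    assume "\<theta> z = \<theta> w"
    then obtain A t where A: "symm \<phi>' A t" "A (Q z) + t = Q w" using cover_symm[OF K'] unfolding \<theta>_def by metis
    from only[OF A(1)] show "period \<theta> (w - z) \<or> glide \<theta> (w - kflip z)"
    proof
      assume "A = id"
      then have "t = Q (w - z)" using A(2) by (simp add: lin algebra_simps)
      then have "period \<theta> (w - z)" using A(1) \<open>A = id\<close> by (simp add: period_def symm_def \<theta>_def lin)
      then show ?thesis ..
    next
      assume "A = As"
      then have "t = Q (w - kflip z)" using A(2) by (simp add: lin QAs algebra_simps)
      then have "P t = w - kflip z" by (simp add: PQ)
      then have "glide \<theta> (w - kflip z)" using glide_symm[of t] A(1) \<open>A = As\<close> by simp
      then show ?thesis ..
    qed
  next
    assume "period \<theta> (w - z) \<or> glide \<theta> (w - kflip z)"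
    then show "\<theta> z = \<theta> w"
    proof
      assume "period \<theta> (w - z)"
      then have "\<theta> (z + (w - z)) = \<theta> z" unfolding period_def by blast
      then show ?thesis by simp
    next
      assume "glide \<theta> (w - kflip z)"
      then have "\<theta> (kflip z + (w - kflip z)) = \<theta> z" unfolding glide_def by blast
      then show ?thesis by simp
    qed
  qed
  have "range \<theta> \<subseteq> range \<phi>" by (auto simp: \<theta>_def \<phi>'_def)
  moreover have "\<phi> z \<in> range \<theta>" for z
  proof -
    have "B (Q (P (C z))) = z" using C by (simp add: PQ fun_eq_iff)
    then have "\<phi> z = \<theta> (P (C z))" by (simp add: \<theta>_def \<phi>'_def)
    then show ?thesis by (rule range_eqI)
  qed
  ultimately have ran: "range \<theta> = vertices K" unfolding hex_cover_vertices[OF K] by blast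
  have ex: "\<exists>t. glide \<theta> t" using glide_symm sAs by blast
  have free: "\<not> glide \<theta> (s, 0)" for s
  proof
    assume "glide \<theta> (s, 0)"
    then have s: "symm \<phi>' As (Q (s, 0))" using glide_symm[of "Q (s, 0)"] by (simp add: PQ)
    \<comment> \<open>A glide of height 0 fixes the point \<open>(s,s)\<close>.\<close>
    have "As (Q (s, s)) + Q (s, 0) = Q (kflip (s, s) + (s, 0))" by (simp only: lin QAs)
    also have "\<dots> = Q (s, s)" by simp
    finally have "As (Q (s, s)) + Q (s, 0) \<in> star (Q (s, s))" by (simp add: star_altdef)
    then show False using symm_free(1)[OF K' s] As_ne by blast
  qed
  have "finite (range \<theta>)" using fin ran by simp
  then obtain a m v where am: "0 < a" "0 < m" "\<And>z w. \<theta> (z + v) = \<theta> (w + v) \<longleftrightarrow> kred a m z = kred a m w"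
    using klein_kernel[OF per _ ex free] by metis
  have "range (\<lambda>z. \<theta> (z + v)) = range \<theta>"
  proof -
    have "\<theta> z \<in> range (\<lambda>z. \<theta> (z + v))" for z by (rule range_eqI[of _ _ "z - v"]) simp
    then show ?thesis by blast
  qed
  moreover have "card (range (\<lambda>z. \<theta> (z + v))) = nat (a * m)"
    by (rule card_range_box[OF am(3) kred_box[OF am(1,2)] kred_id])
  ultimately have n: "nat (a * m) = card (vertices K)" using ran by simp
  have "\<phi> (B z + B (Q v)) = \<phi> (B w + B (Q v)) \<longleftrightarrow> kred a m (P z) = kred a m (P w)" for z w
    using am(3)[of "P z" "P w"] by (simp add: \<theta>_def \<phi>'_def lin PQ dihedral_add[OF Bd])
  moreover have "P = id \<or> P = shear" by (simp add: P_def)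
  ultimately show ?thesis using Bd am(1,2) n by blast
qed


section \<open>Tabulated coverings\<close>

text \<open>The point group as a list of matrices \<open>(p, q; r, s)\<close>, for checks by evaluation:
  the powers of the rotation, followed by the same powers composed with \<open>mir\<close>.\<close>
definition dihedral_matrices :: "(int \<times> int \<times> int \<times> int) list" where
  "dihedral_matrices = [(1,0,0,1), (1,-1,1,0), (0,-1,1,-1), (-1,0,0,-1), (-1,1,-1,0), (0,1,-1,1),
     (1,-1,0,-1), (1,0,1,-1), (0,1,1,0), (-1,1,0,1), (-1,0,-1,1), (0,-1,-1,0)]"

definition mat_app :: "int \<times> int \<times> int \<times> int \<Rightarrow> lat \<Rightarrow> lat" where
  "mat_app M z = (case M of (p, q, r, s) \<Rightarrow> (p * fst z + q * snd z, r * fst z + s * snd z))"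

lemma dihedral_matrix:
  assumes "A \<in> dihedral"
  obtains M where "M \<in> set dihedral_matrices" "A = mat_app M"
proof -
  have p: "rot6 ^^ 2 = rot6 \<circ> rot6" "rot6 ^^ 3 = rot6 \<circ> (rot6 \<circ> rot6)" "rot6 ^^ 4 = rot6 \<circ> (rot6 \<circ> (rot6 \<circ> rot6))"
    "rot6 ^^ 5 = rot6 \<circ> (rot6 \<circ> (rot6 \<circ> (rot6 \<circ> rot6)))"
    by (rule ext, simp add: eval_nat_numeral)+
  have 1: "\<exists>M\<in>set dihedral_matrices. rot6 ^^ k = mat_app M \<and> (\<exists>N\<in>set dihedral_matrices. rot6 ^^ k \<circ> mir = mat_app N)" if "k < 6" for k
    using that by (elim less6_cases) (simp_all add: p dihedral_matrices_def fun_eq_iff mat_app_def rot6_def mir_def prod_eq_iff)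
  then have "\<exists>M\<in>set dihedral_matrices. rot6 ^^ k = mat_app M \<and> (\<exists>N\<in>set dihedral_matrices. rot6 ^^ k \<circ> mir = mat_app N)" for k
    using rot6_funpow_mod[of k] by simp
  then show thesis using assms that by (elim dihedral_cases) metis+
qed

text \<open>A map on the lattice given by a list of values on the box, row by row, and by reduction of
  points to the box.\<close>
definition tab_map :: "int \<Rightarrow> (lat \<Rightarrow> lat) \<Rightarrow> 'v list \<Rightarrow> lat \<Rightarrow> 'v" where
  "tab_map a \<rho> tab z = tab ! nat (snd (\<rho> z) * a + fst (\<rho> z))"

lemma tab_map_eq_iff:
  fixes a c :: int
  assumes "\<And>z. \<rho> z \<in> {0..<a} \<times> {0..<c}" "distinct tab" "length tab = nat (a * c)"
  shows "tab_map a \<rho> tab z = tab_map a \<rho> tab w \<longleftrightarrow> \<rho> z = \<rho> w"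
proof
  have bd: "0 \<le> y * a + x" "y * a + x < a * c" if "0 \<le> x" "x < a" "0 \<le> y" "y < c" for x y
  proof -
    show "0 \<le> y * a + x" using that by simp
    have "y * a + x < (y + 1) * a" using that by (simp add: algebra_simps)
    also have "\<dots> \<le> c * a" using that by (intro mult_right_mono) auto
    finally show "y * a + x < a * c" by (simp add: mult.commute)
  qed
  obtain x y x' y' where r: "\<rho> z = (x, y)" "\<rho> w = (x', y')" by force
  have b: "0 \<le> x" "x < a" "0 \<le> y" "y < c" "0 \<le> x'" "x' < a" "0 \<le> y'" "y' < c"
    using assms(1)[of z] assms(1)[of w] by (simp_all add: r)
  assume "tab_map a \<rho> tab z = tab_map a \<rho> tab w"
  then have "nat (y * a + x) = nat (y' * a + x')"
    using nth_eq_iff_index_eq[OF assms(2)] bd[OF b(1-4)] bd[OF b(5-8)] by (simp add: tab_map_def r assms(3) nat_less_eq_zless)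
  then have e: "y * a + x = y' * a + x'" using bd[OF b(1-4)] bd[OF b(5-8)] by simp
  have "(y * a + x) mod a = x" "(y' * a + x') mod a = x'" "(y * a + x) div a = y" "(y' * a + x') div a = y'"
    using b by simp_all
  then have "x = x'" "y = y'" using e by metis+
  then show "\<rho> z = \<rho> w" using r by simp
qed (simp add: tab_map_def)

definition star_list :: "lat \<Rightarrow> lat list" where
  "star_list z = map (\<lambda>d. z + d) [(0, 0), (1, 0), (1, 1), (0, 1), (-1, 0), (-1, -1), (0, -1)]"

text \<open>The six triangles at a lattice point. Each triangle is thus listed at all three corners, which
  costs nothing and avoids choosing base points.\<close>
definition hex_list :: "lat \<Rightarrow> lat list list" where
  "hex_list z = map (\<lambda>(d, e). [z, z + d, z + e])
     [((1, 0), (1, 1)), ((1, 1), (0, 1)), ((0, 1), (-1, 0)), ((-1, 0), (-1, -1)), ((-1, -1), (0, -1)), ((0, -1), (1, 0))]"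

fun same_face :: "'v list \<Rightarrow> 'v list \<Rightarrow> bool" where
  "same_face xs ys = list_all (\<lambda>x. x \<in> set ys) xs"

definition faces_match :: "'v list list \<Rightarrow> 'v list list \<Rightarrow> bool" where
  "faces_match fs gs \<longleftrightarrow> list_all (\<lambda>f. list_ex (\<lambda>g. same_face f g) gs) fs"

text \<open>The fibre relation of the reduction is invariant under deck transformations, as in
  \<open>hex_cover\<close>.\<close>
definition lattice_rel :: "(lat \<Rightarrow> lat) \<Rightarrow> bool" where
  "lattice_rel \<rho> \<longleftrightarrow> (\<forall>z w. \<rho> z = \<rho> w \<longrightarrow> (\<exists>A\<in>dihedral. \<forall>u. \<rho> (z + u) = \<rho> (w + A u)))"

text \<open>Deck transformations carry the star of any point to the star of a representative, so
  injectivity on stars and the identity of the two lists of faces need to be inspected only at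
  the finitely many representatives.\<close>
lemma tabulated_cover:
  assumes box: "\<And>z. \<rho> z \<in> {0..<a} \<times> {0..<c}" and dist: "distinct tab" and len: "length tab = nat (a * c)"
    and rel: "lattice_rel \<rho>" and reps: "\<And>z. \<exists>r\<in>set rs. \<rho> z = \<rho> r"
    and inj: "list_all (\<lambda>r. distinct (map (tab_map a \<rho> tab) (star_list r))) rs"
    and F3: "list_all (\<lambda>f. length f = 3 \<and> distinct f) fs"
    and m1: "faces_match (concat (map (\<lambda>r. map (map (tab_map a \<rho> tab)) (hex_list r)) rs)) fs"
    and m2: "faces_match fs (concat (map (\<lambda>r. map (map (tab_map a \<rho> tab)) (hex_list r)) rs))"
  shows "hex_cover (tab_map a \<rho> tab) (generated_complex (set ` set fs))"
proof -
  define \<phi> where "\<phi> = tab_map a \<rho> tab"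
  have eq: "\<phi> z = \<phi> w \<longleftrightarrow> \<rho> z = \<rho> w" for z w unfolding \<phi>_def by (rule tab_map_eq_iff[OF box dist len])
  have N: "\<exists>A\<in>dihedral. \<forall>u. \<phi> (z + u) = \<phi> (w + A u)" if "\<phi> z = \<phi> w" for z w
    using rel that unfolding lattice_rel_def eq by blast
  have star: "set (star_list z) = star z" for z by (auto simp: star_list_def star_def)
  have injr: "inj_on \<phi> (star r)" if "r \<in> set rs" for r
  proof -
    have "distinct (map \<phi> (star_list r))" using inj that by (simp add: list_all_iff \<phi>_def)
    then show ?thesis by (simp add: distinct_map star)
  qed
  have inj: "inj_on \<phi> (star z)" for z
  proof -
    obtain r where r: "r \<in> set rs" "\<phi> z = \<phi> r" using reps eq by blast
    obtain A where A: "A \<in> dihedral" "\<And>u. \<phi> (z + u) = \<phi> (r + A u)" using N[OF r(2)] by blast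
    show ?thesis
    proof (rule inj_onI)
      fix v w assume vw: "v \<in> star z" "w \<in> star z" "\<phi> v = \<phi> w"
      have e: "A u + (r - A z) = r + A (u - z)" for u using A(1) by (simp add: dihedral_diff)
      have "A z + (r - A z) = r" by simp
      then have st: "A v + (r - A z) \<in> star r" "A w + (r - A z) \<in> star r"
        using dihedral_star[OF A(1), of "r - A z" z] vw by (auto simp only:)
      have "\<phi> (A v + (r - A z)) = \<phi> v" "\<phi> (A w + (r - A z)) = \<phi> w" using A(2)[of "v - z"] A(2)[of "w - z"] unfolding e by simp_all
      then have "A v + (r - A z) = A w + (r - A z)" using inj_onD[OF injr[OF r(1)] _ st] vw(3) by simp
      then have "A v = A w" by simp
      then show "v = w" using dihedral_inj[OF A(1)] by (simp add: inj_eq)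
    qed
  qed
  have hex: "set ` set (hex_list z) = {{z, z + hexdir k, z + hexdir (Suc k)} | k. True}" for z
  proof (intro subset_antisym subsetI)
    have six: "hexdir (Suc 5) = (1, 0)" using hexdir_mod[of 6] by (simp add: hexdir_values)
    fix t assume "t \<in> set ` set (hex_list z)"
    then have "t \<in> {{z, z + hexdir 0, z + hexdir (Suc 0)}, {z, z + hexdir 1, z + hexdir (Suc 1)}, {z, z + hexdir 2, z + hexdir (Suc 2)},
      {z, z + hexdir 3, z + hexdir (Suc 3)}, {z, z + hexdir 4, z + hexdir (Suc 4)}, {z, z + hexdir 5, z + hexdir (Suc 5)}}"
      using six by (auto simp: hex_list_def hexdir_values hexdir_Suc)
    then show "t \<in> {{z, z + hexdir k, z + hexdir (Suc k)} | k. True}" by blast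
  next
    fix t assume "t \<in> {{z, z + hexdir k, z + hexdir (Suc k)} | k. True}"
    then obtain k where t: "t = {z, z + hexdir k, z + hexdir (Suc k)}" by blast
    show "t \<in> set ` set (hex_list z)" unfolding t
      by (cases k rule: hexdir_cases) (simp_all add: hex_list_def hexdir_Suc)
  qed
  have sf: "set f = set g" if "same_face f g" "length f = 3" "distinct f" "length g = 3" for f g :: "'a list"
  proof -
    have "set f \<subseteq> set g" using that(1) by (auto simp: list_all_iff)
    moreover have "card (set f) = 3" using that by (simp add: distinct_card)
    moreover have "card (set g) \<le> 3" using that card_length[of g] by simp
    ultimately show ?thesis by (metis List.finite_set card_mono card_subset_eq le_antisym)
  qed
  have hl: "length t = 3 \<and> distinct (map \<phi> t)" if "r \<in> set rs" "t \<in> set (hex_list r)" for r t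
  proof -
    obtain x y where "r = (x, y)" by force
    then have "length t = 3 \<and> distinct t \<and> set t \<subseteq> star r" using that(2)
      by (simp add: hex_list_def) (elim disjE; simp add: star_def)
    then show ?thesis using inj_on_subset[OF injr[OF that(1)]] by (simp add: distinct_map)
  qed
  have "(`) \<phi> ` lattice_triangles = set ` set fs"
  proof (intro subset_antisym subsetI)
    fix s assume "s \<in> (`) \<phi> ` lattice_triangles"
    then obtain t where t: "s = \<phi> ` t" "t \<in> lattice_triangles" by blast
    obtain z k where zk: "t = {z, z + hexdir k, z + hexdir (Suc k)}" using t(2) unfolding lattice_triangles_altdef by blast
    obtain r where r: "r \<in> set rs" "\<phi> z = \<phi> r" using reps eq by blast
    obtain A where A: "A \<in> dihedral" "\<And>u. \<phi> (z + u) = \<phi> (r + A u)" using N[OF r(2)] by blast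
    obtain i where "A (hexdir k) = hexdir i \<and> A (hexdir (Suc k)) = hexdir (Suc i) \<or>
      A (hexdir k) = hexdir (Suc i) \<and> A (hexdir (Suc k)) = hexdir i" using dihedral_hexdir[OF A(1), of k] by blast
    then have "s = \<phi> ` {r, r + hexdir i, r + hexdir (Suc i)}"
      using t(1) zk A(2) r(2) by (elim disjE) (simp_all add: insert_commute)
    moreover have "{r, r + hexdir i, r + hexdir (Suc i)} \<in> set ` set (hex_list r)" unfolding hex by blast
    then obtain h where h1: "h \<in> set (hex_list r)" and h2: "{r, r + hexdir i, r + hexdir (Suc i)} = set h" by (elim imageE)
    ultimately have h: "h \<in> set (hex_list r)" "s = set (map \<phi> h)" using h1 by (simp_all only: h2 set_map)
    then obtain g where g: "g \<in> set fs" "same_face (map \<phi> h) g"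
      using m1 r(1) unfolding faces_match_def list_all_iff list_ex_iff \<phi>_def[symmetric] by fastforce
    have "set (map \<phi> h) = set g"
      using sf[OF g(2)] hl[OF r(1) h(1)] F3 g(1) by (simp add: list_all_iff)
    then show "s \<in> set ` set fs" using h(2) g(1) by blast
  next
    fix s assume "s \<in> set ` set fs"
    then obtain f where f: "f \<in> set fs" "s = set f" by blast
    then obtain r h where h: "r \<in> set rs" "h \<in> set (hex_list r)" "same_face f (map \<phi> h)"
      using m2 unfolding faces_match_def list_all_iff list_ex_iff \<phi>_def[symmetric] by fastforce
    have "s = \<phi> ` set h"
      using sf[OF h(3)] hl[OF h(1,2)] F3 f by (simp add: list_all_iff)
    moreover have "set h \<in> {{r, r + hexdir k, r + hexdir (Suc k)} | k. True}" using h(2) unfolding hex[symmetric] by blast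
    then obtain k where k: "set h = {r, r + hexdir k, r + hexdir (Suc k)}" by blast
    have "set h \<in> lattice_triangles" unfolding k by (rule triangle_in)
    ultimately show "s \<in> (`) \<phi> ` lattice_triangles" by blast
  qed
  then show ?thesis unfolding hex_cover_def \<phi>_def[symmetric] using inj N by simp
qed

definition box_list :: "int \<Rightarrow> int \<Rightarrow> lat list" where
  "box_list a c = concat (map (\<lambda>y. map (\<lambda>x. (x, y)) [0..a - 1]) [0..c - 1])"

lemma set_box_list: "set (box_list a c) = {0..<a} \<times> {0..<c}"
  by (auto simp: box_list_def)

lemma lattice_rel_tred:
  assumes "0 < c" shows "lattice_rel (tred a b c)"
  unfolding lattice_rel_def
proof (intro allI impI)
  fix z w assume "tred a b c z = tred a b c w"
  then show "\<exists>A\<in>dihedral. \<forall>u. tred a b c (z + u) = tred a b c (w + A u)"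
    by (intro bexI[of _ id] id_dihedral) (simp add: tred_eq_iff[OF assms])
qed

text \<open>The two positions of the axis of glide reflections: \<open>s\<close> says that the axis is
  parallel to edges, and \<open>frame s\<close> passes to the coordinates in which the
  reflection is \<open>kflip\<close>.\<close>
definition frame :: "bool \<Rightarrow> lat \<Rightarrow> lat" where "frame s = (if s then shear else id)"
definition unframe :: "bool \<Rightarrow> lat \<Rightarrow> lat" where "unframe s z = (if s then (fst z, snd z - fst z) else z)"

lemma frame_unframe [simp]: "frame s (unframe s z) = z" "unframe s (frame s z) = z"
  by (simp_all add: frame_def unframe_def shear_def)
lemma frame_add: "frame s (z + w) = frame s z + frame s w"
  by (simp add: frame_def shear_def prod_eq_iff)

definition axis_reflection :: "bool \<Rightarrow> lat \<Rightarrow> lat" where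
  "axis_reflection s z = (if s then (snd z, fst z) else (snd z - fst z, snd z))"

lemma axis_reflection_dihedral: "axis_reflection s \<in> dihedral"
proof -
  have "axis_reflection s = rot6 ^^ (if s then 2 else 3) \<circ> mir"
    by (rule ext) (simp add: axis_reflection_def mir_def rot6_def numeral_2_eq_2 numeral_3_eq_3)
  then show ?thesis by (simp only: dihedral_intros)
qed

lemma frame_axis_reflection: "frame s (axis_reflection s z) = kflip (frame s z)"
  by (simp add: frame_def axis_reflection_def shear_def kflip_def)

lemma lattice_rel_kred:
  assumes "0 < m" shows "lattice_rel (\<lambda>z. kred a m (frame s z))"
  unfolding lattice_rel_def
proof (intro allI impI)
  fix z w assume "kred a m (frame s z) = kred a m (frame s w)"
  then obtain i j where "frame s w = frame s z + (j * m + i * a, 2 * j * m) \<or> frame s w = kflip (frame s z) + (j * m + i * a, m + 2 * j * m)"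
    unfolding kred_eq_iff[OF assms] krel_def by blast
  then show "\<exists>A\<in>dihedral. \<forall>u. kred a m (frame s (z + u)) = kred a m (frame s (w + A u))"
  proof
    assume "frame s w = frame s z + (j * m + i * a, 2 * j * m)"
    then have "krel a m (frame s (z + u)) (frame s (w + id u))" for u
      unfolding krel_def frame_add id_apply by (intro exI[of _ i] exI[of _ j] disjI1) (simp add: add_ac)
    then show ?thesis unfolding kred_eq_iff[OF assms] using id_dihedral by blast
  next
    assume "frame s w = kflip (frame s z) + (j * m + i * a, m + 2 * j * m)"
    then have "krel a m (frame s (z + u)) (frame s (w + axis_reflection s u))" for u
      unfolding krel_def frame_add frame_axis_reflection kflip_add by (intro exI[of _ i] exI[of _ j] disjI2) (simp add: add_ac)
    then show ?thesis unfolding kred_eq_iff[OF assms] using axis_reflection_dihedral by blast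
  qed
qed

text \<open>The complex is the quotient of the lattice by the group described by the parameters.\<close>
definition torus_model :: "'v set set \<Rightarrow> int \<Rightarrow> int \<Rightarrow> int \<Rightarrow> bool" where
  "torus_model X a b c \<longleftrightarrow> 0 < a \<and> 0 < c \<and>
     (\<exists>\<phi>. hex_cover \<phi> X \<and> (\<forall>z w. \<phi> z = \<phi> w \<longleftrightarrow> tred a b c z = tred a b c w))"

definition klein_model :: "'v set set \<Rightarrow> bool \<Rightarrow> int \<Rightarrow> int \<Rightarrow> bool" where
  "klein_model X s a m \<longleftrightarrow> 0 < a \<and> 0 < m \<and>
     (\<exists>\<phi>. hex_cover \<phi> X \<and> (\<forall>z w. \<phi> z = \<phi> w \<longleftrightarrow> kred a m (frame s z) = kred a m (frame s w)))"

text \<open>The finite conditions of \<open>tabulated_cover\<close>, collected into one executable test.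
  The faces are compared as lists of vertices up to order.\<close>
definition table_check :: "int \<Rightarrow> int \<Rightarrow> (lat \<Rightarrow> lat) \<Rightarrow> lat list \<Rightarrow> 'v list \<Rightarrow> 'v list list \<Rightarrow> bool" where
  "table_check a c \<rho> rs tab fs \<longleftrightarrow> 0 < a \<and> 0 < c \<and> distinct tab \<and> length tab = nat (a * c) \<and>
     list_all (\<lambda>r. distinct (map (tab_map a \<rho> tab) (star_list r))) rs \<and>
     list_all (\<lambda>f. length f = 3 \<and> distinct f) fs \<and>
     (let gs = concat (map (\<lambda>r. map (map (tab_map a \<rho> tab)) (hex_list r)) rs) in faces_match gs fs \<and> faces_match fs gs)"

lemma torus_modelI:
  assumes "table_check a c (tred a b c) (box_list a c) tab fs" "X = generated_complex (set ` set fs)"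
  shows "torus_model X a b c"
proof -
  have ac: "0 < a" "0 < c" using assms(1) by (simp_all add: table_check_def)
  have dl: "distinct tab" "length tab = nat (a * c)" using assms(1) by (simp_all add: table_check_def)
  have "\<exists>r\<in>set (box_list a c). tred a b c z = tred a b c r" for z
    using tred_box[OF ac] tred_id[of "tred a b c z" a c b] unfolding set_box_list by metis
  then have "hex_cover (tab_map a (tred a b c) tab) X" unfolding assms(2)
    by (intro tabulated_cover[where rs = "box_list a c" and c = c] tred_box ac lattice_rel_tred)
       (use assms(1) in \<open>simp_all add: table_check_def Let_def\<close>)
  moreover have "\<forall>z w. tab_map a (tred a b c) tab z = tab_map a (tred a b c) tab w \<longleftrightarrow> tred a b c z = tred a b c w"
    using tab_map_eq_iff[of "tred a b c", OF tred_box[OF ac] dl] by blast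
  ultimately show ?thesis using ac unfolding torus_model_def by blast
qed

lemma klein_modelI:
  assumes "table_check a m (\<lambda>z. kred a m (frame s z)) (map (unframe s) (box_list a m)) tab fs"
    "X = generated_complex (set ` set fs)"
  shows "klein_model X s a m"
proof -
  have ac: "0 < a" "0 < m" using assms(1) by (simp_all add: table_check_def)
  have dl: "distinct tab" "length tab = nat (a * m)" using assms(1) by (simp_all add: table_check_def)
  have "\<exists>r\<in>set (map (unframe s) (box_list a m)). kred a m (frame s z) = kred a m (frame s r)" for z
  proof
    show "unframe s (kred a m (frame s z)) \<in> set (map (unframe s) (box_list a m))"
      using kred_box[OF ac] by (simp add: set_box_list)
    show "kred a m (frame s z) = kred a m (frame s (unframe s (kred a m (frame s z))))"
      using kred_id[OF kred_box[OF ac]] by simp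
  qed
  then have "hex_cover (tab_map a (\<lambda>z. kred a m (frame s z)) tab) X" unfolding assms(2)
    by (intro tabulated_cover[where rs = "map (unframe s) (box_list a m)" and c = m] kred_box ac lattice_rel_kred)
       (use assms(1) in \<open>simp_all add: table_check_def Let_def\<close>)
  moreover have "\<forall>z w. tab_map a (\<lambda>z. kred a m (frame s z)) tab z = tab_map a (\<lambda>z. kred a m (frame s z)) tab w \<longleftrightarrow> kred a m (frame s z) = kred a m (frame s w)"
    using tab_map_eq_iff[of "\<lambda>z. kred a m (frame s z)", OF kred_box[OF ac] dl] by blast
  ultimately show ?thesis using ac unfolding klein_model_def by blast
qed


section \<open>The seventeen complexes as quotients of the lattice\<close>

lemma faces_UN: "set ` set (concat (map g xs)) = (\<Union>i\<in>set xs. set ` set (g i))"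
  by auto

text \<open>Executable lists of the faces of the complexes, to be matched with the sets in their
  definitions.\<close>
definition T1_faces :: "int \<Rightarrow> int \<Rightarrow> vertex list list" where
  "T1_faces n k = (let w = (\<lambda>i. Vtx (cyc n i)) in
     concat (map (\<lambda>i. [[w i, w (i + k), w (i + k + 1)], [w i, w (i + 1), w (i + k + 1)]]) [1..n]))"

definition T2_faces :: "int \<Rightarrow> int \<Rightarrow> vertex list list" where
  "T2_faces n k = (let u = (\<lambda>i. Vtx_u (cyc n i)); v = (\<lambda>i. Vtx_v (cyc n i)) in
     concat (map (\<lambda>i. [[u i, u (i + 1), v (i + 1)], [u i, v i, v (i + 1)],
       [u (i + k), u (i + k + 1), v i], [u (i + k + 1), v i, v (i + 1)]]) [1..n]))"

definition B_faces :: "int \<Rightarrow> int \<Rightarrow> vertex list list" where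
  "B_faces m n = (let v = (\<lambda>i j. Vtx_vv (cyc n i) j) in
     concat (map (\<lambda>i. concat (map (\<lambda>j.
         [[v i j, v (i + 1) j, v (i + 1) (j + 1)], [v i j, v i (j + 1), v (i + 1) (j + 1)]]) [1..m - 1])) [1..n]) @
     concat (map (\<lambda>i.
         [[v i m, v (n + 2 - i) 1, v (n + 1 - i) 1], [v i m, v (i + 1) m, v (n + 1 - i) 1]]) [1..n]))"

definition K_faces :: "int \<Rightarrow> int \<Rightarrow> vertex list list" where
  "K_faces m n = (let v = (\<lambda>i j. Vtx_vv (cyc (2 * n) i) j) in
     ((concat (map (\<lambda>i. concat (map (\<lambda>j.
         [[v i j, v i (j + 1), v (i + 1) j], [v i (j + 1), v (i + 1) j, v (i + 1) (j + 1)]]) [1..m - 1])) [1..n]) @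
     concat (map (\<lambda>i.
         [[v i m, v (i + 1) m, v (2 * n + 2 - i) 1],
          [v (i + 1) m, v (2 * n + 2 - i) 1, v (2 * n + 1 - i) 1]]) [1..n])) @
     concat (map (\<lambda>i. concat (map (\<lambda>j.
         [[v i j, v (i + 1) j, v (i + 1) (j + 1)], [v i j, v i (j + 1), v (i + 1) (j + 1)]]) [1..m - 1])) [n + 1..2 * n])) @
     concat (map (\<lambda>i.
         [[v i m, v (i + 1) m, v (2 * n + 1 - i) 1],
          [v i m, v (2 * n + 2 - i) 1, v (2 * n + 1 - i) 1]]) [n + 1..2 * n]))"

definition Q2_faces :: "int \<Rightarrow> vertex list list" where
  "Q2_faces m = (let w = (\<lambda>i. Vtx (cyc (4 * m + 2) i)) in
     concat (map (\<lambda>i. [[w i, w (i + 1), w (i + 2)], [w i, w (i + 2), w (i + 2 * m + 2)]]) [1..4 * m + 2]))"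

definition Q_faces :: "int \<Rightarrow> int \<Rightarrow> vertex list list" where
  "Q_faces m n = (let u = (\<lambda>i j. Vtx_uu i (cyc n j)); v = (\<lambda>i j. Vtx_vv i (cyc n j)) in
     (concat (map (\<lambda>i. concat (map (\<lambda>j.
         [[u i j, u (i + 1) j, v i j], [u i (j + 1), u (i + 1) (j + 1), v i j]]) [1..n])) [1..m]) @
      concat (map (\<lambda>i. concat (map (\<lambda>j.
         [[v i j, v (i + 1) j, u (i + 1) j], [v i j, v (i + 1) j, u (i + 1) (j + 1)]]) [1..n])) [1..m - 1])) @
      concat (map (\<lambda>j.
         [[u (m + 1) j, u 1 (n + 2 - j), v 1 (n + 2 - j)],
          [u (m + 1) (j + 1), u 1 (n + 2 - j), v 1 (n + 1 - j)],
          [u (m + 1) j, u 1 (n + 2 - j), v m j],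
          [u (m + 1) (j + 1), u 1 (n + 2 - j), v m j]]) [1..n]))"

lemmas faces_list_simps = Let_def set_append image_Un faces_UN set_upto list.set image_insert image_empty

lemma T1_complex_faces: "T1_complex n k = generated_complex (set ` set (T1_faces n k))"
  by (simp only: T1_complex_def T1_faces_def faces_list_simps)
lemma T2_complex_faces: "T2_complex n k = generated_complex (set ` set (T2_faces n k))"
  by (simp only: T2_complex_def T2_faces_def faces_list_simps)
lemma B_complex_faces: "B_complex m n = generated_complex (set ` set (B_faces m n))"
  by (simp only: B_complex_def B_faces_def faces_list_simps)
lemma K_complex_faces: "K_complex m n = generated_complex (set ` set (K_faces m n))"
  by (simp only: K_complex_def K_faces_def faces_list_simps)
lemma Q2_complex_faces: "Q2_complex m = generated_complex (set ` set (Q2_faces m))"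
  by (simp only: Q2_complex_def Q2_faces_def faces_list_simps)
lemma Q_complex_faces: "Q_complex m n = generated_complex (set ` set (Q_faces m n))"
  by (simp only: Q_complex_def Q_faces_def faces_list_simps)

text \<open>The tables list the vertices in the box row by row. For \<open>T\<^bsub>n,1,k\<^esub>\<close>
  the point \<open>(x,y)\<close> goes to the vertex \<open>1 + x + k y\<close> modulo
  \<open>n\<close>, so \<open>(-k,1)\<close> is a period.\<close>
lemma torus_models:
  "torus_model (T1_complex 12 2) 12 (-2) 1"
  "torus_model (T1_complex 12 3) 12 (-3) 1"
  "torus_model (T1_complex 12 4) 12 (-4) 1"
  "torus_model (T2_complex 6 2) 6 (-2) 2"
  "torus_model (T1_complex 14 2) 14 (-2) 1"
  "torus_model (T1_complex 14 3) 14 (-3) 1"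
  "torus_model (T1_complex 15 2) 15 (-2) 1"
  "torus_model (T1_complex 15 3) 15 (-3) 1"
  "torus_model (T1_complex 15 4) 15 (-4) 1"
  "torus_model (T1_complex 15 5) 15 (-5) 1"
  subgoal by (rule torus_modelI[where tab = "map Vtx [1..12]", OF _ T1_complex_faces]) code_simp
  subgoal by (rule torus_modelI[where tab = "map Vtx [1..12]", OF _ T1_complex_faces]) code_simp
  subgoal by (rule torus_modelI[where tab = "map Vtx [1..12]", OF _ T1_complex_faces]) code_simp
  subgoal by (rule torus_modelI[where tab = "map Vtx_u [1..6] @ map Vtx_v [1..6]", OF _ T2_complex_faces]) code_simp
  subgoal by (rule torus_modelI[where tab = "map Vtx [1..14]", OF _ T1_complex_faces]) code_simp
  subgoal by (rule torus_modelI[where tab = "map Vtx [1..14]", OF _ T1_complex_faces]) code_simp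
  subgoal by (rule torus_modelI[where tab = "map Vtx [1..15]", OF _ T1_complex_faces]) code_simp
  subgoal by (rule torus_modelI[where tab = "map Vtx [1..15]", OF _ T1_complex_faces]) code_simp
  subgoal by (rule torus_modelI[where tab = "map Vtx [1..15]", OF _ T1_complex_faces]) code_simp
  subgoal by (rule torus_modelI[where tab = "map Vtx [1..15]", OF _ T1_complex_faces]) code_simp
  done

text \<open>The complexes \<open>B\<^bsub>m,n\<^esub>\<close> are already strips of \<open>m\<close> rows
  of length \<open>n\<close> glued with a reflection, so \<open>v\<^bsub>i,j\<^esub>\<close>
  sits in row \<open>j\<close>. For the other complexes the lists arise by walking through the
  faces in straight lines.\<close>
lemma klein_models:
  "klein_model (Q2_complex 3) True 2 7"
  "klein_model (Q_complex 2 3) True 3 5"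
  "klein_model (B_complex 3 4) False 4 3"
  "klein_model (B_complex 4 3) False 3 4"
  "klein_model (B_complex 3 5) False 5 3"
  "klein_model (B_complex 5 3) False 3 5"
  "klein_model (K_complex 3 2) True 2 6"
  subgoal by (rule klein_modelI[where tab = "[Vtx 1, Vtx 8, Vtx 2, Vtx 9, Vtx 10, Vtx 3, Vtx 11, Vtx 4, Vtx 5, Vtx 12, Vtx 6, Vtx 13, Vtx 14, Vtx 7]", OF _ Q2_complex_faces]) code_simp
  subgoal by (rule klein_modelI[where tab = "[Vtx_uu 1 1, Vtx_uu 1 2, Vtx_uu 1 3, Vtx_uu 3 2, Vtx_uu 3 1, Vtx_uu 3 3, Vtx_vv 2 2, Vtx_vv 2 1, Vtx_vv 2 3, Vtx_uu 2 3, Vtx_uu 2 2, Vtx_uu 2 1, Vtx_vv 1 3, Vtx_vv 1 2, Vtx_vv 1 1]", OF _ Q_complex_faces]) code_simp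
  subgoal by (rule klein_modelI[where tab = "concat (map (\<lambda>j. map (\<lambda>i. Vtx_vv i j) [1..4]) [1..3])", OF _ B_complex_faces]) code_simp
  subgoal by (rule klein_modelI[where tab = "concat (map (\<lambda>j. map (\<lambda>i. Vtx_vv i j) [1..3]) [1..4])", OF _ B_complex_faces]) code_simp
  subgoal by (rule klein_modelI[where tab = "concat (map (\<lambda>j. map (\<lambda>i. Vtx_vv i j) [1..5]) [1..3])", OF _ B_complex_faces]) code_simp
  subgoal by (rule klein_modelI[where tab = "concat (map (\<lambda>j. map (\<lambda>i. Vtx_vv i j) [1..3]) [1..5])", OF _ B_complex_faces]) code_simp
  subgoal by (rule klein_modelI[where tab = "[Vtx_vv 2 1, Vtx_vv 4 1, Vtx_vv 1 1, Vtx_vv 3 3, Vtx_vv 2 3, Vtx_vv 4 3, Vtx_vv 3 2, Vtx_vv 1 3, Vtx_vv 4 2, Vtx_vv 2 2, Vtx_vv 1 2, Vtx_vv 3 1]", OF _ K_complex_faces]) code_simp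
  done


section \<open>Comparing the models\<close>

lemma mat_app_dihedral: "M \<in> set dihedral_matrices \<Longrightarrow> mat_app M \<in> dihedral"
proof -
  have p: "rot6 ^^ 2 = rot6 \<circ> rot6" "rot6 ^^ 3 = rot6 \<circ> (rot6 \<circ> rot6)" "rot6 ^^ 4 = rot6 \<circ> (rot6 \<circ> (rot6 \<circ> rot6))"
    "rot6 ^^ 5 = rot6 \<circ> (rot6 \<circ> (rot6 \<circ> (rot6 \<circ> rot6)))"
    by (rule ext, simp add: eval_nat_numeral)+
  have eqs: "mat_app (1,0,0,1) = rot6 ^^ 0" "mat_app (1,-1,1,0) = rot6 ^^ 1" "mat_app (0,-1,1,-1) = rot6 ^^ 2"
    "mat_app (-1,0,0,-1) = rot6 ^^ 3" "mat_app (-1,1,-1,0) = rot6 ^^ 4" "mat_app (0,1,-1,1) = rot6 ^^ 5"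
    "mat_app (1,-1,0,-1) = rot6 ^^ 0 \<circ> mir" "mat_app (1,0,1,-1) = rot6 ^^ 1 \<circ> mir" "mat_app (0,1,1,0) = rot6 ^^ 2 \<circ> mir"
    "mat_app (-1,1,0,1) = rot6 ^^ 3 \<circ> mir" "mat_app (-1,0,-1,1) = rot6 ^^ 4 \<circ> mir" "mat_app (0,-1,-1,0) = rot6 ^^ 5 \<circ> mir"
    by (simp_all add: p fun_eq_iff mat_app_def rot6_def mir_def prod_eq_iff)
  have "\<forall>M\<in>set dihedral_matrices. mat_app M \<in> dihedral"
    by (simp only: dihedral_matrices_def list.set ball_simps eqs dihedral_intros simp_thms)
  then show "M \<in> set dihedral_matrices \<Longrightarrow> ?thesis" by blast
qed

text \<open>Names for the groups: lattices by their Hermite normal form, glide groups by the position of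
  the axis and the the parameters of \<open>kred\<close>.\<close>
datatype shape = Torus int int int | Klein bool int int

fun shape_red :: "shape \<Rightarrow> lat \<Rightarrow> lat" where
  "shape_red (Torus a b c) z = tred a b c z"
| "shape_red (Klein s a m) z = kred a m (frame s z)"

fun shape_size :: "shape \<Rightarrow> int" where
  "shape_size (Torus a b c) = a * c"
| "shape_size (Klein s a m) = a * m"

fun shape_reps :: "shape \<Rightarrow> lat list" where
  "shape_reps (Torus a b c) = box_list a c"
| "shape_reps (Klein s a m) = map (unframe s) (box_list a m)"

fun has_shape :: "'v set set \<Rightarrow> shape \<Rightarrow> bool" where
  "has_shape X (Torus a b c) = torus_model X a b c"
| "has_shape X (Klein s a m) = klein_model X s a m"

lemma has_shape_cover:
  assumes "has_shape X k"
  obtains \<phi> where "hex_cover \<phi> X" "\<And>z w. \<phi> z = \<phi> w \<longleftrightarrow> shape_red k z = shape_red k w"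
  using assms by (cases k) (auto simp: torus_model_def klein_model_def)

lemma has_shape_card:
  assumes "has_shape X k"
  shows "card (vertices X) = nat (shape_size k)" "0 < shape_size k"
proof -
  have "card (vertices X) = nat (shape_size k) \<and> 0 < shape_size k"
  proof (cases k)
    case (Torus a b c)
    then obtain \<phi> where p: "0 < a" "0 < c" "hex_cover \<phi> X" "\<And>z w. \<phi> z = \<phi> w \<longleftrightarrow> tred a b c z = tred a b c w"
      using assms by (auto simp: torus_model_def)
    have "card (range \<phi>) = nat (a * c)" by (rule card_range_box[OF p(4) tred_box[OF p(1,2)] tred_id])
    then show ?thesis using p hex_cover_vertices[OF p(3)] Torus by simp
  next
    case (Klein s a m)
    then obtain \<phi> where p: "0 < a" "0 < m" "hex_cover \<phi> X" "\<And>z w. \<phi> z = \<phi> w \<longleftrightarrow> kred a m (frame s z) = kred a m (frame s w)"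
      using assms by (auto simp: klein_model_def)
    define \<psi> where "\<psi> z = \<phi> (unframe s z)" for z
    have "card (range \<psi>) = nat (a * m)"
      by (rule card_range_box[OF _ kred_box[OF p(1,2)] kred_id]) (simp add: \<psi>_def p(4))
    moreover have "range \<psi> = range \<phi>"
    proof (intro subset_antisym image_subsetI)
      show "\<phi> z \<in> range \<psi>" for z by (rule range_eqI[of _ _ "frame s z"]) (simp add: \<psi>_def)
    qed (simp add: \<psi>_def)
    ultimately show ?thesis using p hex_cover_vertices[OF p(3)] Klein by simp
  qed
  then show "card (vertices X) = nat (shape_size k)" "0 < shape_size k" by blast+
qed

lemma has_shape_reps:
  assumes "has_shape X k"
  shows "\<exists>r\<in>set (shape_reps k). shape_red k z = shape_red k r"
proof (cases k)
  case (Torus a b c)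
  then have "0 < a" "0 < c" using assms by (auto simp: torus_model_def)
  then show ?thesis using Torus tred_box[of a c b z] tred_id[of "tred a b c z" a c b]
    by (intro bexI[of _ "tred a b c z"]) (simp_all add: set_box_list)
next
  case (Klein s a m)
  then have "0 < a" "0 < m" using assms by (auto simp: klein_model_def)
  then show ?thesis using Klein kred_box[of a m "frame s z"] kred_id[of "kred a m (frame s z)" a m]
    by (intro bexI[of _ "unframe s (kred a m (frame s z))"]) (simp_all add: set_box_list)
qed

lemma has_shape_isomorphic:
  assumes "hex_cover \<phi> M" "\<And>z w. \<phi> z = \<phi> w \<longleftrightarrow> shape_red k z = shape_red k w" "has_shape X k"
  shows "isomorphic_complexes M X"
proof -
  obtain \<psi> where "hex_cover \<psi> X" "\<And>z w. \<psi> z = \<psi> w \<longleftrightarrow> shape_red k z = shape_red k w"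
    using has_shape_cover[OF assms(3)] by blast
  then show ?thesis using hex_cover_isomorphic[OF assms(1)] assms(2) by blast
qed

subsection \<open>Equivalent lattices\<close>

lemma tlat_comb:
  assumes "0 < c" "tlat a b c u" "tlat a b c v"
  shows "tlat a b c (i * fst u + j * fst v, i * snd u + j * snd v)"
proof -
  obtain p q p' q' where "u = (p * a + q * b, q * c)" "v = (p' * a + q' * b, q' * c)"
    using assms tlat_iff[OF assms(1)] by metis
  then have "(i * fst u + j * fst v, i * snd u + j * snd v) = ((i * p + j * p') * a + (i * q + j * q') * b, (i * q + j * q') * c)"
    by (simp add: algebra_simps)
  then show ?thesis using tlat_iff[OF assms(1)] by blast
qed

text \<open>It suffices to map the two basis vectors into the target lattice.\<close>
definition maps_lattice :: "int \<times> int \<times> int \<times> int \<Rightarrow> int \<times> int \<times> int \<Rightarrow> int \<times> int \<times> int \<Rightarrow> bool" where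
  "maps_lattice M k l = (case (k, l) of ((a, b, c), (a', b', c')) \<Rightarrow>
      tlat a' b' c' (mat_app M (a, 0)) \<and> tlat a' b' c' (mat_app M (b, c)))"

lemma maps_latticeD:
  assumes "maps_lattice M (a, b, c) (a', b', c')" "0 < c" "0 < c'" "tlat a b c z"
  shows "tlat a' b' c' (mat_app M z)"
proof -
  obtain i j where z: "z = (i * a + j * b, j * c)" using assms tlat_iff by blast
  have "mat_app M z = (i * fst (mat_app M (a, 0)) + j * fst (mat_app M (b, c)), i * snd (mat_app M (a, 0)) + j * snd (mat_app M (b, c)))"
    by (cases M) (simp add: z mat_app_def algebra_simps)
  moreover have "tlat a' b' c' (mat_app M (a, 0))" "tlat a' b' c' (mat_app M (b, c))"
    using assms(1) by (simp_all add: maps_lattice_def)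
  ultimately show ?thesis using tlat_comb[OF assms(3)] by metis
qed

definition inverse_pairs :: "((int \<times> int \<times> int \<times> int) \<times> (int \<times> int \<times> int \<times> int)) list" where
  "inverse_pairs = [(M, N). M \<leftarrow> dihedral_matrices, N \<leftarrow> dihedral_matrices,
      mat_app M (mat_app N (1, 0)) = (1, 0), mat_app M (mat_app N (0, 1)) = (0, 1)]"

text \<open>A mutually inverse pair of symmetries exchanging the two lattices. Inclusion in both
  directions is tested instead of comparing determinants.\<close>
definition equivalent_lattices :: "int \<times> int \<times> int \<Rightarrow> int \<times> int \<times> int \<Rightarrow> bool" where
  "equivalent_lattices k l \<longleftrightarrow> list_ex (\<lambda>(M, N). maps_lattice M l k \<and> maps_lattice N k l) inverse_pairs"

lemma mat_app_inverse:
  assumes "mat_app M (mat_app N (1, 0)) = (1, 0)" "mat_app M (mat_app N (0, 1)) = (0, 1)"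
  shows "mat_app M (mat_app N z) = z"
proof -
  obtain p q r s p' q' r' s' where MN: "M = (p, q, r, s)" "N = (p', q', r', s')" by (cases M; cases N) auto
  obtain x y where z: "z = (x, y)" by force
  have e: "p * p' + q * r' = 1" "r * p' + s * r' = 0" "p * q' + q * s' = 0" "r * q' + s * s' = 1"
    using assms by (simp_all add: MN mat_app_def)
  have "mat_app M (mat_app N z) = ((p * p' + q * r') * x + (p * q' + q * s') * y, (r * p' + s * r') * x + (r * q' + s * s') * y)"
    by (simp add: MN z mat_app_def algebra_simps)
  then show ?thesis unfolding e z by simp
qed

text \<open>Composing the covering with the symmetry changes its deck group to the equivalent one.\<close>
lemma equivalent_lattices_cover:
  assumes K: "hex_cover \<phi> K" and ker: "\<And>z w. \<phi> z = \<phi> w \<longleftrightarrow> tred a b c z = tred a b c w"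
    and c: "0 < c" "0 < c'" and e: "equivalent_lattices (a, b, c) (a', b', c')"
  obtains \<psi> where "hex_cover \<psi> K" "\<And>z w. \<psi> z = \<psi> w \<longleftrightarrow> tred a' b' c' z = tred a' b' c' w"
proof -
  obtain M N where MN: "(M, N) \<in> set inverse_pairs" "maps_lattice M (a', b', c') (a, b, c)" "maps_lattice N (a, b, c) (a', b', c')"
    using e unfolding equivalent_lattices_def list_ex_iff by auto
  have M: "M \<in> set dihedral_matrices" and N: "N \<in> set dihedral_matrices" and inv: "mat_app M (mat_app N z) = z" for z
    using MN(1) mat_app_inverse[of M N] by (auto simp: inverse_pairs_def)
  have Md: "mat_app M \<in> dihedral" by (rule mat_app_dihedral[OF M])
  have inv': "mat_app N (mat_app M z) = z" for z
    using inv[of "mat_app M z"] dihedral_inj[OF Md] by (simp add: inj_eq)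
  define \<psi> where "\<psi> z = \<phi> (mat_app M z + 0)" for z
  have "hex_cover \<psi> K" unfolding \<psi>_def by (rule hex_cover_reparam[OF K Md])
  moreover have "\<psi> z = \<psi> w \<longleftrightarrow> tred a' b' c' z = tred a' b' c' w" for z w
  proof -
    have "\<psi> z = \<psi> w \<longleftrightarrow> tlat a b c (mat_app M (z - w))"
      unfolding \<psi>_def by (simp add: ker tred_eq_iff[OF c(1)] dihedral_diff[OF Md])
    also have "\<dots> \<longleftrightarrow> tlat a' b' c' (z - w)"
      using maps_latticeD[OF MN(2) c(2,1)] maps_latticeD[OF MN(3) c] inv' by metis
    finally show ?thesis by (simp add: tred_eq_iff[OF c(2)])
  qed
  ultimately show thesis by (rule that)
qed

subsection \<open>The kernels with few vertices\<close>

text \<open>Four points suffice below, both to find a vertex star that is not embedded and to separate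
  groups.\<close>
definition test_points :: "lat list" where "test_points = [(0, 0), (1, 0), (0, 1), (1, 1)]"

text \<open>A necessary condition for being the group of a covering fails: stars must embed.\<close>
definition singular :: "shape \<Rightarrow> bool" where
  "singular k \<longleftrightarrow> list_ex (\<lambda>p. \<not> distinct (map (shape_red k) (star_list p))) test_points"

lemma cover_not_singular:
  assumes K: "hex_cover \<phi> K" and ker: "\<And>z w. \<phi> z = \<phi> w \<longleftrightarrow> shape_red k z = shape_red k w"
  shows "\<not> singular k"
proof
  assume "singular k"
  then obtain p where p: "\<not> distinct (map (shape_red k) (star_list p))" unfolding singular_def list_ex_iff by blast
  have "distinct (star_list p)" by (cases p) (simp add: star_list_def)
  moreover have st: "set (star_list p) = star p" by (auto simp: star_list_def star_def)
  ultimately have "\<not> inj_on (shape_red k) (star p)" using p by (simp add: distinct_map)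
  moreover have "inj_on \<phi> (star p)" using K by (simp add: hex_cover_def)
  ultimately show False using ker by (auto simp: inj_on_def)
qed

text \<open>Representatives, in the order in which the theorem lists the complexes.\<close>
definition torus_parameters :: "int \<Rightarrow> (int \<times> int \<times> int) list" where
  "torus_parameters n = (if n = 12 then [(12, -2, 1), (12, -3, 1), (12, -4, 1), (6, -2, 2)]
     else if n = 14 then [(14, -2, 1), (14, -3, 1)]
     else if n = 15 then [(15, -2, 1), (15, -3, 1), (15, -4, 1), (15, -5, 1)] else [])"

definition klein_parameters :: "(bool \<times> int \<times> int) list" where
  "klein_parameters = [(True, 2, 7), (True, 3, 5), (False, 4, 3), (False, 3, 4), (False, 5, 3), (False, 3, 5), (True, 2, 6)]"

definition small_torus_check :: "int \<Rightarrow> bool" where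
  "small_torus_check n \<longleftrightarrow> list_all (\<lambda>a. list_all (\<lambda>c. a * c \<noteq> n \<or> list_all (\<lambda>b. singular (Torus a b c) \<or>
      list_ex (equivalent_lattices (a, b, c)) (torus_parameters n)) [0..a - 1]) [1..n]) [1..n]"

definition small_klein_check :: "int \<Rightarrow> bool" where
  "small_klein_check n \<longleftrightarrow> list_all (\<lambda>a. list_all (\<lambda>m. a * m \<noteq> n \<or> list_all (\<lambda>s. singular (Klein s a m) \<or>
      (s, a, m) \<in> set klein_parameters) [False, True]) [1..n]) [1..n]"

lemma small_checks: "list_all small_torus_check [12, 14, 15]" "list_all small_klein_check [12, 14, 15]"
  by code_simp+

lemma factor_range: "0 < (a::int) \<Longrightarrow> 0 < c \<Longrightarrow> a * c = n \<Longrightarrow> a \<in> {1..n} \<and> c \<in> {1..n}"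
  by (auto simp: mult_le_cancel_left1 mult_le_cancel_right1)

text \<open>By \<open>hex_cover_kernel\<close> the product of two parameters is the number of vertices, so
  finitely many groups are to be inspected; \<open>small_checks\<close> does this.\<close>
theorem small_covers:
  assumes K: "hex_cover \<phi> K" and n: "card (vertices K) \<in> {12, 14, 15}"
  obtains (torus) \<psi> a b c where "hex_cover \<psi> K" "(a, b, c) \<in> set (torus_parameters (int (card (vertices K))))"
      "\<And>z w. \<psi> z = \<psi> w \<longleftrightarrow> shape_red (Torus a b c) z = shape_red (Torus a b c) w"
  | (klein) \<psi> s a m where "hex_cover \<psi> K" "(s, a, m) \<in> set klein_parameters"
      "\<And>z w. \<psi> z = \<psi> w \<longleftrightarrow> shape_red (Klein s a m) z = shape_red (Klein s a m) w"
proof -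
  define N where "N = int (card (vertices K))"
  have N: "N \<in> {12, 14, 15}" using n by (auto simp: N_def)
  have checks: "small_torus_check N" "small_klein_check N" using small_checks N by auto
  have "finite (vertices K)" using n card.infinite[of "vertices K"] by fastforce
  from hex_cover_kernel[OF K this] show thesis
  proof (elim disjE[of "Ex p" "Ex q" for p q] exE conjE)
    fix a b c assume abc: "0 < a" "0 < c" "0 \<le> b" "b < a" "nat (a * c) = card (vertices K)"
      "\<forall>z w. \<phi> z = \<phi> w \<longleftrightarrow> tred a b c z = tred a b c w"
    then have "0 \<le> a * c" by simp
    then have "a * c = N" unfolding N_def using abc(5) by linarith
    then have "a \<in> set [1..N]" "c \<in> set [1..N]" "b \<in> set [0..a - 1]" using factor_range abc by auto
    then have "singular (Torus a b c) \<or> list_ex (equivalent_lattices (a, b, c)) (torus_parameters N)"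
      using checks(1) \<open>a * c = N\<close> unfolding small_torus_check_def list_all_iff by blast
    moreover have "\<not> singular (Torus a b c)" using cover_not_singular[OF K, of "Torus a b c"] abc by simp
    ultimately obtain a' b' c' where k: "(a', b', c') \<in> set (torus_parameters N)" "equivalent_lattices (a, b, c) (a', b', c')"
      unfolding list_ex_iff by (metis prod_cases3)
    then have "0 < c'" by (auto simp: torus_parameters_def split: if_splits)
    then obtain \<psi> where "hex_cover \<psi> K" "\<And>z w. \<psi> z = \<psi> w \<longleftrightarrow> tred a' b' c' z = tred a' b' c' w"
      using equivalent_lattices_cover[OF K _ abc(2) _ k(2)] abc(6) by metis
    then show thesis using torus k(1) unfolding N_def by simp
  next
    fix B v P a m assume am: "B \<in> dihedral" "P = id \<or> P = shear" "0 < a" "0 < m" "nat (a * m) = card (vertices K)"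
      and ker: "\<forall>z w. \<phi> (B z + v) = \<phi> (B w + v) \<longleftrightarrow> kred a m (P z) = kred a m (P w)"
    define s where "s \<longleftrightarrow> P = shear"
    have P: "P = frame s" using am(2) by (auto simp: s_def frame_def)
    define \<psi> where "\<psi> z = \<phi> (B z + v)" for z
    have \<psi>: "hex_cover \<psi> K" unfolding \<psi>_def by (rule hex_cover_reparam[OF K am(1)])
    have ker': "\<psi> z = \<psi> w \<longleftrightarrow> shape_red (Klein s a m) z = shape_red (Klein s a m) w" for z w
      using ker by (simp add: \<psi>_def P)
    have "0 \<le> a * m" using am(3,4) by simp
    then have "a * m = N" unfolding N_def using am(5) by linarith
    then have "a \<in> set [1..N]" "m \<in> set [1..N]" "s \<in> set [False, True]" using factor_range am by auto
    then have "singular (Klein s a m) \<or> (s, a, m) \<in> set klein_parameters"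
      using checks(2) \<open>a * m = N\<close> unfolding small_klein_check_def list_all_iff by blast
    then have "(s, a, m) \<in> set klein_parameters" using cover_not_singular[OF \<psi> ker'] by blast
    then show thesis using klein \<psi> ker' by blast
  qed
qed

subsection \<open>Non-isomorphic shapes\<close>

lemma simplicial_iso_sym:
  assumes "simplicial_iso f K L" shows "simplicial_iso (inv_into (vertices K) f) L K"
proof -
  define g where "g = inv_into (vertices K) f"
  have b: "bij_betw f (vertices K) (vertices L)" using assms by (simp add: simplicial_iso_def)
  then have g: "bij_betw g (vertices L) (vertices K)" unfolding g_def by (rule bij_betw_inv_into)
  have fg: "f ` g ` s = s" if "s \<subseteq> vertices L" for s
    using that b unfolding g_def by (metis bij_betw_def image_inv_into_cancel)
  have "s \<in> L \<longleftrightarrow> g ` s \<in> K" if s: "s \<subseteq> vertices L" for s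
  proof -
    have "g ` s \<subseteq> vertices K" using s g unfolding bij_betw_def by blast
    then show ?thesis using assms fg[OF s] unfolding simplicial_iso_def by metis
  qed
  then show ?thesis using g unfolding simplicial_iso_def g_def by blast
qed

text \<open>Lift of an isomorphism, normalised so that the image of the origin is one of the finitely many
  representatives.\<close>
lemma has_shape_match:
  assumes X: "has_shape X k" and Y: "has_shape Y l" and f: "simplicial_iso f X Y"
  obtains M b where "M \<in> set dihedral_matrices" "b \<in> set (shape_reps l)"
    "\<And>u v. shape_red k u = shape_red k v \<longleftrightarrow> shape_red l (b + mat_app M u) = shape_red l (b + mat_app M v)"
proof -
  obtain \<phi> where \<phi>: "hex_cover \<phi> X" "\<And>z w. \<phi> z = \<phi> w \<longleftrightarrow> shape_red k z = shape_red k w"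
    using has_shape_cover[OF X] by blast
  obtain \<psi> where \<psi>: "hex_cover \<psi> Y" "\<And>z w. \<psi> z = \<psi> w \<longleftrightarrow> shape_red l z = shape_red l w"
    using has_shape_cover[OF Y] by blast
  have "f (\<phi> 0) \<in> range \<psi>"
    using f hex_cover_vertices[OF \<phi>(1)] hex_cover_vertices[OF \<psi>(1)] unfolding simplicial_iso_def bij_betw_def by blast
  then obtain b' where "f (\<phi> 0) = \<psi> b'" by blast
  moreover obtain b where b: "b \<in> set (shape_reps l)" "shape_red l b' = shape_red l b" using has_shape_reps[OF Y] by blast
  ultimately have "f (\<phi> 0) = \<psi> b" using \<psi>(2) by simp
  from simplicial_iso_match[OF \<phi>(1) \<psi>(1) f this] obtain A where
    A: "A \<in> dihedral" "\<And>u v. \<phi> (0 + u) = \<phi> (0 + v) \<longleftrightarrow> \<psi> (b + A u) = \<psi> (b + A v)" by blast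
  obtain M where M: "M \<in> set dihedral_matrices" "A = mat_app M" using dihedral_matrix[OF A(1)] .
  show thesis by (rule that[OF M(1) b(1)]) (use A(2) \<phi>(2) \<psi>(2) M(2) in simp)
qed

text \<open>Pairs of points that are related by the generators of the group. For a glide group several
  base points are used, because the displacement of a glide reflection varies with the point.\<close>
fun glide_pairs :: "shape \<Rightarrow> (lat \<times> lat) list" where
  "glide_pairs (Klein s a m) = concat (map (\<lambda>p. [(unframe s p, unframe s (p + (a, 0))), (unframe s p, unframe s (kflip p + (0, m)))]) test_points)"
| "glide_pairs (Torus a b c) = [((0, 0), (a, 0)), ((0, 0), (b, c))]"

text \<open>No lattice symmetry taking \<open>a\<close> to \<open>b\<close> carries the relation of
  \<open>k\<close> to that of \<open>l\<close>: for each linear part some pair of related points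
  is a witness.\<close>
definition separated :: "shape \<Rightarrow> shape \<Rightarrow> lat \<Rightarrow> lat \<Rightarrow> bool" where
  "separated k l a b \<longleftrightarrow> list_all (\<lambda>M. list_ex (\<lambda>(u, v).
     (shape_red k u = shape_red k v) \<noteq> (shape_red l (b + mat_app M (u - a)) = shape_red l (b + mat_app M (v - a)))) (glide_pairs k)) dihedral_matrices"

text \<open>Sufficient conditions for non-isomorphism: different numbers of vertices, or, for lattices and
  for glide groups among themselves, no symmetry carrying one to the other. A torus is told from
  a Klein bottle by the translation invariance of its relation, which glide reflections violate.
  In the lists to be compared the tori come first; hence \<open>False\<close> in the last case.\<close>
fun different :: "shape \<Rightarrow> shape \<Rightarrow> bool" where
  "different (Torus a b c) (Torus a' b' c') \<longleftrightarrow> a * c \<noteq> a' * c' \<or>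
      list_all (\<lambda>M. \<not> maps_lattice M (a, b, c) (a', b', c')) dihedral_matrices"
| "different (Torus a b c) (Klein s a' m) \<longleftrightarrow> a * c \<noteq> a' * m \<or>
      list_ex (\<lambda>p. list_ex (\<lambda>t. kred a' m (p + t) \<noteq> kred a' m (kflip p + (0, m) + t)) test_points) test_points"
| "different (Klein s a m) (Klein s' a' m') \<longleftrightarrow> a * m \<noteq> a' * m' \<or>
      list_all (separated (Klein s a m) (Klein s' a' m') 0) (shape_reps (Klein s' a' m'))"
| "different (Klein s a m) (Torus a' b' c') \<longleftrightarrow> False"

lemma isomorphic_card: "isomorphic_complexes X Y \<Longrightarrow> card (vertices X) = card (vertices Y)"
  unfolding isomorphic_complexes_def simplicial_iso_def using bij_betw_same_card by blast

lemma shape_size_iso: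
  assumes "has_shape X k" "has_shape Y l" "isomorphic_complexes X Y"
  shows "shape_size k = shape_size l"
  using isomorphic_card[OF assms(3)] has_shape_card[OF assms(1)] has_shape_card[OF assms(2)] by simp

lemma different_shapes:
  assumes X: "has_shape X k" and Y: "has_shape Y l" and d: "different k l"
  shows "\<not> isomorphic_complexes X Y"
proof
  assume iso: "isomorphic_complexes X Y"
  then obtain f where f: "simplicial_iso f X Y" unfolding isomorphic_complexes_def by blast
  obtain M b where M: "M \<in> set dihedral_matrices" "b \<in> set (shape_reps l)"
    and eq: "\<And>u v. shape_red k u = shape_red k v \<longleftrightarrow> shape_red l (b + mat_app M u) = shape_red l (b + mat_app M v)"
    using has_shape_match[OF X Y f] by metis
  have Md: "mat_app M \<in> dihedral" by (rule mat_app_dihedral[OF M(1)])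
  note size = shape_size_iso[OF X Y iso]
  show False
  proof (cases k)
    case k: (Torus a b0 c)
    then have c: "0 < c" using X by (simp add: torus_model_def)
    show False
    proof (cases l)
      case l: (Torus a' b' c')
      then have c': "0 < c'" using Y by (simp add: torus_model_def)
      have "tlat a' b' c' (mat_app M u)" if "tlat a b0 c u" for u
        using eq[of u 0] that k l by (simp add: tred_eq_iff[OF c] tred_eq_iff[OF c'] dihedral_zero[OF Md])
      moreover have "tlat a b0 c (a, 0)" "tlat a b0 c (b0, c)" using c by (simp_all add: tlat_def)
      ultimately have "maps_lattice M (a, b0, c) (a', b', c')" by (simp add: maps_lattice_def)
      then show False using d size k l M(1) by (auto simp: list_all_iff)
    next
      case l: (Klein s a' m)
      then have m: "0 < m" using Y by (simp add: klein_model_def)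
      obtain B where B: "B \<in> dihedral" "mat_app M \<circ> B = id" using dihedral_inverse[OF Md] by metis
      define h where "h z = B (unframe s z - b)" for z
      have h: "b + mat_app M (h z) = unframe s z" for z using B(2) by (simp add: h_def fun_eq_iff)
      have eq': "kred a' m z = kred a' m w \<longleftrightarrow> tlat a b0 c (h z - h w)" for z w
        using eq[of "h z" "h w"] k l by (simp add: h tred_eq_iff[OF c])
      have "h (z + t) - h (w + t) = h z - h w" for z w t
      proof -
        have e: "unframe s (z + t) - b - (unframe s (w + t) - b) = unframe s z - b - (unframe s w - b)"
          by (simp add: unframe_def prod_eq_iff)
        show ?thesis by (simp only: h_def dihedral_diff[OF B(1), symmetric] e)
      qed
      then have inv: "kred a' m (z + t) = kred a' m (w + t) \<longleftrightarrow> kred a' m z = kred a' m w" for z w t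
        unfolding eq' by simp
      have "kred a' m p = kred a' m (kflip p + (0, m))" for p
        unfolding kred_eq_iff[OF m] krel_def by (intro exI[of _ 0] disjI2) simp
      then have "kred a' m (p + t) = kred a' m (kflip p + (0, m) + t)" for p t using inv by simp
      then show False using d size k l by (auto simp: list_ex_iff)
    qed
  next
    case k: (Klein s a m)
    show False
    proof (cases l)
      case l: (Torus a' b' c')
      then show False using d k by simp
    next
      case l: (Klein s' a' m')
      then have "separated k l 0 b" using d size k M(2) by (auto simp: list_all_iff simp del: shape_reps.simps)
      then show False using M(1) eq unfolding separated_def list_all_iff list_ex_iff by fastforce
    qed
  qed
qed

subsection \<open>Weak regularity\<close>

text \<open>A transitive automorphism group would contain an element taking the image of \<open>a\<close>
  to that of \<open>b\<close>, and its lift would be a symmetry excluded by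
  \<open>separated\<close>.\<close>
lemma separated_not_transitive:
  assumes X: "has_shape X k" and s: "separated k k a b"
  shows "\<not> weakly_regular X"
proof
  obtain \<phi> where \<phi>: "hex_cover \<phi> X" "\<And>z w. \<phi> z = \<phi> w \<longleftrightarrow> shape_red k z = shape_red k w"
    using has_shape_cover[OF X] by blast
  have V: "\<phi> a \<in> vertices X" "\<phi> b \<in> vertices X" by (simp_all add: hex_cover_vertices[OF \<phi>(1)])
  assume "weakly_regular X"
  then obtain f where f: "simplicial_iso f X X" "f (\<phi> a) = \<phi> b" using V unfolding weakly_regular_def by blast
  from simplicial_iso_match[OF \<phi>(1) \<phi>(1) f] obtain A where
    A: "A \<in> dihedral" "\<And>u v. \<phi> (a + u) = \<phi> (a + v) \<longleftrightarrow> \<phi> (b + A u) = \<phi> (b + A v)" by blast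
  obtain M where M: "M \<in> set dihedral_matrices" "A = mat_app M" using dihedral_matrix[OF A(1)] .
  have "shape_red k u = shape_red k v \<longleftrightarrow> shape_red k (b + mat_app M (u - a)) = shape_red k (b + mat_app M (v - a))" for u v
    using A(2)[of "u - a" "v - a"] M(2) \<phi>(2) by simp
  then show False using s M(1) unfolding separated_def list_all_iff list_ex_iff by fastforce
qed


section \<open>Quotients of the plane\<close>

text \<open>The plane as \<open>\<real> \<times> \<real>\<close>, in place of the functions that make up
  \<open>Euclidean_space 2\<close>.\<close>
definition plane_point :: "real \<times> real \<Rightarrow> nat \<Rightarrow> real" where
  "plane_point p i = (if i = 0 then fst p else if i = 1 then snd p else 0)"

lemma plane_homeomorphic: "homeomorphic_map euclidean (Euclidean_space 2) plane_point"
proof -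
  have c1: "continuous_map euclidean (Euclidean_space 2) plane_point"
    unfolding Euclidean_space_def
  proof (rule continuous_map_into_subtopology)
    show "continuous_map euclidean (powertop_real UNIV) plane_point"
      unfolding continuous_map_componentwise_UNIV
    proof
      fix i :: nat
      have "continuous_on UNIV (\<lambda>p. plane_point p i)"
        unfolding plane_point_def by (cases "i = 0"; cases "i = 1") (auto intro!: continuous_intros)
      then show "continuous_map euclidean euclideanreal (\<lambda>p. plane_point p i)" by simp
    qed
  qed (auto simp: plane_point_def)
  have c2: "continuous_map (Euclidean_space 2) euclidean (\<lambda>x. (x 0, x 1) :: real \<times> real)"
  proof -
    have "continuous_map (powertop_real UNIV) euclideanreal (\<lambda>x. x i)" for i :: nat
      using continuous_map_product_projection[of i UNIV "\<lambda>_. euclideanreal"] by simp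
    then have "continuous_map (Euclidean_space 2) euclideanreal (\<lambda>x. x i)" for i
      unfolding Euclidean_space_def by (rule continuous_map_from_subtopology)
    then have "continuous_map (Euclidean_space 2) (prod_topology euclideanreal euclideanreal) (\<lambda>x. (x 0, x 1))"
      by (intro continuous_map_pairedI) auto
    then show ?thesis by simp
  qed
  have "homeomorphic_maps euclidean (Euclidean_space 2) plane_point (\<lambda>x. (x 0, x 1))"
    unfolding homeomorphic_maps_def
  proof (intro conjI ballI c1 c2)
    fix y assume "y \<in> topspace (Euclidean_space 2)"
    then have "\<forall>i\<ge>2. y i = 0" by (simp add: topspace_Euclidean_space)
    then show "plane_point (y 0, y 1) = y" by (auto simp: plane_point_def fun_eq_iff)
  qed (simp add: plane_point_def)
  then show ?thesis unfolding homeomorphic_map_maps by blast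
qed

lemma plane_open_chart:
  assumes "open W"
  shows "openin (Euclidean_space 2) (plane_point ` W)"
    "subtopology euclidean W homeomorphic_space subtopology (Euclidean_space 2) (plane_point ` W)"
proof -
  show "openin (Euclidean_space 2) (plane_point ` W)"
    using plane_homeomorphic assms by (metis homeomorphic_map_openness_eq open_openin)
  have "homeomorphic_map (subtopology euclidean W) (subtopology (Euclidean_space 2) (plane_point ` W)) plane_point"
    by (rule homeomorphic_map_subtopologies[OF plane_homeomorphic])
       (use homeomorphic_imp_surjective_map[OF plane_homeomorphic] in auto)
  then show "subtopology euclidean W homeomorphic_space subtopology (Euclidean_space 2) (plane_point ` W)"
    by (rule homeomorphic_map_imp_homeomorphic_space)
qed

lemma second_countable_euclidean: "second_countable (euclidean :: 'a::second_countable_topology topology)"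
proof -
  obtain B :: "'a set set" where B: "countable B" "topological_basis B" using ex_countable_basis by blast
  show ?thesis unfolding second_countable_def
  proof (intro exI[of _ B] conjI allI ballI impI)
    fix U and x :: 'a assume "openin euclidean U \<and> x \<in> U"
    then show "\<exists>V\<in>B. x \<in> V \<and> V \<subseteq> U"
      using topological_basisE[OF B(2), of U x] by (metis open_openin)
  qed (use B topological_basis_open in auto)
qed

text \<open>Two quotient maps with the same fibres factor through each other.\<close>
lemma same_fibres_homeomorphic:
  assumes f: "quotient_map X Y f" and h: "quotient_map X Z h"
    and eq: "\<And>x y. x \<in> topspace X \<Longrightarrow> y \<in> topspace X \<Longrightarrow> f x = f y \<longleftrightarrow> h x = h y"
  shows "Y homeomorphic_space Z"
proof -
  obtain g where g: "continuous_map Y Z g" "\<And>x. x \<in> topspace X \<Longrightarrow> g (f x) = h x"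
    using quotient_map_lift_exists[OF f quotient_imp_continuous_map[OF h]] eq by metis
  obtain k where k: "continuous_map Z Y k" "\<And>x. x \<in> topspace X \<Longrightarrow> k (h x) = f x"
    using quotient_map_lift_exists[OF h quotient_imp_continuous_map[OF f]] eq by metis
  have "f ` topspace X = topspace Y" "h ` topspace X = topspace Z"
    using f h by (simp_all add: quotient_map_def)
  then have "homeomorphic_maps Y Z g k"
    unfolding homeomorphic_maps_def using g k by (metis (no_types, lifting) imageE)
  then show ?thesis unfolding homeomorphic_space_def by blast
qed

text \<open>A space presented as the quotient of the plane by a group of homeomorphisms that has the unit
  square as a compact set of representatives and moves each point by at least one half. The
  bound serves to find evenly covered discs.\<close>
locale plane_quotient =
  fixes X :: "'a topology" and \<Psi> :: "real \<times> real \<Rightarrow> 'a" and G :: "(real \<times> real \<Rightarrow> real \<times> real) set"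
  assumes cont: "continuous_map euclidean X \<Psi>"
    and onto: "\<Psi> ` unit_square = topspace X"
    and Hausdorff: "Hausdorff_space X"
    and fibre: "\<Psi> p = \<Psi> q \<longleftrightarrow> (\<exists>g\<in>G. q = g p)"
    and action: "g \<in> G \<Longrightarrow> \<exists>h. continuous_on UNIV h \<and> (\<forall>p. h (g p) = p) \<and> (\<forall>p. g (h p) = p)"
    and discrete: "\<Psi> p = \<Psi> q \<Longrightarrow> dist p q < 1 / 2 \<Longrightarrow> p = q"
begin

lemma range_eq: "range \<Psi> = topspace X"
proof
  show "range \<Psi> \<subseteq> topspace X" using cont by (auto simp: continuous_map_def)
  show "topspace X \<subseteq> range \<Psi>" unfolding onto[symmetric] by blast
qed

text \<open>A continuous map from a compact space onto a Hausdorff space is a quotient map. This makes the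
  topology of \<open>X\<close> accessible: it is determined by the fibres on the square.\<close>
lemma square_quotient: "quotient_map (top_of_set unit_square) X \<Psi>"
proof (rule T1_Spaces.continuous_imp_quotient_map)
  show "continuous_map (top_of_set unit_square) X \<Psi>" using cont by (rule continuous_map_from_subtopology)
  have "compact unit_square" by (simp add: unit_square_def compact_Times)
  then show "compact_space (top_of_set unit_square)" by (simp add: compact_space_subtopology)
qed (use Hausdorff onto in simp_all)

text \<open>The preimage of the image of an open set is the union of its translates under the group.\<close>
lemma open_map: "open_map euclidean X \<Psi>"
  unfolding open_map_def
proof (intro allI impI)
  fix V :: "(real \<times> real) set" assume "openin euclidean V"
  then have V: "open V" by simp
  have pre: "{p. \<Psi> p \<in> \<Psi> ` V} = (\<Union>g\<in>G. g ` V)"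
  proof (intro subset_antisym subsetI)
    fix p assume "p \<in> {p. \<Psi> p \<in> \<Psi> ` V}"
    then obtain v where "v \<in> V" "\<Psi> v = \<Psi> p" by auto
    moreover from this obtain g where "g \<in> G" "p = g v" using fibre[of v p] by auto
    ultimately show "p \<in> (\<Union>g\<in>G. g ` V)" by blast
  next
    fix p assume "p \<in> (\<Union>g\<in>G. g ` V)"
    then obtain g v where "g \<in> G" "v \<in> V" "p = g v" by blast
    then have "\<Psi> p = \<Psi> v" using fibre[of v p] by auto
    then show "p \<in> {p. \<Psi> p \<in> \<Psi> ` V}" using \<open>v \<in> V\<close> by simp
  qed
  have "open (g ` V)" if g: "g \<in> G" for g
  proof -
    obtain h where h: "continuous_on UNIV h" "\<And>p. h (g p) = p" "\<And>p. g (h p) = p" using action[OF g] by blast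
    have "g ` V = h -` V"
    proof (intro subset_antisym subsetI)
      show "x \<in> g ` V" if "x \<in> h -` V" for x
        by (rule image_eqI[of _ _ "h x"]) (use that h(3) in simp_all)
    qed (use h(2) in auto)
    then show ?thesis using open_vimage[OF V h(1)] by simp
  qed
  then have "open {p. \<Psi> p \<in> \<Psi> ` V}" unfolding pre by blast
  then have "openin (top_of_set unit_square) (unit_square \<inter> {p. \<Psi> p \<in> \<Psi> ` V})" by (simp add: openin_open_Int)
  moreover have e: "{p \<in> topspace (top_of_set unit_square). \<Psi> p \<in> \<Psi> ` V} = unit_square \<inter> {p. \<Psi> p \<in> \<Psi> ` V}" by auto
  moreover have "\<Psi> ` V \<subseteq> topspace X" unfolding range_eq[symmetric] by blast
  then have "openin (top_of_set unit_square) {p \<in> topspace (top_of_set unit_square). \<Psi> p \<in> \<Psi> ` V} \<longleftrightarrow> openin X (\<Psi> ` V)"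
    using square_quotient unfolding quotient_map_def by blast
  ultimately show "openin X (\<Psi> ` V)" unfolding e by blast
qed

text \<open>Discs of radius 1/4 are embedded, by the bound on displacements, and serve as charts.\<close>
lemma closed_surface: "closed_surface X"
  unfolding closed_surface_def
proof (intro conjI ballI)
  have "compact unit_square" by (simp add: unit_square_def compact_Times)
  then have "compactin (top_of_set unit_square) unit_square" by (simp add: compactin_subtopology)
  then have "compactin X (\<Psi> ` unit_square)"
    by (rule image_compactin) (rule continuous_map_from_subtopology[OF cont])
  then show "compact_space X" by (simp add: onto compact_space_def)
  show "Hausdorff_space X" by (rule Hausdorff)
  show "second_countable X"
    using second_countable_open_map_image[OF cont open_map] second_countable_euclidean range_eq by simp
  fix x assume "x \<in> topspace X"
  then obtain p where p: "x = \<Psi> p" using onto by blast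
  define B where "B = ball p (1 / 4)"
  have B: "open B" "p \<in> B" by (simp_all add: B_def)
  have "inj_on \<Psi> B"
  proof (rule inj_onI)
    fix u v assume "u \<in> B" "v \<in> B" "\<Psi> u = \<Psi> v"
    moreover from this have "dist u v < 1 / 2"
      using dist_triangle[of u v p] by (simp add: B_def dist_commute)
    ultimately show "u = v" using discrete by blast
  qed
  moreover have "continuous_map (top_of_set B) (subtopology X (\<Psi> ` B)) \<Psi>"
    by (intro continuous_map_into_subtopology continuous_map_from_subtopology cont) auto
  moreover have "open_map (top_of_set B) (subtopology X (\<Psi> ` B)) \<Psi>"
  proof (rule open_map_into_subtopology)
    show "open_map (top_of_set B) X \<Psi>"
      unfolding open_map_def
    proof (intro allI impI)
      fix V assume "openin (top_of_set B) V"
      then have "open V" using B(1) by (simp add: openin_open_eq)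
      then have "openin euclidean V" by simp
      then show "openin X (\<Psi> ` V)" using open_map unfolding open_map_def by blast
    qed
  qed auto
  moreover have "\<Psi> ` B \<subseteq> topspace X" unfolding range_eq[symmetric] by blast
  ultimately have "homeomorphic_map (top_of_set B) (subtopology X (\<Psi> ` B)) \<Psi>"
    by (intro bijective_open_imp_homeomorphic_map) (auto simp: topspace_subtopology)
  then have "subtopology X (\<Psi> ` B) homeomorphic_space top_of_set B"
    using homeomorphic_map_imp_homeomorphic_space homeomorphic_space_sym by metis
  then have "subtopology X (\<Psi> ` B) homeomorphic_space subtopology (Euclidean_space 2) (plane_point ` B)"
    using plane_open_chart(2)[OF B(1)] homeomorphic_space_trans by metis
  moreover have "openin euclidean B" using B(1) by simp
  then have "openin X (\<Psi> ` B)" using open_map unfolding open_map_def by blast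
  moreover have "x \<in> \<Psi> ` B" using p B(2) by blast
  ultimately show "\<exists>U W. openin X U \<and> x \<in> U \<and> openin (Euclidean_space 2) W \<and>
        subtopology X U homeomorphic_space subtopology (Euclidean_space 2) W"
    using plane_open_chart(1)[OF B(1)] by blast
qed

lemma connected: "connected_space X"
proof -
  have "connectedin X (\<Psi> ` UNIV)"
    by (rule connectedin_continuous_map_image[OF cont]) (simp add: connected_UNIV)
  then show ?thesis by (simp add: range_eq connectedin_topspace)
qed

end

lemma cis_eq_iff: "cis (2 * pi * s) = cis (2 * pi * t) \<longleftrightarrow> (\<exists>i::int. t = s + of_int i)"
proof
  assume "cis (2 * pi * s) = cis (2 * pi * t)"
  then have "sin (2 * pi * t) = sin (2 * pi * s) \<and> cos (2 * pi * t) = cos (2 * pi * s)" by (simp add: complex_eq_iff)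
  then obtain n :: int where "2 * pi * t = 2 * pi * s + 2 * pi * of_int n" unfolding sin_cos_eq_iff by blast
  then have "2 * pi * t = 2 * pi * (s + of_int n)" by (simp add: algebra_simps)
  then have "t = s + of_int n" by simp
  then show "\<exists>i::int. t = s + of_int i" by blast
next
  assume "\<exists>i::int. t = s + of_int i"
  then obtain i :: int where "t = s + of_int i" by blast
  then have "2 * pi * t = 2 * pi * s + 2 * pi * of_int i" by (simp add: distrib_left)
  then have "sin (2 * pi * t) = sin (2 * pi * s) \<and> cos (2 * pi * t) = cos (2 * pi * s)"
    unfolding sin_cos_eq_iff by blast
  then show "cis (2 * pi * s) = cis (2 * pi * t)" by (simp add: complex_eq_iff)
qed

text \<open>The standard groups: translations by \<open>\<int>\<^sup>2\<close>, and the group generated by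
  \<open>(x,y) \<mapsto> (x+1,y)\<close> and \<open>(x,y) \<mapsto> (-x,y+1)\<close>, whose
  elements are sorted by whether they reflect.\<close>
definition torus_action :: "(real \<times> real \<Rightarrow> real \<times> real) set" where
  "torus_action = {g. \<exists>i j::int. g = (\<lambda>p. (fst p + of_int i, snd p + of_int j))}"

definition klein_action :: "(real \<times> real \<Rightarrow> real \<times> real) set" where
  "klein_action = {g. \<exists>i j::int. g = (\<lambda>p. (fst p + of_int i, snd p + 2 * of_int j)) \<or>
      g = (\<lambda>p. (of_int i - fst p, snd p + 1 + 2 * of_int j))}"

lemma torus_action_iff:
  "(\<exists>g\<in>torus_action. q = g p) \<longleftrightarrow> (\<exists>i j::int. q = (fst p + of_int i, snd p + of_int j))"
proof
  assume "\<exists>g\<in>torus_action. q = g p"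
  then show "\<exists>i j::int. q = (fst p + of_int i, snd p + of_int j)" by (auto simp: torus_action_def)
next
  assume "\<exists>i j::int. q = (fst p + of_int i, snd p + of_int j)"
  then obtain i j :: int where q: "q = (fst p + of_int i, snd p + of_int j)" by (elim exE)
  have "(\<lambda>p. (fst p + of_int i, snd p + of_int j)) \<in> torus_action"
    unfolding torus_action_def mem_Collect_eq by (intro exI[of _ i] exI[of _ j] refl)
  then show "\<exists>g\<in>torus_action. q = g p" by (rule bexI[rotated]) (rule q)
qed

lemma klein_action_iff:
  "(\<exists>g\<in>klein_action. q = g p) \<longleftrightarrow> (\<exists>i j::int. q = (fst p + of_int i, snd p + 2 * of_int j) \<or>
      q = (of_int i - fst p, snd p + 1 + 2 * of_int j))"
proof
  assume "\<exists>g\<in>klein_action. q = g p"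
  then obtain g where g: "g \<in> klein_action" "q = g p" by (elim bexE)
  from g(1) obtain i j :: int where "g = (\<lambda>p. (fst p + of_int i, snd p + 2 * of_int j)) \<or>
      g = (\<lambda>p. (of_int i - fst p, snd p + 1 + 2 * of_int j))"
    unfolding klein_action_def mem_Collect_eq by (elim exE)
  then have "q = (fst p + of_int i, snd p + 2 * of_int j) \<or> q = (of_int i - fst p, snd p + 1 + 2 * of_int j)"
    using g(2) by (elim disjE) simp_all
  then show "\<exists>i j::int. q = (fst p + of_int i, snd p + 2 * of_int j) \<or> q = (of_int i - fst p, snd p + 1 + 2 * of_int j)"
    by (intro exI)
next
  assume "\<exists>i j::int. q = (fst p + of_int i, snd p + 2 * of_int j) \<or> q = (of_int i - fst p, snd p + 1 + 2 * of_int j)"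
  then obtain i j :: int where q: "q = (fst p + of_int i, snd p + 2 * of_int j) \<or> q = (of_int i - fst p, snd p + 1 + 2 * of_int j)"
    by (elim exE)
  have g: "(\<lambda>p. (fst p + of_int i, snd p + 2 * of_int j)) \<in> klein_action"
    "(\<lambda>p. (of_int i - fst p, snd p + 1 + 2 * of_int j)) \<in> klein_action"
    unfolding klein_action_def mem_Collect_eq
    by (intro exI[of _ i] exI[of _ j] disjI1 refl, intro exI[of _ i] exI[of _ j] disjI2 refl)
  from q show "\<exists>g\<in>klein_action. q = g p"
    by (elim disjE) (rule bexI[OF _ g(1)], assumption, rule bexI[OF _ g(2)], assumption)
qed

lemma torus_plane_quotient:
  assumes "continuous_map euclidean X \<Psi>" "\<Psi> ` unit_square = topspace X" "Hausdorff_space X"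
    and fibre: "\<And>p q. \<Psi> p = \<Psi> q \<longleftrightarrow> (\<exists>g\<in>torus_action. q = g p)"
  shows "plane_quotient X \<Psi> torus_action"
proof
  fix g assume "g \<in> torus_action"
  then obtain i j :: int where g: "g = (\<lambda>p. (fst p + of_int i, snd p + of_int j))" by (auto simp: torus_action_def)
  show "\<exists>h. continuous_on UNIV h \<and> (\<forall>p. h (g p) = p) \<and> (\<forall>p. g (h p) = p)"
    by (intro exI[of _ "\<lambda>p. (fst p - of_int i, snd p - of_int j)"]) (auto simp: g intro!: continuous_intros)
next
  fix p q :: "real \<times> real" assume "\<Psi> p = \<Psi> q" and d: "dist p q < 1 / 2"
  then obtain i j :: int where q: "q = (fst p + of_int i, snd p + of_int j)" using fibre unfolding torus_action_iff by blast
  have "dist (fst p) (fst q) < 1 / 2" "dist (snd p) (snd q) < 1 / 2"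
    using dist_fst_le[of p q] dist_snd_le[of p q] d by simp_all
  then have "\<bar>real_of_int i\<bar> < 1 / 2" "\<bar>real_of_int j\<bar> < 1 / 2" by (simp_all add: q dist_real_def)
  then have "i = 0" "j = 0" by linarith+
  then show "p = q" by (simp add: q)
qed (use assms in auto)

lemma klein_plane_quotient:
  assumes "continuous_map euclidean X \<Psi>" "\<Psi> ` unit_square = topspace X" "Hausdorff_space X"
    and fibre: "\<And>p q. \<Psi> p = \<Psi> q \<longleftrightarrow> (\<exists>g\<in>klein_action. q = g p)"
  shows "plane_quotient X \<Psi> klein_action"
proof
  fix g assume "g \<in> klein_action"
  then obtain i j :: int where "g = (\<lambda>p. (fst p + of_int i, snd p + 2 * of_int j)) \<or>
      g = (\<lambda>p. (of_int i - fst p, snd p + 1 + 2 * of_int j))" by (auto simp: klein_action_def)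
  then show "\<exists>h. continuous_on UNIV h \<and> (\<forall>p. h (g p) = p) \<and> (\<forall>p. g (h p) = p)"
  proof
    assume g: "g = (\<lambda>p. (fst p + of_int i, snd p + 2 * of_int j))"
    show ?thesis
      by (intro exI[of _ "\<lambda>p. (fst p - of_int i, snd p - 2 * of_int j)"]) (auto simp: g intro!: continuous_intros)
  next
    assume g: "g = (\<lambda>p. (of_int i - fst p, snd p + 1 + 2 * of_int j))"
    show ?thesis
      by (intro exI[of _ "\<lambda>p. (of_int i - fst p, snd p - 1 - 2 * of_int j)"]) (auto simp: g intro!: continuous_intros)
  qed
next
  fix p q :: "real \<times> real" assume "\<Psi> p = \<Psi> q" and d: "dist p q < 1 / 2"
  then obtain i j :: int where q: "q = (fst p + of_int i, snd p + 2 * of_int j) \<or> q = (of_int i - fst p, snd p + 1 + 2 * of_int j)"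
    using fibre unfolding klein_action_iff by blast
  have d: "\<bar>fst p - fst q\<bar> < 1 / 2" "\<bar>snd p - snd q\<bar> < 1 / 2"
    using dist_fst_le[of p q] dist_snd_le[of p q] d by (simp_all add: dist_real_def)
  from q show "p = q"
  proof
    assume q: "q = (fst p + of_int i, snd p + 2 * of_int j)"
    then have "\<bar>real_of_int i\<bar> < 1 / 2" "\<bar>real_of_int (2 * j)\<bar> < 1 / 2" using d by simp_all
    then have "i = 0" "j = 0" by linarith+
    then show "p = q" by (simp add: q)
  next
    assume q: "q = (of_int i - fst p, snd p + 1 + 2 * of_int j)"
    then have "real_of_int (1 + 2 * j) < 1 / 2" "- real_of_int (1 + 2 * j) < 1 / 2"
      using d(2) unfolding q abs_less_iff by simp_all
    then have "1 + 2 * j = 0" by linarith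
    then have False by presburger
    then show "p = q" ..
  qed
qed (use assms in auto)

text \<open>Both spaces are quotients of the unit square; the other quotient map is the pair of
  exponentials.\<close>
lemma torus_homeomorphic:
  assumes "plane_quotient X \<Psi> torus_action"
  shows "X homeomorphic_space torus"
proof -
  interpret plane_quotient X \<Psi> torus_action by (rule assms)
  define E where "E p = (cis (2 * pi * fst p), cis (2 * pi * snd p))" for p :: "real \<times> real"
  have E_eq: "E p = E q \<longleftrightarrow> (\<exists>g\<in>torus_action. q = g p)" for p q
    unfolding torus_action_iff by (auto simp: E_def cis_eq_iff prod_eq_iff)
  have T: "torus = top_of_set (sphere 0 1 \<times> sphere 0 1)"
    unfolding torus_def by (rule prod_topology_subtopology_eu)
  have "quotient_map (top_of_set unit_square) torus E"
  proof (rule T1_Spaces.continuous_imp_quotient_map)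
    have "continuous_on unit_square E" unfolding E_def cis_conv_exp by (intro continuous_intros)
    moreover have "E ` unit_square \<subseteq> sphere 0 1 \<times> sphere 0 1" by (auto simp: E_def)
    ultimately show "continuous_map (top_of_set unit_square) torus E" unfolding T by auto
    have "compact unit_square" by (simp add: unit_square_def compact_Times)
    then show "compact_space (top_of_set unit_square)" by (simp add: compact_space_subtopology)
    show "Hausdorff_space torus" unfolding T by (simp add: Hausdorff_space_subtopology)
    have "(u, v) \<in> E ` unit_square" if uv: "u \<in> sphere 0 1" "v \<in> sphere 0 1" for u v
    proof -
      have ex: "\<exists>s\<in>{0..1}. w = cis (2 * pi * s)" if "w \<in> sphere 0 1" for w
      proof -
        have "norm w = 1" using that by simp
        then have "w = cis (Arg2pi w)" using Arg2pi_eq[of w] by (simp add: cis_conv_exp)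
        moreover have "0 \<le> Arg2pi w" "Arg2pi w < 2 * pi" by (simp_all add: Arg2pi_ge_0 Arg2pi_lt_2pi)
        ultimately show ?thesis by (intro bexI[of _ "Arg2pi w / (2 * pi)"]) (auto simp: field_simps)
      qed
      obtain s where "s \<in> {0..1}" "u = cis (2 * pi * s)" using ex[OF uv(1)] by blast
      moreover obtain t where "t \<in> {0..1}" "v = cis (2 * pi * t)" using ex[OF uv(2)] by blast
      ultimately show ?thesis by (intro image_eqI[of _ _ "(s, t)"]) (auto simp: E_def unit_square_def)
    qed
    then show "E ` topspace (top_of_set unit_square) = topspace torus"
      unfolding T by (auto simp: E_def)
  qed
  then show ?thesis by (rule same_fibres_homeomorphic[OF square_quotient]) (simp only: fibre E_eq)
qed

text \<open>On the unit square the orbits of the group are exactly the classes of the gluing that defines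
  the Klein bottle, so both spaces are quotients of the square with the same fibres.\<close>
lemma klein_homeomorphic:
  assumes "plane_quotient X \<Psi> klein_action"
  shows "X homeomorphic_space klein_bottle"
proof -
  interpret plane_quotient X \<Psi> klein_action by (rule assms)
  have "equiv (topspace (top_of_set unit_square)) klein_rel" using equiv_klein_rel by simp
  then have q: "quotient_map (top_of_set unit_square) klein_bottle (\<lambda>p. klein_rel `` {p})"
    unfolding klein_bottle_def by (rule quotient_map_quotient_topology)
  have glue: "\<Psi> p = \<Psi> q" if "(p, q) \<in> klein_gluing" for p q
  proof -
    from that consider y where "p = (0, y)" "q = (1, y)" | x where "p = (x, 0)" "q = (1 - x, 1)"
      unfolding klein_gluing_def by blast
    then have "\<exists>i j::int. q = (fst p + of_int i, snd p + 2 * of_int j) \<or> q = (of_int i - fst p, snd p + 1 + 2 * of_int j)"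
      by cases (intro exI[of _ 1] exI[of _ 0]; simp)+
    then show ?thesis unfolding fibre klein_action_iff .
  qed
  have eq: "\<Psi> p = \<Psi> q" if "(p, q) \<in> klein_rel" for p q
  proof -
    have "(p, q) \<in> (klein_gluing \<union> klein_gluing\<inverse>)\<^sup>*" using that by (simp add: klein_rel_def)
    then show ?thesis
    proof (induction rule: rtrancl_induct)
      case (step y z) then show ?case using glue by (metis Un_iff converse_iff)
    qed simp
  qed
  have rel: "(p, q) \<in> klein_rel" if pq: "p \<in> unit_square" "q \<in> unit_square" "\<Psi> p = \<Psi> q" for p q
  proof -
    let ?R = "(klein_gluing \<union> klein_gluing\<inverse>)\<^sup>*"
    have side: "((0, y), (1, y)) \<in> ?R" "((1, y), (0, y)) \<in> ?R" if "y \<in> {0..1}" for y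
      using that by (auto simp: klein_gluing_def intro!: r_into_rtrancl)
    have flip: "((x, 0), (1 - x, 1)) \<in> ?R" "((1 - x, 1), (x, 0)) \<in> ?R" if "x \<in> {0..1}" for x
      using that by (auto simp: klein_gluing_def intro!: r_into_rtrancl)
    have shift: "((x, y), (x', y)) \<in> ?R" if "x \<in> {0..1}" "x' \<in> {0..1}" "y \<in> {0..1}" "x' = x + of_int i" for x x' y i
    proof -
      have "\<bar>real_of_int i\<bar> \<le> 1" using that by auto
      then have "i = 0 \<or> i = 1 \<or> i = -1" by linarith
      then have "x' = x \<or> x = 0 \<and> x' = 1 \<or> x = 1 \<and> x' = 0" using that by auto
      then show ?thesis using side[OF that(3)] by auto
    qed
    have "(p, q) \<in> ?R"
    proof -
      obtain i j :: int where g: "q = (fst p + of_int i, snd p + 2 * of_int j) \<or> q = (of_int i - fst p, snd p + 1 + 2 * of_int j)"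
        using pq(3) unfolding fibre klein_action_iff by blast
      obtain x y x' y' where xy: "p = (x, y)" "q = (x', y')" by force
      have b: "x \<in> {0..1}" "y \<in> {0..1}" "x' \<in> {0..1}" "y' \<in> {0..1}" using pq(1,2) by (auto simp: unit_square_def xy)
      have "x' = x + of_int i \<and> y' = y + 2 * of_int j \<or> x' = of_int i - x \<and> y' = y + 1 + 2 * of_int j"
        using g by (simp add: xy)
      then show ?thesis
      proof (elim disjE conjE)
        assume e: "x' = x + of_int i" "y' = y + 2 * of_int j"
        then have "\<bar>real_of_int (2 * j)\<bar> \<le> 1" using b by auto
        then have "j = 0" by linarith
        then show ?thesis using shift[OF b(1,3,2) e(1)] e(2) by (simp add: xy)
      next
        assume e: "x' = of_int i - x" "y' = y + 1 + 2 * of_int j"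
        then have "\<bar>real_of_int (1 + 2 * j)\<bar> \<le> 1" using b by auto
        then have "j = 0 \<or> j = -1" by linarith
        then show ?thesis
        proof
          assume "j = 0"
          then have y: "y = 0" "y' = 1" using e(2) b by auto
          have "((1 - x, 1), (x', 1)) \<in> ?R"
            by (rule shift[where i = "i - 1"]) (use b e in auto)
          then show ?thesis using rtrancl_trans[OF flip(1)[OF b(1)]] by (simp add: xy y)
        next
          assume "j = -1"
          then have y: "y = 1" "y' = 0" using e(2) b by auto
          have "((1 - (1 - x), 1), (1 - (1 - x), 1)) \<in> ?R" by simp
          have "((1 - (1 - x), 1), (1 - x, 0)) \<in> ?R" by (rule flip(2)) (use b in auto)
          moreover have "((1 - x, 0), (x', 0)) \<in> ?R"
            by (rule shift[where i = "i - 1"]) (use b e in auto)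
          ultimately show ?thesis using rtrancl_trans by (simp add: xy y)
        qed
      qed
    qed
    then show ?thesis using pq by (simp add: klein_rel_def)
  qed
  show ?thesis
  proof (rule same_fibres_homeomorphic[OF square_quotient q])
    fix p q assume "p \<in> topspace (top_of_set unit_square)" "q \<in> topspace (top_of_set unit_square)"
    then have pq: "p \<in> unit_square" "q \<in> unit_square" by simp_all
    show "\<Psi> p = \<Psi> q \<longleftrightarrow> klein_rel `` {p} = klein_rel `` {q}"
      unfolding eq_equiv_class_iff[OF equiv_klein_rel pq] using eq rel[OF pq] by blast
  qed
qed



section \<open>The carrier as a quotient of the plane\<close>

text \<open>The piecewise linear function that is 1 at the origin, 0 at all other lattice points and
  affine on each lattice triangle: \<open>hat (p - u)\<close> is the barycentric coordinate of
  \<open>p\<close> with respect to the lattice point \<open>u\<close>. The closed formula makes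
  continuity and symmetry evident.\<close>
definition hat :: "real \<times> real \<Rightarrow> real" where
  "hat p = max 0 (1 - max (max \<bar>fst p\<bar> \<bar>snd p\<bar>) \<bar>fst p - snd p\<bar>)"

definition rl :: "lat \<Rightarrow> real \<times> real" where "rl z = (real_of_int (fst z), real_of_int (snd z))"

lemma hat_nonneg: "0 \<le> hat p" by (simp add: hat_def)
lemma rl_add: "rl (z + w) = rl z + rl w" by (simp add: rl_def)
lemma hat_swap: "hat (prod.swap p) = hat p"
  by (simp add: hat_def abs_minus_commute max.commute)

text \<open>The coordinates in the lower triangle of the unit square; the upper triangle follows by the
  symmetry \<open>hat_swap\<close>, and all other triangles by translation.\<close>
lemma hat_lower:
  assumes "0 \<le> \<beta>" "0 \<le> \<gamma>" "\<beta> + \<gamma> \<le> 1"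
  shows "hat ((\<beta> + \<gamma>, \<gamma>) - rl z) = (if z = (0, 0) then 1 - \<beta> - \<gamma> else if z = (1, 0) then \<beta> else if z = (1, 1) then \<gamma> else 0)"
proof -
  obtain m n where z: "z = (m, n)" by force
  have *: "hat ((\<beta> + \<gamma>, \<gamma>) - rl z) = 0" if "1 \<le> \<bar>\<beta> + \<gamma> - m\<bar> \<or> 1 \<le> \<bar>\<gamma> - n\<bar> \<or> 1 \<le> \<bar>\<beta> - (m - n)\<bar>"
    using that by (auto simp: hat_def rl_def z max_def abs_if)
  consider "m < 0" | "1 < m" | "n < 0" | "1 < n" | "(m = 0 \<or> m = 1) \<and> (n = 0 \<or> n = 1)" by linarith
  then show ?thesis
  proof cases
    case 1
    then have "real_of_int m \<le> -1" by linarith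
    then have "1 \<le> \<bar>\<beta> + \<gamma> - m\<bar>" using assms by linarith
    then show ?thesis using * 1 by (simp add: z)
  next
    case 2
    then have "2 \<le> real_of_int m" by linarith
    then have "1 \<le> \<bar>\<beta> + \<gamma> - m\<bar>" using assms by linarith
    then show ?thesis using * 2 by (simp add: z)
  next
    case 3
    then have "real_of_int n \<le> -1" by linarith
    then have "1 \<le> \<bar>\<gamma> - n\<bar>" using assms by linarith
    then show ?thesis using * 3 by (simp add: z)
  next
    case 4
    then have "2 \<le> real_of_int n" by linarith
    then have "1 \<le> \<bar>\<gamma> - n\<bar>" using assms by linarith
    then show ?thesis using * 4 by (simp add: z)
  next
    case 5
    have "\<bar>\<beta> + \<gamma>\<bar> = \<beta> + \<gamma>" "\<bar>\<gamma>\<bar> = \<gamma>" "\<bar>\<beta>\<bar> = \<beta>" "\<bar>\<beta> + \<gamma> - 1\<bar> = 1 - \<beta> - \<gamma>" "\<bar>\<gamma> - 1\<bar> = 1 - \<gamma>"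
      "\<bar>\<beta> - 1\<bar> = 1 - \<beta>" "\<bar>\<beta> + 1\<bar> = \<beta> + 1" "\<bar>\<beta> + \<gamma> - 1 - \<gamma>\<bar> = 1 - \<beta>" "\<bar>\<beta> + \<gamma> - (\<gamma> - 1)\<bar> = 1 + \<beta>"
      using assms by linarith+
    with 5 assms show ?thesis
      by (elim conjE disjE) (simp_all add: z hat_def rl_def max_def)
  qed
qed

lemma hat_upper:
  assumes "0 \<le> \<beta>" "0 \<le> \<gamma>" "\<beta> + \<gamma> \<le> 1"
  shows "hat ((\<gamma>, \<beta> + \<gamma>) - rl z) = (if z = (0, 0) then 1 - \<beta> - \<gamma> else if z = (0, 1) then \<beta> else if z = (1, 1) then \<gamma> else 0)"
proof -
  have e: "(\<gamma>, \<beta> + \<gamma>) - rl z = prod.swap ((\<beta> + \<gamma>, \<gamma>) - rl (prod.swap z))" by (cases z) (simp add: rl_def)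
  have "prod.swap z = (0, 0) \<longleftrightarrow> z = (0, 0)" "prod.swap z = (1, 0) \<longleftrightarrow> z = (0, 1)" "prod.swap z = (1, 1) \<longleftrightarrow> z = (1, 1)"
    by (cases z; simp; blast)+
  then show ?thesis unfolding e hat_swap hat_lower[OF assms] by presburger
qed

lemma triangle_coordinates:
  assumes t: "t \<in> lattice_triangles" and nn: "\<And>u. u \<in> t \<Longrightarrow> 0 \<le> \<mu> u" and sum: "(\<Sum>u\<in>t. \<mu> u) = 1"
  shows "hat ((\<Sum>u\<in>t. \<mu> u *\<^sub>R rl u) - rl w) = (if w \<in> t then \<mu> w else 0)"
proof -
  consider z where "t = tri1 z" | z where "t = tri2 z" using t by (auto simp: lattice_triangles_def)
  then show ?thesis
  proof cases
    case 1
    have d: "z \<noteq> z + (1, 0)" "z \<noteq> z + (1, 1)" "z + (1, 0) \<noteq> z + (1, 1)" by (cases z; simp)+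
    define \<beta> where "\<beta> = \<mu> (z + (1, 0))"
    define \<gamma> where "\<gamma> = \<mu> (z + (1, 1))"
    have a: "\<mu> z = 1 - \<beta> - \<gamma>" using sum d by (simp add: 1 tri1_def \<beta>_def \<gamma>_def)
    have b: "0 \<le> \<beta>" "0 \<le> \<gamma>" "\<beta> + \<gamma> \<le> 1" using nn[of z] nn[of "z + (1, 0)"] nn[of "z + (1, 1)"] a
      by (simp_all add: 1 tri1_def \<beta>_def \<gamma>_def)
    have "(\<Sum>u\<in>t. \<mu> u *\<^sub>R rl u) = (1 - \<beta> - \<gamma>) *\<^sub>R rl z + (\<beta> *\<^sub>R rl (z + (1, 0)) + \<gamma> *\<^sub>R rl (z + (1, 1)))"
      using d by (simp add: 1 tri1_def a \<beta>_def[symmetric] \<gamma>_def[symmetric])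
    also have "\<dots> - rl w = (\<beta> + \<gamma>, \<gamma>) - rl (w - z)"
      by (simp add: rl_def prod_eq_iff algebra_simps)
    finally have e: "(\<Sum>u\<in>t. \<mu> u *\<^sub>R rl u) - rl w = (\<beta> + \<gamma>, \<gamma>) - rl (w - z)" .
    have c: "w - z = (0, 0) \<longleftrightarrow> w = z" "w - z = (1, 0) \<longleftrightarrow> w = z + (1, 0)" "w - z = (1, 1) \<longleftrightarrow> w = z + (1, 1)"
      by (auto simp: prod_eq_iff)
    show ?thesis unfolding e hat_lower[OF b] c using a d by (auto simp: 1 tri1_def \<beta>_def \<gamma>_def)
  next
    case 2
    have d: "z \<noteq> z + (0, 1)" "z \<noteq> z + (1, 1)" "z + (0, 1) \<noteq> z + (1, 1)" by (cases z; simp)+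
    define \<beta> where "\<beta> = \<mu> (z + (0, 1))"
    define \<gamma> where "\<gamma> = \<mu> (z + (1, 1))"
    have a: "\<mu> z = 1 - \<beta> - \<gamma>" using sum d by (simp add: 2 tri2_def \<beta>_def \<gamma>_def)
    have b: "0 \<le> \<beta>" "0 \<le> \<gamma>" "\<beta> + \<gamma> \<le> 1" using nn[of z] nn[of "z + (0, 1)"] nn[of "z + (1, 1)"] a
      by (simp_all add: 2 tri2_def \<beta>_def \<gamma>_def)
    have "(\<Sum>u\<in>t. \<mu> u *\<^sub>R rl u) = (1 - \<beta> - \<gamma>) *\<^sub>R rl z + (\<beta> *\<^sub>R rl (z + (0, 1)) + \<gamma> *\<^sub>R rl (z + (1, 1)))"
      using d by (simp add: 2 tri2_def a \<beta>_def[symmetric] \<gamma>_def[symmetric])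
    also have "\<dots> - rl w = (\<gamma>, \<beta> + \<gamma>) - rl (w - z)"
      by (simp add: rl_def prod_eq_iff algebra_simps)
    finally have e: "(\<Sum>u\<in>t. \<mu> u *\<^sub>R rl u) - rl w = (\<gamma>, \<beta> + \<gamma>) - rl (w - z)" .
    have c: "w - z = (0, 0) \<longleftrightarrow> w = z" "w - z = (0, 1) \<longleftrightarrow> w = z + (0, 1)" "w - z = (1, 1) \<longleftrightarrow> w = z + (1, 1)"
      by (auto simp: prod_eq_iff)
    show ?thesis unfolding e hat_upper[OF b] c using a d by (auto simp: 2 tri2_def \<beta>_def \<gamma>_def)
  qed
qed

lemma finite_triangle: "t \<in> lattice_triangles \<Longrightarrow> finite t"
  by (auto simp: lattice_triangles_def tri1_def tri2_def)

lemma point_in_triangle: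
  obtains t \<mu> where "t \<in> lattice_triangles" "\<forall>u. 0 \<le> (\<mu> u :: real)" "(\<Sum>u\<in>t. \<mu> u) = 1" "p = (\<Sum>u\<in>t. \<mu> u *\<^sub>R rl u)"
proof -
  obtain x y where p: "p = (x, y)" by force
  define z where "z = (\<lfloor>x\<rfloor>, \<lfloor>y\<rfloor>)"
  define f g where "f = frac x" and "g = frac y"
  have fg: "0 \<le> f" "f < 1" "0 \<le> g" "g < 1" by (simp_all add: f_def g_def frac_lt_1)
  have xy: "x = \<lfloor>x\<rfloor> + f" "y = \<lfloor>y\<rfloor> + g" by (simp_all add: f_def g_def frac_def)
  show thesis
  proof (cases "g \<le> f")
    case True
    have d: "z \<noteq> z + (1, 0)" "z \<noteq> z + (1, 1)" "z + (1, 0) \<noteq> z + (1, 1)" by (cases z; simp)+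
    define \<mu> where "\<mu> u = (if u = z then 1 - f else if u = z + (1, 0) then f - g else if u = z + (1, 1) then g else 0)" for u
    have \<mu>: "\<mu> z = 1 - f" "\<mu> (z + (1, 0)) = f - g" "\<mu> (z + (1, 1)) = g" using d unfolding \<mu>_def by presburger+
    show thesis
    proof (rule that[of "tri1 z" \<mu>])
      show "tri1 z \<in> lattice_triangles" by (auto simp: lattice_triangles_def)
      show "\<forall>u. 0 \<le> \<mu> u" using True fg by (simp add: \<mu>_def)
      show "(\<Sum>u\<in>tri1 z. \<mu> u) = 1" using d by (simp add: tri1_def \<mu>)
      have "p = (1 - f) *\<^sub>R rl z + ((f - g) *\<^sub>R rl (z + (1, 0)) + g *\<^sub>R rl (z + (1, 1)))"
        by (subst p, subst xy(1), subst xy(2)) (simp add: z_def rl_def algebra_simps)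
      then show "p = (\<Sum>u\<in>tri1 z. \<mu> u *\<^sub>R rl u)" using d by (simp add: tri1_def \<mu>)
    qed
  next
    case False
    have d: "z \<noteq> z + (0, 1)" "z \<noteq> z + (1, 1)" "z + (0, 1) \<noteq> z + (1, 1)" by (cases z; simp)+
    define \<mu> where "\<mu> u = (if u = z then 1 - g else if u = z + (0, 1) then g - f else if u = z + (1, 1) then f else 0)" for u
    have \<mu>: "\<mu> z = 1 - g" "\<mu> (z + (0, 1)) = g - f" "\<mu> (z + (1, 1)) = f" using d unfolding \<mu>_def by presburger+
    show thesis
    proof (rule that[of "tri2 z" \<mu>])
      show "tri2 z \<in> lattice_triangles" by (auto simp: lattice_triangles_def)
      show "\<forall>u. 0 \<le> \<mu> u" using False fg by (simp add: \<mu>_def)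
      show "(\<Sum>u\<in>tri2 z. \<mu> u) = 1" using d by (simp add: tri2_def \<mu>)
      have "p = (1 - g) *\<^sub>R rl z + ((g - f) *\<^sub>R rl (z + (0, 1)) + f *\<^sub>R rl (z + (1, 1)))"
        by (subst p, subst xy(1), subst xy(2)) (simp add: z_def rl_def algebra_simps)
      then show "p = (\<Sum>u\<in>tri2 z. \<mu> u *\<^sub>R rl u)" using d by (simp add: tri2_def \<mu>)
    qed
  qed
qed

definition supported :: "lat set \<Rightarrow> real \<times> real \<Rightarrow> bool" where
  "supported t p \<longleftrightarrow> (\<forall>u. u \<notin> t \<longrightarrow> hat (p - rl u) = 0)"

lemma supportedD: "supported t p \<Longrightarrow> u \<notin> t \<Longrightarrow> hat (p - rl u) = 0"
  by (simp add: supported_def)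

text \<open>Every point lies in some triangle, and its coordinates with respect to all other lattice
  points vanish.\<close>
lemma barycentric:
  obtains t where "t \<in> lattice_triangles" "supported t p"
    "(\<Sum>u\<in>t. hat (p - rl u)) = 1" "(\<Sum>u\<in>t. hat (p - rl u) *\<^sub>R rl u) = p"
proof -
  obtain t \<mu> where t: "t \<in> lattice_triangles" "\<forall>u. 0 \<le> (\<mu> u :: real)" "(\<Sum>u\<in>t. \<mu> u) = 1" "p = (\<Sum>u\<in>t. \<mu> u *\<^sub>R rl u)"
    by (rule point_in_triangle[of p])
  have h: "hat (p - rl w) = (if w \<in> t then \<mu> w else 0)" for w
    unfolding t(4) by (rule triangle_coordinates[OF t(1) spec[OF t(2)] t(3)])
  have s: "supported t p" by (simp add: supported_def h)
  have "(\<Sum>u\<in>t. hat (p - rl u)) = (\<Sum>u\<in>t. \<mu> u)" by (rule sum.cong) (simp_all add: h)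
  then have 1: "(\<Sum>u\<in>t. hat (p - rl u)) = 1" using t(3) by simp
  have "(\<Sum>u\<in>t. hat (p - rl u) *\<^sub>R rl u) = (\<Sum>u\<in>t. \<mu> u *\<^sub>R rl u)" by (rule sum.cong) (simp_all add: h)
  then have "(\<Sum>u\<in>t. hat (p - rl u) *\<^sub>R rl u) = p" using t(4) by simp
  with t(1) s 1 show thesis by (rule that)
qed

text \<open>The linear extension of a simplicial map: the coordinate of the image at the vertex
  \<open>v\<close> collects the coordinates at all lattice points over \<open>v\<close>. The
  support is restricted to make the sum finite.\<close>
definition realize :: "(lat \<Rightarrow> 'v) \<Rightarrow> real \<times> real \<Rightarrow> 'v \<Rightarrow> real" where
  "realize \<phi> p v = (\<Sum>u | hat (p - rl u) \<noteq> 0 \<and> \<phi> u = v. hat (p - rl u))"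

lemma realize_sum:
  assumes "finite S" "supported S p"
  shows "realize \<phi> p v = (\<Sum>u | u \<in> S \<and> \<phi> u = v. hat (p - rl u))"
  unfolding realize_def
  by (rule sum.mono_neutral_left) (use assms in \<open>auto simp: supported_def\<close>)

lemma realize_triangle:
  assumes t: "t \<in> lattice_triangles" "supported t p" and inj: "inj_on \<phi> t"
  shows "u \<in> t \<Longrightarrow> realize \<phi> p (\<phi> u) = hat (p - rl u)" "v \<notin> \<phi> ` t \<Longrightarrow> realize \<phi> p v = 0"
proof -
  note r = realize_sum[OF finite_triangle[OF t(1)] t(2)]
  show "realize \<phi> p (\<phi> u) = hat (p - rl u)" if "u \<in> t"
  proof -
    have "{w. w \<in> t \<and> \<phi> w = \<phi> u} = {u}" using inj that by (auto dest: inj_onD)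
    then show ?thesis unfolding r by simp
  qed
  show "realize \<phi> p v = 0" if "v \<notin> \<phi> ` t"
  proof -
    have "{w. w \<in> t \<and> \<phi> w = v} = {}" using that by auto
    then show ?thesis by (simp only: r sum.empty)
  qed
qed

lemma triangle_subset_star: "t \<in> lattice_triangles \<Longrightarrow> w \<in> t \<Longrightarrow> t \<subseteq> star w"
proof -
  assume "t \<in> lattice_triangles" "w \<in> t"
  then obtain k where t: "t = {w, w + hexdir k, w + hexdir (Suc k)}" by (rule triangle_at)
  show "t \<subseteq> star w" unfolding t star_altdef by blast
qed

lemma triangle_nonempty: "t \<in> lattice_triangles \<Longrightarrow> t \<noteq> {}"
  by (auto simp: lattice_triangles_def tri1_def tri2_def)

lemma hex_cover_inj_triangle: "hex_cover \<phi> K \<Longrightarrow> t \<in> lattice_triangles \<Longrightarrow> inj_on \<phi> t"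
proof -
  assume K: "hex_cover \<phi> K" and t: "t \<in> lattice_triangles"
  obtain w where "w \<in> t" using triangle_nonempty[OF t] by blast
  moreover have "inj_on \<phi> (star w)" using K by (simp add: hex_cover_def)
  ultimately show "inj_on \<phi> t" using triangle_subset_star[OF t] inj_on_subset by blast
qed

lemma topspace_carrier:
  "x \<in> topspace (geometric_carrier K) \<longleftrightarrow> (\<forall>v. 0 \<le> x v) \<and> {v. x v \<noteq> 0} \<in> K \<and> (\<Sum>v | x v \<noteq> 0. x v) = 1"
  by (simp add: geometric_carrier_def)

lemma realize_in_carrier:
  assumes K: "hex_cover \<phi> K"
  shows "realize \<phi> p \<in> topspace (geometric_carrier K)"
proof -
  obtain t where t: "t \<in> lattice_triangles" "supported t p"
    "(\<Sum>u\<in>t. hat (p - rl u)) = 1" "(\<Sum>u\<in>t. hat (p - rl u) *\<^sub>R rl u) = p" by (rule barycentric[of p])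
  have inj: "inj_on \<phi> t" by (rule hex_cover_inj_triangle[OF K t(1)])
  note r = realize_triangle[OF t(1,2) inj]
  have nn: "0 \<le> realize \<phi> p v" for v unfolding realize_def by (rule sum_nonneg) (rule hat_nonneg)
  have sub: "{v. realize \<phi> p v \<noteq> 0} \<subseteq> \<phi> ` t" using r(2) by blast
  have "(\<Sum>v | realize \<phi> p v \<noteq> 0. realize \<phi> p v) = (\<Sum>v\<in>\<phi> ` t. realize \<phi> p v)"
    by (rule sum.mono_neutral_left) (use sub finite_triangle[OF t(1)] in auto)
  also have "\<dots> = (\<Sum>u\<in>t. realize \<phi> p (\<phi> u))" by (rule sum.reindex_cong[OF inj]) auto
  also have "\<dots> = (\<Sum>u\<in>t. hat (p - rl u))" by (rule sum.cong[OF refl r(1)])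
  finally have s: "(\<Sum>v | realize \<phi> p v \<noteq> 0. realize \<phi> p v) = 1" using t(3) by simp
  then have "{v. realize \<phi> p v \<noteq> 0} \<noteq> {}" by force
  then have "{v. realize \<phi> p v \<noteq> 0} \<in> generated_complex ((`) \<phi> ` lattice_triangles)"
    unfolding generated_complex_def using sub t(1) by blast
  then have "{v. realize \<phi> p v \<noteq> 0} \<in> K" using K unfolding hex_cover_def by simp
  then show ?thesis unfolding topspace_carrier using nn s by blast
qed

lemma realize_onto:
  assumes K: "hex_cover \<phi> K" and x: "x \<in> topspace (geometric_carrier K)"
  obtains p where "x = realize \<phi> p"
proof -
  have nn: "\<And>v. 0 \<le> x v" and s: "{v. x v \<noteq> 0} \<in> K" and sum: "(\<Sum>v | x v \<noteq> 0. x v) = 1"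
    using x unfolding topspace_carrier by blast+
  have "{v. x v \<noteq> 0} \<in> generated_complex ((`) \<phi> ` lattice_triangles)" using s K unfolding hex_cover_def by simp
  then obtain t where t: "t \<in> lattice_triangles" "{v. x v \<noteq> 0} \<subseteq> \<phi> ` t" unfolding generated_complex_def by blast
  have inj: "inj_on \<phi> t" by (rule hex_cover_inj_triangle[OF K t(1)])
  have "(\<Sum>u\<in>t. x (\<phi> u)) = (\<Sum>v\<in>\<phi> ` t. x v)" by (rule sum.reindex_cong[OF inj, symmetric]) auto
  also have "\<dots> = (\<Sum>v | x v \<noteq> 0. x v)"
    by (rule sum.mono_neutral_right) (use t finite_triangle[OF t(1)] in auto)
  finally have sum': "(\<Sum>u\<in>t. x (\<phi> u)) = 1" using sum by simp
  define p where "p = (\<Sum>u\<in>t. x (\<phi> u) *\<^sub>R rl u)"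
  have h: "hat (p - rl w) = (if w \<in> t then x (\<phi> w) else 0)" for w
    unfolding p_def by (rule triangle_coordinates[OF t(1) nn sum'])
  have h0: "supported t p" by (simp add: supported_def h)
  have "realize \<phi> p v = x v" for v
  proof (cases "v \<in> \<phi> ` t")
    case True
    then obtain u where u: "u \<in> t" "v = \<phi> u" by blast
    then show ?thesis using realize_triangle(1)[OF t(1) h0 inj u(1)] h by simp
  next
    case False
    then have "x v = 0" using t(2) by blast
    then show ?thesis using realize_triangle(2)[OF t(1) h0 inj False] by simp
  qed
  then show thesis using that[of p] by (simp add: fun_eq_iff)
qed

text \<open>Locally only lattice points from a bounded box contribute, so each coordinate is locally a
  finite sum of hat functions.\<close>
lemma realize_continuous:
  assumes K: "hex_cover \<phi> K"
  shows "continuous_map euclidean (geometric_carrier K) (realize \<phi>)"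
proof -
  have "continuous_on UNIV (\<lambda>p. realize \<phi> p v)" for v
  proof (rule continuous_at_imp_continuous_on, rule ballI)
    fix p0 :: "real \<times> real"
    define Z where "Z = {\<lfloor>fst p0\<rfloor> - 3..\<lfloor>fst p0\<rfloor> + 3} \<times> {\<lfloor>snd p0\<rfloor> - 3..\<lfloor>snd p0\<rfloor> + 3}"
    have Z: "supported Z p" if p: "p \<in> ball p0 1" for p
      unfolding supported_def
    proof (intro allI impI, rule ccontr)
      fix u assume u: "u \<notin> Z" and "hat (p - rl u) \<noteq> 0"
      then have "\<bar>fst p - fst u\<bar> < 1" "\<bar>snd p - snd u\<bar> < 1" by (auto simp: hat_def rl_def max_def split: if_splits)
      moreover have "\<bar>fst p0 - fst p\<bar> < 1" "\<bar>snd p0 - snd p\<bar> < 1"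
        using p dist_fst_le[of p0 p] dist_snd_le[of p0 p] by (simp_all add: dist_real_def)
      ultimately have "fst u \<in> {\<lfloor>fst p0\<rfloor> - 3..\<lfloor>fst p0\<rfloor> + 3}" "snd u \<in> {\<lfloor>snd p0\<rfloor> - 3..\<lfloor>snd p0\<rfloor> + 3}"
        unfolding atLeastAtMost_iff by linarith+
      then show False using u by (simp add: Z_def mem_Times_iff)
    qed
    have fin: "finite Z" by (simp add: Z_def)
    have "continuous_on (ball p0 1) (\<lambda>p. \<Sum>u | u \<in> Z \<and> \<phi> u = v. hat (p - rl u))"
      unfolding hat_def by (intro continuous_intros)
    then have "continuous_on (ball p0 1) (\<lambda>p. realize \<phi> p v)"
      by (rule continuous_on_eq) (rule realize_sum[OF fin Z, symmetric])
    then show "isCont (\<lambda>p. realize \<phi> p v) p0"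
      using continuous_on_eq_continuous_at[OF open_ball] by (metis centre_in_ball zero_less_one)
  qed
  then have "continuous_map euclidean (powertop_real UNIV) (realize \<phi>)"
    unfolding continuous_map_componentwise_UNIV by simp
  then show ?thesis unfolding geometric_carrier_def
    by (rule continuous_map_into_subtopology)
       (use realize_in_carrier[OF K] in \<open>auto simp: topspace_carrier\<close>)
qed

text \<open>A symmetry of the lattice together with its extension to the plane, expressed by the
  invariance of barycentric coordinates.\<close>
definition lattice_motion :: "(lat \<Rightarrow> lat) \<Rightarrow> (real \<times> real \<Rightarrow> real \<times> real) \<Rightarrow> bool" where
  "lattice_motion \<alpha> \<alpha>' \<longleftrightarrow> bij \<alpha> \<and> (\<forall>p u. hat (\<alpha>' p - rl (\<alpha> u)) = hat (p - rl u))"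

lemma realize_motion:
  assumes "lattice_motion \<alpha> \<alpha>'" "\<And>u. \<phi> (\<alpha> u) = \<phi> u"
  shows "realize \<phi> (\<alpha>' p) = realize \<phi> p"
proof
  fix v
  have bij: "bij \<alpha>" and h: "\<And>u. hat (\<alpha>' p - rl (\<alpha> u)) = hat (p - rl u)" using assms(1) by (auto simp: lattice_motion_def)
  have "\<alpha> ` {u. hat (p - rl u) \<noteq> 0 \<and> \<phi> u = v} = {u. hat (\<alpha>' p - rl u) \<noteq> 0 \<and> \<phi> u = v}"
  proof (intro subset_antisym subsetI)
    fix w assume w: "w \<in> {u. hat (\<alpha>' p - rl u) \<noteq> 0 \<and> \<phi> u = v}"
    obtain u where u: "w = \<alpha> u" using bij_is_surj[OF bij] by (elim surjE)
    show "w \<in> \<alpha> ` {u. hat (p - rl u) \<noteq> 0 \<and> \<phi> u = v}"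
      unfolding u by (rule imageI) (use w h assms(2) u in simp)
  qed (use h assms(2) in auto)
  moreover have "inj_on \<alpha> {u. hat (p - rl u) \<noteq> 0 \<and> \<phi> u = v}" using bij bij_is_inj inj_on_subset by blast
  ultimately show "realize \<phi> (\<alpha>' p) v = realize \<phi> p v"
    unfolding realize_def by (intro sum.reindex_cong[of \<alpha>]) (simp_all add: h)
qed

text \<open>Points of an open vertex star are determined by their coordinates at the points of the star,
  and these are visible in the image because \<open>\<phi>\<close> is injective on the star.\<close>
lemma realize_inj_star:
  assumes inj: "inj_on \<phi> (star w)" and p: "hat (p - rl w) \<noteq> 0" and q: "hat (q - rl w) \<noteq> 0"
    and eq: "realize \<phi> p = realize \<phi> q"
  shows "p = q"
proof -
  have val: "(\<forall>u\<in>star w. realize \<phi> p (\<phi> u) = hat (p - rl u)) \<and> (\<Sum>u\<in>star w. hat (p - rl u) *\<^sub>R rl u) = p"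
    if p: "hat (p - rl w) \<noteq> 0" for p
  proof -
    obtain t where t: "t \<in> lattice_triangles" "supported t p"
      "(\<Sum>u\<in>t. hat (p - rl u)) = 1" "(\<Sum>u\<in>t. hat (p - rl u) *\<^sub>R rl u) = p" by (rule barycentric[of p])
    have "w \<in> t" using supportedD[OF t(2)] p by blast
    then have sub: "t \<subseteq> star w" using triangle_subset_star t(1) by blast
    then have injt: "inj_on \<phi> t" using inj inj_on_subset by blast
    have "realize \<phi> p (\<phi> u) = hat (p - rl u)" if u: "u \<in> star w" for u
    proof (cases "u \<in> t")
      case True then show ?thesis by (rule realize_triangle(1)[OF t(1,2) injt])
    next
      case False
      then have "\<phi> u \<notin> \<phi> ` t" using inj_on_image_mem_iff[OF inj u sub] by blast
      then show ?thesis using realize_triangle(2)[OF t(1,2) injt] supportedD[OF t(2) False] by simp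
    qed
    moreover have "(\<Sum>u\<in>star w. hat (p - rl u) *\<^sub>R rl u) = (\<Sum>u\<in>t. hat (p - rl u) *\<^sub>R rl u)"
      by (rule sum.mono_neutral_right) (use sub supportedD[OF t(2)] in \<open>auto simp: star_def\<close>)
    ultimately show ?thesis using t(4) by simp
  qed
  have "hat (p - rl u) = hat (q - rl u)" if "u \<in> star w" for u using val[OF p] val[OF q] that eq by metis
  then have "(\<Sum>u\<in>star w. hat (p - rl u) *\<^sub>R rl u) = (\<Sum>u\<in>star w. hat (q - rl u) *\<^sub>R rl u)" by (intro sum.cong) simp_all
  then show ?thesis using val[OF p] val[OF q] by simp
qed

text \<open>Points with the same image have positive coordinates at two lattice points \<open>z\<close>
  and \<open>w\<close> over one vertex. A deck transformation taking \<open>z\<close> to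
  \<open>w\<close> moves the first point into the star of \<open>w\<close>, where
  \<open>realize_inj_star\<close> applies.\<close>
lemma realize_eqD:
  assumes K: "hex_cover \<phi> K" and eq: "realize \<phi> p = realize \<phi> q"
  obtains z w where "\<phi> z = \<phi> w"
    "\<forall>\<alpha> \<alpha>'. lattice_motion \<alpha> \<alpha>' \<longrightarrow> (\<forall>u. \<phi> (\<alpha> u) = \<phi> u) \<longrightarrow> \<alpha> z = w \<longrightarrow> q = \<alpha>' p"
proof -
  obtain t where t: "t \<in> lattice_triangles" "supported t p"
    "(\<Sum>u\<in>t. hat (p - rl u)) = 1" "(\<Sum>u\<in>t. hat (p - rl u) *\<^sub>R rl u) = p" by (rule barycentric[of p])
  have "\<exists>z\<in>t. hat (p - rl z) \<noteq> 0" using t(3) sum.neutral[of t "\<lambda>u. hat (p - rl u)"] by fastforce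
  then obtain z where z: "z \<in> t" "hat (p - rl z) \<noteq> 0" by blast
  have "realize \<phi> q (\<phi> z) \<noteq> 0"
    using realize_triangle(1)[OF t(1,2) hex_cover_inj_triangle[OF K t(1)] z(1)] z(2) eq by simp
  then obtain w where w: "hat (q - rl w) \<noteq> 0" "\<phi> w = \<phi> z"
    unfolding realize_def by (elim sum.not_neutral_contains_not_neutral) auto
  show thesis
  proof (rule that[of z w], goal_cases)
    case 2
    show ?case
    proof (intro allI impI)
    fix \<alpha> \<alpha>' assume a: "lattice_motion \<alpha> \<alpha>'" "\<forall>u. \<phi> (\<alpha> u) = \<phi> u" "\<alpha> z = w"
    have "realize \<phi> (\<alpha>' p) = realize \<phi> q" using realize_motion[of \<alpha> \<alpha>' \<phi> p] a eq by simp
    moreover have "hat (\<alpha>' p - rl w) \<noteq> 0" using a(1,3) z(2) by (auto simp: lattice_motion_def)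
    moreover have "inj_on \<phi> (star w)" using K by (simp add: hex_cover_def)
    ultimately show "q = \<alpha>' p" using realize_inj_star[of \<phi> w q "\<alpha>' p"] w(1) by simp
    qed
  qed (use w in simp)
qed

lemma Hausdorff_carrier: "Hausdorff_space (geometric_carrier K)"
  unfolding geometric_carrier_def
  by (intro Hausdorff_space_subtopology) (simp add: Hausdorff_space_product_topology)

lemma translation_motion: "lattice_motion (\<lambda>u. u + t) (\<lambda>p. p + rl t)"
  unfolding lattice_motion_def
proof (intro conjI allI)
  show "bij (\<lambda>u. u + t)" by (intro bij_betw_byWitness[where f' = "\<lambda>u. u - t"] ballI subset_UNIV)
    (rule add_diff_cancel_right' diff_add_cancel)+
qed (simp add: rl_add)

definition real_reflection :: "bool \<Rightarrow> real \<times> real \<Rightarrow> real \<times> real" where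
  "real_reflection s p = (if s then (snd p, fst p) else (snd p - fst p, snd p))"

text \<open>The barycentric coordinates are invariant under the reflection because \<open>hat\<close> is
  symmetric in \<open>x\<close>, \<open>y\<close> and \<open>x - y\<close> up to signs.\<close>
lemma glide_motion: "lattice_motion (\<lambda>u. axis_reflection s u + t) (\<lambda>p. real_reflection s p + rl t)"
  unfolding lattice_motion_def
proof (intro conjI allI)
  show "bij (\<lambda>u. axis_reflection s u + t)"
    by (rule bij_betw_byWitness[where f' = "\<lambda>u. axis_reflection s (u - t)"]) (auto simp: axis_reflection_def prod_eq_iff)
  fix p u
  have "real_reflection s p + rl t - rl (axis_reflection s u + t) = real_reflection s (p - rl u)"
    by (simp add: rl_add real_reflection_def axis_reflection_def rl_def prod_eq_iff)
  moreover have "hat (real_reflection s d) = hat d" for d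
    by (simp add: hat_def real_reflection_def abs_minus_commute max.commute max.left_commute)
  ultimately show "hat (real_reflection s p + rl t - rl (axis_reflection s u + t)) = hat (p - rl u)" by simp
qed

text \<open>In coordinates with respect to the basis \<open>(a,0)\<close>, \<open>(b,c)\<close> the period
  lattice becomes \<open>\<int>\<^sup>2\<close>.\<close>
lemma torus_model_quotient:
  assumes "torus_model X a b c"
  obtains \<Psi> where "plane_quotient (geometric_carrier X) \<Psi> torus_action"
proof -
  obtain \<phi> where ac: "0 < a" "0 < c" and K: "hex_cover \<phi> X" and ker: "\<And>z w. \<phi> z = \<phi> w \<longleftrightarrow> tred a b c z = tred a b c w"
    using assms unfolding torus_model_def by blast
  define L where "L p = (fst p * a + snd p * b, snd p * c)" for p :: "real \<times> real"
  have L_eq: "L p = L q \<longleftrightarrow> p = q" for p q using ac by (auto simp: L_def prod_eq_iff)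
  define \<Psi> where "\<Psi> p = realize \<phi> (L p)" for p
  have shift: "L p + rl (i * a + j * b, j * c) = L (fst p + of_int i, snd p + of_int j)" for p i j
    by (simp add: L_def rl_def algebra_simps)
  have per: "\<phi> (u + (i * a + j * b, j * c)) = \<phi> u" for u i j
    unfolding ker tred_eq_iff[OF ac(2)] tlat_iff[OF ac(2)] by (intro exI[of _ i] exI[of _ j]) simp
  have fibre: "\<Psi> p = \<Psi> q \<longleftrightarrow> (\<exists>g\<in>torus_action. q = g p)" for p q
    unfolding torus_action_iff
  proof
    assume "\<Psi> p = \<Psi> q"
    then have "realize \<phi> (L p) = realize \<phi> (L q)" by (simp add: \<Psi>_def)
    then obtain z w where zw: "\<phi> z = \<phi> w"
      "\<forall>\<alpha> \<alpha>'. lattice_motion \<alpha> \<alpha>' \<longrightarrow> (\<forall>u. \<phi> (\<alpha> u) = \<phi> u) \<longrightarrow> \<alpha> z = w \<longrightarrow> L q = \<alpha>' (L p)"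
      by (rule realize_eqD[OF K])
    have "tlat a b c (w - z)" using zw(1)[symmetric] unfolding ker tred_eq_iff[OF ac(2)] .
    then obtain i j where "w - z = (i * a + j * b, j * c)" unfolding tlat_iff[OF ac(2)] by blast
    then have "z + (i * a + j * b, j * c) = w" by (metis add.commute diff_add_cancel)
    from zw(2)[rule_format, OF translation_motion per this] have "L q = L (fst p + of_int i, snd p + of_int j)" unfolding shift .
    then have "q = (fst p + of_int i, snd p + of_int j)" unfolding L_eq .
    then show "\<exists>i j::int. q = (fst p + of_int i, snd p + of_int j)" by blast
  next
    assume "\<exists>i j::int. q = (fst p + of_int i, snd p + of_int j)"
    then obtain i j :: int where "q = (fst p + of_int i, snd p + of_int j)" by blast
    then have "L q = L p + rl (i * a + j * b, j * c)" unfolding shift by simp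
    then show "\<Psi> p = \<Psi> q" unfolding \<Psi>_def using realize_motion[of _ _ \<phi>, OF translation_motion per] by simp
  qed
  have "continuous_on UNIV L" unfolding L_def by (intro continuous_intros)
  then have c: "continuous_map euclidean euclidean L" by simp
  then have cont: "continuous_map euclidean (geometric_carrier X) \<Psi>"
    using continuous_map_compose[OF c realize_continuous[OF K]] by (simp add: \<Psi>_def[abs_def] o_def)
  have onto: "\<Psi> ` unit_square = topspace (geometric_carrier X)"
  proof (intro subset_antisym subsetI)
    fix x assume "x \<in> topspace (geometric_carrier X)"
    then obtain p where p: "x = realize \<phi> p" by (rule realize_onto[OF K])
    define t where "t = snd p / c"
    define s where "s = (fst p - t * b) / a"
    have "L (s, t) = p" using ac by (simp add: L_def s_def t_def prod_eq_iff)
    then have "x = \<Psi> (s, t)" using p by (simp add: \<Psi>_def)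
    also have "\<Psi> (s, t) = \<Psi> (frac s, frac t)"
      unfolding fibre torus_action_iff by (intro exI[of _ "- \<lfloor>s\<rfloor>"] exI[of _ "- \<lfloor>t\<rfloor>"]) (simp add: frac_def)
    finally show "x \<in> \<Psi> ` unit_square"
      by (rule image_eqI) (simp add: unit_square_def less_imp_le[OF frac_lt_1])
  qed (elim imageE, simp only: \<Psi>_def, rule realize_in_carrier[OF K])
  show thesis by (rule that[OF torus_plane_quotient[OF cont onto Hausdorff_carrier fibre]])
qed

definition real_unframe :: "bool \<Rightarrow> real \<times> real \<Rightarrow> real \<times> real" where
  "real_unframe s p = (if s then (fst p, snd p - fst p) else p)"

text \<open>The deck group becomes the standard group in the coordinates \<open>u\<close>,
  \<open>v\<close> with \<open>y = m v\<close> and \<open>x = a u - m/4 + m v/2\<close>: the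
  term \<open>m v/2\<close> straightens the axis of the glide reflection, which has slope 2, and
  the shift by \<open>m/4\<close> puts it at \<open>u = 0\<close>.\<close>
lemma klein_model_quotient:
  assumes "klein_model X s a m"
  obtains \<Psi> where "plane_quotient (geometric_carrier X) \<Psi> klein_action"
proof -
  obtain \<phi> where am: "0 < a" "0 < m" and K: "hex_cover \<phi> X"
    and ker: "\<And>z w. \<phi> z = \<phi> w \<longleftrightarrow> kred a m (frame s z) = kred a m (frame s w)"
    using assms unfolding klein_model_def by blast
  define L where "L p = real_unframe s (a * fst p - m / 4 + m * snd p / 2, m * snd p)" for p :: "real \<times> real"
  have ue: "real_unframe s p = real_unframe s q \<longleftrightarrow> p = q" for p q by (auto simp: real_unframe_def prod_eq_iff)
  have L_eq: "L p = L q \<longleftrightarrow> p = q" for p q using am unfolding L_def ue by (auto simp: prod_eq_iff)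
  define \<Psi> where "\<Psi> p = realize \<phi> (L p)" for p
  define T where "T i j = unframe s (j * m + i * a, 2 * j * m)" for i j
  define U where "U i j = unframe s (j * m + i * a, m + 2 * j * m)" for i j
  have shift: "L p + rl (T i j) = L (fst p + of_int i, snd p + 2 * of_int j)" for p i j
    by (simp add: L_def T_def rl_def real_unframe_def unframe_def prod_eq_iff field_simps)
  have flip: "real_reflection s (L p) + rl (U i j) = L (of_int i - fst p, snd p + 1 + 2 * of_int j)" for p i j
    by (simp add: L_def U_def rl_def real_unframe_def unframe_def real_reflection_def prod_eq_iff field_simps)
  have perT: "\<phi> (u + T i j) = \<phi> u" for u i j
  proof -
    have "krel a m (frame s u) (frame s (u + T i j))"
      unfolding krel_def frame_add T_def frame_unframe by blast
    then show ?thesis unfolding ker kred_eq_iff[OF am(2), symmetric] by (rule sym)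
  qed
  have perU: "\<phi> (axis_reflection s u + U i j) = \<phi> u" for u i j
  proof -
    have "krel a m (frame s u) (frame s (axis_reflection s u + U i j))"
      unfolding krel_def frame_add U_def frame_unframe frame_axis_reflection by blast
    then show ?thesis unfolding ker kred_eq_iff[OF am(2), symmetric] by (rule sym)
  qed
  have fibre: "\<Psi> p = \<Psi> q \<longleftrightarrow> (\<exists>g\<in>klein_action. q = g p)" for p q
    unfolding klein_action_iff
  proof
    assume "\<Psi> p = \<Psi> q"
    then have "realize \<phi> (L p) = realize \<phi> (L q)" by (simp add: \<Psi>_def)
    then obtain z w where zw: "\<phi> z = \<phi> w"
      "\<forall>\<alpha> \<alpha>'. lattice_motion \<alpha> \<alpha>' \<longrightarrow> (\<forall>u. \<phi> (\<alpha> u) = \<phi> u) \<longrightarrow> \<alpha> z = w \<longrightarrow> L q = \<alpha>' (L p)"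
      by (rule realize_eqD[OF K])
    obtain i j where "frame s w = frame s z + (j * m + i * a, 2 * j * m) \<or> frame s w = kflip (frame s z) + (j * m + i * a, m + 2 * j * m)"
      using zw(1) unfolding ker kred_eq_iff[OF am(2)] krel_def by blast
    then show "\<exists>i j::int. q = (fst p + of_int i, snd p + 2 * of_int j) \<or> q = (of_int i - fst p, snd p + 1 + 2 * of_int j)"
    proof
      assume "frame s w = frame s z + (j * m + i * a, 2 * j * m)"
      then have "frame s w = frame s (z + T i j)" by (simp only: frame_add T_def frame_unframe)
      then have "z + T i j = w" by (metis frame_unframe(2))
      from zw(2)[rule_format, OF translation_motion perT this] have "L q = L (fst p + of_int i, snd p + 2 * of_int j)" unfolding shift .
      then show ?thesis unfolding L_eq by blast
    next
      assume "frame s w = kflip (frame s z) + (j * m + i * a, m + 2 * j * m)"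
      then have "frame s w = frame s (axis_reflection s z + U i j)"
        by (simp only: frame_add U_def frame_unframe frame_axis_reflection)
      then have "axis_reflection s z + U i j = w" by (metis frame_unframe(2))
      from zw(2)[rule_format, OF glide_motion perU this] have "L q = L (of_int i - fst p, snd p + 1 + 2 * of_int j)" unfolding flip .
      then show ?thesis unfolding L_eq by blast
    qed
  next
    assume "\<exists>i j::int. q = (fst p + of_int i, snd p + 2 * of_int j) \<or> q = (of_int i - fst p, snd p + 1 + 2 * of_int j)"
    then obtain i j :: int where "q = (fst p + of_int i, snd p + 2 * of_int j) \<or> q = (of_int i - fst p, snd p + 1 + 2 * of_int j)" by blast
    then show "\<Psi> p = \<Psi> q"
    proof
      assume "q = (fst p + of_int i, snd p + 2 * of_int j)"
      then have "L q = L p + rl (T i j)" unfolding shift by simp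
      then show ?thesis unfolding \<Psi>_def using realize_motion[of _ _ \<phi>, OF translation_motion perT] by simp
    next
      assume "q = (of_int i - fst p, snd p + 1 + 2 * of_int j)"
      then have "L q = real_reflection s (L p) + rl (U i j)" unfolding flip by simp
      then show ?thesis unfolding \<Psi>_def using realize_motion[of _ _ \<phi>, OF glide_motion perU] by simp
    qed
  qed
  have "continuous_on UNIV L" unfolding L_def real_unframe_def
    by (cases s) (auto intro!: continuous_intros)
  then have c: "continuous_map euclidean euclidean L" by simp
  then have cont: "continuous_map euclidean (geometric_carrier X) \<Psi>"
    using continuous_map_compose[OF c realize_continuous[OF K]] by (simp add: \<Psi>_def[abs_def] o_def)
  have onto: "\<Psi> ` unit_square = topspace (geometric_carrier X)"
  proof (intro subset_antisym subsetI)
    fix x assume "x \<in> topspace (geometric_carrier X)"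
    then obtain p where p: "x = realize \<phi> p" by (rule realize_onto[OF K])
    define p' where "p' = (if s then (fst p, snd p + fst p) else p)"
    define v where "v = snd p' / m"
    define u where "u = (fst p' + m / 4 - m * v / 2) / a"
    have e: "(a * u - m / 4 + m * v / 2, m * v) = p'" using am by (simp add: u_def v_def prod_eq_iff)
    have "L (u, v) = real_unframe s p'" unfolding L_def fst_conv snd_conv e ..
    also have "\<dots> = p" by (simp add: real_unframe_def p'_def prod_eq_iff)
    finally have "L (u, v) = p" .
    then have x: "x = \<Psi> (u, v)" using p by (simp add: \<Psi>_def)
    have in_sq: "(frac r, frac v) \<in> unit_square" for r by (simp add: unit_square_def less_imp_le[OF frac_lt_1])
    show "x \<in> \<Psi> ` unit_square"
    proof (cases "even \<lfloor>v\<rfloor>")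
      case True
      then obtain k where k: "\<lfloor>v\<rfloor> = 2 * k" by (elim evenE)
      have "\<Psi> (u, v) = \<Psi> (frac u, frac v)"
        unfolding fibre klein_action_iff by (intro exI[of _ "- \<lfloor>u\<rfloor>"] exI[of _ "- k"] disjI1) (simp add: frac_def k)
      then show ?thesis using x in_sq by blast
    next
      case False
      then obtain k where k: "\<lfloor>v\<rfloor> = 2 * k + 1" by (elim oddE)
      have "\<Psi> (u, v) = \<Psi> (frac (- u), frac v)"
        unfolding fibre klein_action_iff by (intro exI[of _ "- \<lfloor>- u\<rfloor>"] exI[of _ "- k - 1"] disjI2) (simp add: frac_def k)
      then show ?thesis using x in_sq by blast
    qed
  qed (elim imageE, simp only: \<Psi>_def, rule realize_in_carrier[OF K])
  show thesis by (rule that[OF klein_plane_quotient[OF cont onto Hausdorff_carrier fibre]])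
qed



section \<open>Local structure of triangulated surfaces\<close>

text \<open>Charts with values in \<open>\<real> \<times> \<real>\<close>.\<close>
lemma surface_chart:
  assumes "closed_surface X" "x \<in> topspace X"
  obtains U W h k where "openin X U" "x \<in> U" "open (W :: (real \<times> real) set)"
    "homeomorphic_maps (subtopology X U) (top_of_set W) h k"
proof -
  obtain U W0 where U: "openin X U" "x \<in> U" "openin (Euclidean_space 2) W0"
    "subtopology X U homeomorphic_space subtopology (Euclidean_space 2) W0"
    using assms unfolding closed_surface_def by blast
  define W where "W = plane_point -` W0"
  have sur: "range plane_point = topspace (Euclidean_space 2)"
    using homeomorphic_imp_surjective_map[OF plane_homeomorphic] by simp
  then have im: "plane_point ` W = W0" using openin_subset[OF U(3)] unfolding W_def by auto
  have "continuous_map euclidean (Euclidean_space 2) plane_point"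
    using plane_homeomorphic homeomorphic_imp_continuous_map by blast
  then have "openin euclidean {p \<in> topspace euclidean. plane_point p \<in> W0}" using U(3) by (rule openin_continuous_map_preimage)
  then have W: "open W" by (simp add: W_def vimage_def)
  have "subtopology X U homeomorphic_space top_of_set W"
    using plane_open_chart(2)[OF W] U(4) unfolding im by (metis homeomorphic_space_sym homeomorphic_space_trans)
  then show thesis using that U(1,2) W unfolding homeomorphic_space_def by blast
qed

text \<open>Brouwer's theorem, transported through charts.\<close>
lemma surface_invariance_of_domain:
  assumes X: "closed_surface X" and S: "open (S :: (real \<times> real) set)"
    and f: "continuous_map (top_of_set S) X f" and inj: "inj_on f S"
  shows "openin X (f ` S)"
proof (subst openin_subopen, rule ballI)
  fix y assume "y \<in> f ` S"
  then obtain p where p: "p \<in> S" "y = f p" by blast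
  have "y \<in> topspace X" using f p by (auto simp: continuous_map_def)
  then obtain U W h k where U: "openin X U" "y \<in> U" "open (W :: (real \<times> real) set)"
    "homeomorphic_maps (subtopology X U) (top_of_set W) h k" by (rule surface_chart[OF X])
  define S' where "S' = {q \<in> S. f q \<in> U}"
  have "openin (top_of_set S) {q \<in> topspace (top_of_set S). f q \<in> U}"
    using openin_continuous_map_preimage[OF f U(1)] .
  then have S': "open S'" using S by (simp add: S'_def openin_open_eq)
  have UX: "U \<subseteq> topspace X" using U(1) by (rule openin_subset)
  have h: "continuous_map (subtopology X U) (top_of_set W) h" and k: "continuous_map (top_of_set W) (subtopology X U) k"
    and kh: "\<And>x. x \<in> U \<Longrightarrow> k (h x) = x" and hk: "\<And>w. w \<in> W \<Longrightarrow> h (k w) = w"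
    using U(4) UX unfolding homeomorphic_maps_def by auto
  have "continuous_map (top_of_set S') (subtopology X U) f"
  proof (rule continuous_map_into_subtopology)
    show "continuous_map (top_of_set S') X f"
      by (rule continuous_map_from_subtopology_mono[OF f]) (auto simp: S'_def)
  qed (auto simp: S'_def)
  then have hf: "continuous_map (top_of_set S') (top_of_set W) (h \<circ> f)" using h by (rule continuous_map_compose)
  then have "continuous_on S' (h \<circ> f)" by (simp add: continuous_map_in_subtopology)
  moreover have "inj_on (h \<circ> f) S'"
  proof (rule inj_onI)
    fix u v assume uv: "u \<in> S'" "v \<in> S'" "(h \<circ> f) u = (h \<circ> f) v"
    have U': "f u \<in> U" "f v \<in> U" "u \<in> S" "v \<in> S" using uv(1,2) unfolding S'_def by blast+
    have "k (h (f u)) = k (h (f v))" using uv(3) by simp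
    then have "f u = f v" unfolding kh[OF U'(1)] kh[OF U'(2)] .
    then show "u = v" using U'(3,4) by (rule inj_onD[OF inj])
  qed
  ultimately have O: "open ((h \<circ> f) ` S')" using S' by (intro invariance_of_domain) auto
  have sub: "(h \<circ> f) ` S' \<subseteq> W" using hf by (auto simp: continuous_map_def)
  have "f ` S' = {x \<in> topspace (subtopology X U). h x \<in> (h \<circ> f) ` S'}"
  proof (intro subset_antisym subsetI)
    fix x assume "x \<in> {x \<in> topspace (subtopology X U). h x \<in> (h \<circ> f) ` S'}"
    then obtain q where "x \<in> U" "q \<in> S'" "h x = h (f q)" by auto
    moreover have "f q \<in> U" using \<open>q \<in> S'\<close> unfolding S'_def by blast
    ultimately have "x = f q" using kh[of x] kh[of "f q"] by metis
    then show "x \<in> f ` S'" using \<open>q \<in> S'\<close> by blast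
  qed (use UX in \<open>auto simp: S'_def\<close>)
  moreover have "openin (top_of_set W) ((h \<circ> f) ` S')" using O sub by (simp add: open_subset)
  ultimately have "openin (subtopology X U) (f ` S')" using openin_continuous_map_preimage[OF h] by simp
  then have "openin X (f ` S')" using openin_open_subtopology[OF U(1)] by blast
  moreover have "y \<in> f ` S'" "f ` S' \<subseteq> f ` S" using p U(2) by (auto simp: S'_def)
  ultimately show "\<exists>T. openin X T \<and> y \<in> T \<and> T \<subseteq> f ` S" by blast
qed

text \<open>A converse: a subset of the plane that is homeomorphic, with an inverse extending to the whole
  surface, to an open part of the surface is open in the plane. Used to show that a surface has
  no boundary and no part of lower dimension.\<close>
lemma surface_plane_piece_open:
  assumes X: "closed_surface X" and f: "continuous_map (top_of_set S) X f" and g: "continuous_map X euclidean g"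
    and gf: "\<And>p. p \<in> S \<Longrightarrow> g (f p) = p" and O: "openin X (f ` S)"
  shows "open (S :: (real \<times> real) set)"
proof (subst open_subopen, rule ballI)
  fix p assume p: "p \<in> S"
  have fX: "f ` S \<subseteq> topspace X" using O by (rule openin_subset)
  then have fp: "f p \<in> topspace X" using p by blast
  obtain U W h k where U: "openin X U" "f p \<in> U" "open (W :: (real \<times> real) set)"
    "homeomorphic_maps (subtopology X U) (top_of_set W) h k" by (rule surface_chart[OF X fp])
  have UX: "U \<subseteq> topspace X" using U(1) by (rule openin_subset)
  have h: "continuous_map (subtopology X U) (top_of_set W) h" and k: "continuous_map (top_of_set W) (subtopology X U) k"
    and kh: "\<And>x. x \<in> U \<Longrightarrow> k (h x) = x" and hk: "\<And>w. w \<in> W \<Longrightarrow> h (k w) = w"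
    using U(4) UX unfolding homeomorphic_maps_def by auto
  define W' where "W' = {w \<in> W. k w \<in> f ` S}"
  have "openin (subtopology X U) (U \<inter> f ` S)" using O by (simp add: openin_subtopology_Int2)
  then have "openin (top_of_set W) {w \<in> topspace (top_of_set W). k w \<in> U \<inter> f ` S}"
    by (rule openin_continuous_map_preimage[OF k])
  moreover have "{w \<in> topspace (top_of_set W). k w \<in> U \<inter> f ` S} = W'"
    using k by (auto simp: W'_def continuous_map_def)
  ultimately have W': "open W'" using U(3) by (simp add: openin_open_eq)
  have "continuous_map (top_of_set W') X k"
    using continuous_map_from_subtopology_mono[OF continuous_map_into_fulltopology[OF k], of W'] by (auto simp: W'_def)
  then have "continuous_map (top_of_set W') euclidean (g \<circ> k)" using g by (rule continuous_map_compose)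
  then have "continuous_on W' (g \<circ> k)" by simp
  moreover have "inj_on (g \<circ> k) W'"
  proof (rule inj_onI)
    fix u v assume uv: "u \<in> W'" "v \<in> W'" "(g \<circ> k) u = (g \<circ> k) v"
    then obtain q r where "q \<in> S" "r \<in> S" "k u = f q" "k v = f r" by (auto simp: W'_def)
    then have "k u = k v" using uv(3) gf[of q] gf[of r] by simp
    then have "h (k u) = h (k v)" by simp
    moreover have "u \<in> W" "v \<in> W" using uv(1,2) unfolding W'_def by blast+
    ultimately show "u = v" using hk[of u] hk[of v] by simp
  qed
  ultimately have "open ((g \<circ> k) ` W')" using W' by (intro invariance_of_domain) auto
  moreover have "(g \<circ> k) ` W' \<subseteq> S" using gf by (auto simp: W'_def)
  moreover have "h (f p) \<in> W'" using h U(2) UX kh[OF U(2)] p by (auto simp: W'_def continuous_map_def)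
  then have "p \<in> (g \<circ> k) ` W'" using kh[OF U(2)] gf[OF p] by (intro image_eqI[of _ _ "h (f p)"]) simp_all
  ultimately show "\<exists>T. open T \<and> p \<in> T \<and> T \<subseteq> S" by blast
qed

locale triangulated_surface =
  fixes K :: "'a set set"
  assumes complex: "abstract_complex K" and dim2: "two_dimensional K"
    and surface: "closed_surface (geometric_carrier K)"
begin

abbreviation X where "X \<equiv> geometric_carrier K"

lemma topX: "x \<in> topspace X \<longleftrightarrow> (\<forall>v. 0 \<le> x v) \<and> {v. x v \<noteq> 0} \<in> K \<and> (\<Sum>v | x v \<noteq> 0. x v) = 1"
  by (simp add: geometric_carrier_def)

lemma face_finite: "s \<in> K \<Longrightarrow> finite s" and face_nonempty: "s \<in> K \<Longrightarrow> s \<noteq> {}"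
  and face_sub: "s \<in> K \<Longrightarrow> t \<subseteq> s \<Longrightarrow> t \<noteq> {} \<Longrightarrow> t \<in> K"
  using complex unfolding abstract_complex_def by blast+

lemma face_card: "s \<in> K \<Longrightarrow> card s \<le> 3"
  using dim2 unfolding two_dimensional_def by blast

lemma carrierI:
  assumes "t \<in> K" "\<And>v. 0 \<le> x v" "\<And>v. v \<notin> t \<Longrightarrow> x v = 0" "(\<Sum>v\<in>t. x v) = 1"
  shows "x \<in> topspace X"
proof -
  have sub: "{v. x v \<noteq> 0} \<subseteq> t" using assms(3) by blast
  have s: "(\<Sum>v | x v \<noteq> 0. x v) = 1"
    using sum.mono_neutral_left[OF face_finite[OF assms(1)] sub, of x] assms(4) by simp
  then have "{v. x v \<noteq> 0} \<noteq> {}" by (metis sum.empty zero_neq_one)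
  then show ?thesis unfolding topX using s assms(2) face_sub[OF assms(1) sub] by blast
qed

lemma coordinate_continuous: "continuous_map X euclideanreal (\<lambda>x. x v)"
  unfolding geometric_carrier_def
  by (rule continuous_map_from_subtopology)
     (use continuous_map_product_projection[of v UNIV "\<lambda>_. euclideanreal"] in simp)

lemma continuous_into:
  assumes "\<And>p. p \<in> S \<Longrightarrow> f p \<in> topspace X" "\<And>v. continuous_on S (\<lambda>p. f p v)"
  shows "continuous_map (top_of_set S) X f"
  unfolding geometric_carrier_def
proof (rule continuous_map_into_subtopology)
  show "continuous_map (top_of_set S) (powertop_real UNIV) f"
    unfolding continuous_map_componentwise_UNIV using assms(2) by simp
  show "f \<in> topspace (top_of_set S) \<rightarrow> {x. (\<forall>v. 0 \<le> x v) \<and> {v. x v \<noteq> 0} \<in> K \<and> (\<Sum>v | x v \<noteq> 0. x v) = 1}"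
    using assms(1) unfolding topX by auto
qed

text \<open>Open stars of simplices are given by strict inequalities for finitely many coordinates.\<close>
lemma open_star:
  assumes "finite s" shows "openin X {x \<in> topspace X. \<forall>v\<in>s. 0 < x v}"
proof -
  have "openin X {x \<in> topspace X. x v \<in> {0<..}}" for v
    by (rule openin_continuous_map_preimage[OF coordinate_continuous]) simp
  then have o: "openin X {x \<in> topspace X. 0 < x v}" for v by simp
  show ?thesis using assms
  proof (induction s)
    case (insert v s)
    have "{x \<in> topspace X. \<forall>w\<in>insert v s. 0 < x w} = {x \<in> topspace X. 0 < x v} \<inter> {x \<in> topspace X. \<forall>w\<in>s. 0 < x w}" by auto
    then show ?case using openin_Int[OF o insert.IH] by simp
  qed simp
qed

text \<open>Here the piece is the open star of the simplex \<open>s\<close>, and the inverse consists of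
  two coordinates, scaled by \<open>c\<close> and \<open>d\<close>. A scaling factor 0 describes
  pieces that are contained in a line or are a single point.\<close>
lemma piece_open:
  assumes S: "\<And>p. p \<in> S \<Longrightarrow> f p \<in> topspace X" "\<And>v. continuous_on S (\<lambda>p. f p v)"
    and gf: "\<And>p. p \<in> S \<Longrightarrow> (c * f p a, d * f p b) = p"
    and im: "finite s" "f ` S = {x \<in> topspace X. \<forall>v\<in>s. 0 < x v}"
  shows "open (S :: (real \<times> real) set)"
proof (rule surface_plane_piece_open[OF surface continuous_into[OF S]])
  have "continuous_map X (prod_topology euclideanreal euclideanreal) (\<lambda>x. (c * x a, d * x b))"
    by (intro continuous_map_pairedI continuous_map_real_mult_left coordinate_continuous)
  then show "continuous_map X euclidean (\<lambda>x. (c * x a, d * x b))" by simp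
  show "openin X (f ` S)" unfolding im(2) by (rule open_star[OF im(1)])
qed (use gf in auto)

text \<open>An embedded open disc is open in the surface. So no segment inside the surface can leave the
  disc at an interior point; here a segment starts at the point of the disc with parameter
  \<open>p0\<close> and runs towards a vertex \<open>y\<close> outside it.\<close>
lemma no_branch:
  assumes S: "open (S :: (real \<times> real) set)" and f: "\<And>p. p \<in> S \<Longrightarrow> f p \<in> topspace X" "\<And>v. continuous_on S (\<lambda>p. f p v)"
    and inj: "inj_on f S" and p0: "p0 \<in> S" and y: "\<And>p. p \<in> S \<Longrightarrow> f p y = 0"
    and br: "\<And>e. 0 \<le> e \<Longrightarrow> e < 1 \<Longrightarrow> (\<lambda>v. (1 - e) * f p0 v + (if v = y then e else 0)) \<in> topspace X"
  shows False
proof -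
  have O: "openin X (f ` S)" by (rule surface_invariance_of_domain[OF surface S continuous_into[OF f] inj])
  define \<gamma> where "\<gamma> e = (\<lambda>v. (1 - e) * f p0 v + (if v = y then e else 0))" for e
  have "continuous_on {0..<1} (\<lambda>e. \<gamma> e v)" for v
    unfolding \<gamma>_def by (cases "v = y") (auto intro!: continuous_intros)
  then have "continuous_map (top_of_set {0..<1}) X \<gamma>"
    by (intro continuous_into) (use br in \<open>auto simp: \<gamma>_def\<close>)
  then have "openin (top_of_set {0..<1}) {e \<in> topspace (top_of_set {0..<1}). \<gamma> e \<in> f ` S}"
    using O by (rule openin_continuous_map_preimage)
  then have op: "openin (top_of_set {0..<1}) {e \<in> {0..<1}. \<gamma> e \<in> f ` S}" by simp
  have "\<gamma> 0 = f p0" by (simp add: \<gamma>_def fun_eq_iff)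
  then have "0 \<in> {e \<in> {0..<1}. \<gamma> e \<in> f ` S}" using p0 by simp
  then obtain r where r: "0 < r" "ball 0 r \<inter> {0..<1} \<subseteq> {e \<in> {0..<1}. \<gamma> e \<in> f ` S}"
    using op unfolding openin_contains_ball by blast
  define e where "e = min (r / 2) (1 / 2)"
  have e: "0 < e" "e < r" "e < 1" using r(1) by (auto simp: e_def min_def)
  then have "e \<in> ball 0 r \<inter> {0..<1}" by simp
  then have "\<gamma> e \<in> f ` S" using r(2) by blast
  then obtain p where "p \<in> S" "\<gamma> e = f p" by blast
  then have "\<gamma> e y = 0" using y by simp
  then show False using e y[OF p0] by (simp add: \<gamma>_def)
qed

lemma support_eq:
  assumes x: "x \<in> topspace X" and pos: "\<forall>v\<in>s. 0 < x v" and max: "\<forall>t\<in>K. s \<subseteq> t \<longrightarrow> t \<subseteq> u" and fin: "finite u"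
  shows "v \<notin> u \<Longrightarrow> x v = 0" "(\<Sum>v\<in>u. x v) = 1"
proof -
  have "s \<subseteq> {v. x v \<noteq> 0}" using pos by fastforce
  then have sub: "{v. x v \<noteq> 0} \<subseteq> u" using x max unfolding topX by blast
  then show "v \<notin> u \<Longrightarrow> x v = 0" by blast
  show "(\<Sum>v\<in>u. x v) = 1"
    using sum.mono_neutral_left[OF fin sub, of x] x unfolding topX by simp
qed

text \<open>Otherwise a point would be open in the plane.\<close>
lemma vertex_in_edge:
  assumes "{v} \<in> K" shows "\<exists>t\<in>K. v \<in> t \<and> t \<noteq> {v}"
proof (rule ccontr)
  assume "\<not> ?thesis"
  then have max: "\<forall>t\<in>K. {v} \<subseteq> t \<longrightarrow> t \<subseteq> {v}" by blast
  define f where "f p = (\<lambda>w. if w = v then 1 else 0 :: real)" for p :: "real \<times> real"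
  have fX: "f p \<in> topspace X" for p by (rule carrierI[OF assms]) (auto simp: f_def)
  have "open {(0, 0) :: real \<times> real}"
  proof (rule piece_open[of _ f 0 v 0 v "{v}"])
    show "f ` {(0, 0)} = {x \<in> topspace X. \<forall>w\<in>{v}. 0 < x w}"
    proof (intro subset_antisym subsetI)
      fix x assume "x \<in> {x \<in> topspace X. \<forall>w\<in>{v}. 0 < x w}"
      then have x: "x \<in> topspace X" "\<forall>w\<in>{v}. 0 < x w" by blast+
      have "finite {v}" by simp
      note e = support_eq[OF x max this]
      have "x = f (0, 0)" using e by (auto simp: f_def fun_eq_iff)
      then show "x \<in> f ` {(0, 0)}" by blast
    qed (use fX in \<open>auto simp: f_def\<close>)
  qed (use fX in auto)
  then show False using not_open_singleton by blast
qed

text \<open>Otherwise a segment would be open in the plane.\<close>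
lemma edge_in_triangle:
  assumes uv: "{u, v} \<in> K" "u \<noteq> v" shows "\<exists>w. w \<noteq> u \<and> w \<noteq> v \<and> {u, v, w} \<in> K"
proof (rule ccontr)
  assume none: "\<not> ?thesis"
  have max: "\<forall>t\<in>K. {u, v} \<subseteq> t \<longrightarrow> t \<subseteq> {u, v}"
  proof (intro ballI impI, rule ccontr)
    fix t assume that: "t \<in> K" "{u, v} \<subseteq> t"
    assume "\<not> t \<subseteq> {u, v}"
    then obtain w where "w \<in> t" "w \<noteq> u" "w \<noteq> v" by blast
    then have "{u, v, w} \<in> K" using face_sub[OF that(1), of "{u, v, w}"] that(2) by simp
    then show False using none \<open>w \<noteq> u\<close> \<open>w \<noteq> v\<close> by blast
  qed
  define f where "f p = (\<lambda>w. if w = u then fst p else if w = v then 1 - fst p else 0 :: real)" for p :: "real \<times> real"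
  define S where "S = {0<..<1::real} \<times> {0::real}"
  have fX: "f p \<in> topspace X" if "p \<in> S" for p
    by (rule carrierI[OF uv(1)]) (use that uv(2) in \<open>auto simp: f_def S_def\<close>)
  have "open S"
  proof (rule piece_open[of _ f 1 u 0 v "{u, v}"])
    show "f ` S = {x \<in> topspace X. \<forall>w\<in>{u, v}. 0 < x w}"
    proof (intro subset_antisym subsetI)
      fix x assume "x \<in> {x \<in> topspace X. \<forall>w\<in>{u, v}. 0 < x w}"
      then have x: "x \<in> topspace X" "\<forall>w\<in>{u, v}. 0 < x w" by blast+
      then have pos: "0 < x u" "0 < x v" by simp_all
      have "finite {u, v}" by simp
      note e = support_eq[OF x max this]
      have "x v = 1 - x u" using e(2) uv(2) by simp
      then have "x = f (x u, 0)" using e(1) by (auto simp: f_def fun_eq_iff)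
      moreover have "(x u, 0) \<in> S" using pos \<open>x v = 1 - x u\<close> by (simp add: S_def)
      ultimately show "x \<in> f ` S" by blast
    next
      fix x assume "x \<in> f ` S"
      then obtain p where "p \<in> S" "x = f p" by blast
      then show "x \<in> {x \<in> topspace X. \<forall>w\<in>{u, v}. 0 < x w}" using fX uv(2) by (auto simp: f_def S_def)
    qed
    show "continuous_on S (\<lambda>p. f p w)" for w
      unfolding f_def by (cases "w = u"; cases "w = v") (auto intro!: continuous_intros)
    show "(1 * f p u, 0 * f p v) = p" if "p \<in> S" for p using that by (auto simp: f_def S_def)
  qed (use fX in auto)
  moreover have "(1 / 2, 0) \<in> S" by (simp add: S_def)
  ultimately obtain r where r: "0 < r" "ball (1 / 2, 0) r \<subseteq> S" by (rule openE)
  have "(1 / 2, r / 2) \<in> ball (1 / 2, 0 :: real) r" using r(1) by (simp add: dist_Pair_Pair dist_real_def)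
  then show False using r by (auto simp: S_def)
qed

text \<open>Otherwise a triangle together with one of its open edges would be open in the plane.\<close>
lemma edge_second_triangle:
  assumes t: "{u, v, w} \<in> K" "u \<noteq> v" "w \<noteq> u" "w \<noteq> v" shows "\<exists>w'. w' \<noteq> u \<and> w' \<noteq> v \<and> w' \<noteq> w \<and> {u, v, w'} \<in> K"
proof (rule ccontr)
  assume none: "\<not> ?thesis"
  have max: "\<forall>t\<in>K. {u, v} \<subseteq> t \<longrightarrow> t \<subseteq> {u, v, w}"
  proof (intro ballI impI, rule ccontr)
    fix t assume that: "t \<in> K" "{u, v} \<subseteq> t"
    assume "\<not> t \<subseteq> {u, v, w}"
    then obtain w' where w': "w' \<in> t" "w' \<noteq> u" "w' \<noteq> v" "w' \<noteq> w" by blast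
    then have "{u, v, w'} \<in> K" using face_sub[OF that(1), of "{u, v, w'}"] that(2) by simp
    then show False using none w' by blast
  qed
  define f where "f p = (\<lambda>z. if z = u then fst p else if z = v then 1 - fst p - snd p else if z = w then snd p else 0 :: real)" for p :: "real \<times> real"
  define S where "S = {p :: real \<times> real. 0 < fst p \<and> 0 \<le> snd p \<and> fst p + snd p < 1}"
  have fX: "f p \<in> topspace X" if "p \<in> S" for p
    by (rule carrierI[OF t(1)]) (use that t in \<open>auto simp: f_def S_def\<close>)
  have "open S"
  proof (rule piece_open[of _ f 1 u 1 w "{u, v}"])
    show "f ` S = {x \<in> topspace X. \<forall>w\<in>{u, v}. 0 < x w}"
    proof (intro subset_antisym subsetI)
      fix x assume "x \<in> {x \<in> topspace X. \<forall>w\<in>{u, v}. 0 < x w}"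
      then have x: "x \<in> topspace X" "\<forall>w\<in>{u, v}. 0 < x w" by blast+
      then have pos: "0 < x u" "0 < x v" by simp_all
      have "finite {u, v, w}" by simp
      note e = support_eq[OF x max this]
      have xv: "x v = 1 - x u - x w" using e(2) t(2-4) by auto
      then have "x = f (x u, x w)" using e(1) by (auto simp: f_def fun_eq_iff)
      moreover have "0 \<le> x w" using x(1) unfolding topX by blast
      then have "(x u, x w) \<in> S" using pos xv by (simp add: S_def)
      ultimately show "x \<in> f ` S" by blast
    next
      fix x assume "x \<in> f ` S"
      then obtain p where "p \<in> S" "x = f p" by blast
      then show "x \<in> {x \<in> topspace X. \<forall>w\<in>{u, v}. 0 < x w}" using fX t(2-4) by (auto simp: f_def S_def)
    qed
    show "continuous_on S (\<lambda>p. f p z)" for z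
      unfolding f_def by (cases "z = u"; cases "z = v"; cases "z = w") (auto intro!: continuous_intros)
    show "(1 * f p u, 1 * f p w) = p" if "p \<in> S" for p using that t by (auto simp: f_def S_def)
  qed (use fX in auto)
  moreover have "(1 / 2, 0) \<in> S" by (simp add: S_def)
  ultimately obtain r where r: "0 < r" "ball (1 / 2, 0) r \<subseteq> S" by (rule openE)
  have "(1 / 2, - (r / 2)) \<in> ball (1 / 2, 0 :: real) r" using r(1) by (simp add: dist_Pair_Pair dist_real_def)
  then show False using r by (auto simp: S_def)
qed

text \<open>Two triangles on a common edge already form a disc around the interior of the edge; a third
  one would branch off.\<close>
lemma edge_two_triangles:
  assumes t: "{u, v, w1} \<in> K" "{u, v, w2} \<in> K" "{u, v, w3} \<in> K"
    and d: "u \<noteq> v" "w1 \<noteq> u" "w1 \<noteq> v" "w2 \<noteq> u" "w2 \<noteq> v" "w3 \<noteq> u" "w3 \<noteq> v"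
  shows "w1 = w2 \<or> w3 = w1 \<or> w3 = w2"
proof (rule ccontr)
  assume n: "\<not> ?thesis"
  define f where "f p = (\<lambda>z. if z = u then fst p else if z = v then 1 - fst p - \<bar>snd p\<bar> else if z = w1 then max (snd p) 0
      else if z = w2 then max (- snd p) 0 else 0 :: real)" for p :: "real \<times> real"
  define S where "S = {p :: real \<times> real. 0 < fst p \<and> fst p + \<bar>snd p\<bar> < 1}"
  have "open S" unfolding S_def by (intro open_Collect_conj open_Collect_less continuous_intros)
  have fX: "f p \<in> topspace X" if "p \<in> S" for p
  proof (cases "0 \<le> snd p")
    case True
    show ?thesis by (rule carrierI[OF t(1)]) (use True that d n in \<open>auto simp: f_def S_def\<close>)
  next
    case False
    show ?thesis by (rule carrierI[OF t(2)]) (use False that d n in \<open>auto simp: f_def S_def\<close>)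
  qed
  show False
  proof (rule no_branch[where f = f and ?p0.0 = "(1 / 2, 0)" and y = w3, OF \<open>open S\<close> fX])
    show "continuous_on S (\<lambda>p. f p z)" for z
      unfolding f_def by (cases "z = u"; cases "z = v"; cases "z = w1"; cases "z = w2") (auto intro!: continuous_intros)
    show "inj_on f S"
    proof (rule inj_onI)
      fix p q assume "f p = f q"
      then have "f p u = f q u" "f p w1 - f p w2 = f q w1 - f q w2" by simp_all
      then have "fst p = fst q" "snd p = snd q" using d n by (auto simp: f_def max_def split: if_splits)
      then show "p = q" by (simp add: prod_eq_iff)
    qed
    show "(1 / 2, 0) \<in> S" by (simp add: S_def)
    show "f p w3 = 0" if "p \<in> S" for p using d n by (auto simp: f_def)
    fix e :: real assume e: "0 \<le> e" "e < 1"
    show "(\<lambda>z. (1 - e) * f (1 / 2, 0) z + (if z = w3 then e else 0)) \<in> topspace X"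
      by (rule carrierI[OF t(3)]) (use e d n in \<open>auto simp: f_def field_simps\<close>)
  qed
qed

text \<open>Three triangles that close up around \<open>a\<close> form a disc around \<open>a\<close>, so
  a further edge at \<open>a\<close> would branch off. The disc is parametrised by the plane cut
  into three sectors, bounded by the two positive half axes and the negative diagonal, with
  \<open>- m p\<close> as the coordinate that belongs to \<open>z\<close>.\<close>
lemma closed_triangle_link:
  assumes t: "{a, x, y} \<in> K" "{a, y, z} \<in> K" "{a, x, z} \<in> K" and b: "{a, b} \<in> K"
    and d: "a \<noteq> x" "a \<noteq> y" "a \<noteq> z" "x \<noteq> y" "y \<noteq> z" "x \<noteq> z" "b \<noteq> a"
  shows "b = x \<or> b = y \<or> b = z"
proof (rule ccontr)
  assume n: "\<not> ?thesis"
  define m where "m p = min 0 (min (fst p) (snd p))" for p :: "real \<times> real"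
  define f where "f p = (\<lambda>w. if w = a then 1 - (fst p + snd p - 3 * m p) else if w = x then fst p - m p else if w = y then snd p - m p
      else if w = z then - m p else 0)" for p
  define S where "S = {p. fst p + snd p - 3 * m p < 1}"
  have "open S" unfolding S_def m_def by (intro open_Collect_less continuous_intros)
  have fX: "f p \<in> topspace X" if "p \<in> S" for p
  proof -
    have nn: "0 \<le> f p w" for w using that by (auto simp: f_def S_def m_def)
    have "m p = 0 \<or> m p = fst p \<or> m p = snd p" by (simp add: m_def min_def)
    then consider "m p = 0" | "m p = fst p" | "m p = snd p" by blast
    then show ?thesis
    proof cases
      case 1 show ?thesis by (rule carrierI[OF t(1) nn]) (use 1 d in \<open>auto simp: f_def\<close>)
    next
      case 2 show ?thesis by (rule carrierI[OF t(2) nn]) (use 2 d in \<open>auto simp: f_def\<close>)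
    next
      case 3 show ?thesis by (rule carrierI[OF t(3) nn]) (use 3 d in \<open>auto simp: f_def\<close>)
    qed
  qed
  show False
  proof (rule no_branch[where f = f and ?p0.0 = "(0, 0)" and y = b, OF \<open>open S\<close> fX])
    show "continuous_on S (\<lambda>p. f p w)" for w
      unfolding f_def m_def by (cases "w = a"; cases "w = x"; cases "w = y"; cases "w = z") (auto intro!: continuous_intros)
    show "inj_on f S"
    proof (rule inj_onI)
      fix p q assume "f p = f q"
      then have "f p x - f p z = f q x - f q z" "f p y - f p z = f q y - f q z" by simp_all
      then have "fst p = fst q" "snd p = snd q" using d by (auto simp: f_def)
      then show "p = q" by (simp add: prod_eq_iff)
    qed
    show "(0, 0) \<in> S" by (simp add: S_def m_def)
    show "f p b = 0" if "p \<in> S" for p using d n by (auto simp: f_def)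
    fix e :: real assume e: "0 \<le> e" "e < 1"
    show "(\<lambda>w. (1 - e) * f (0, 0) w + (if w = b then e else 0)) \<in> topspace X"
      by (rule carrierI[OF b]) (use e d n in \<open>auto simp: f_def m_def\<close>)
  qed
qed

end



section \<open>Degree-regular surfaces of Euler characteristic zero\<close>

lemma card_two_other:
  assumes "card A = 2" "p \<in> A" obtains q where "A = {p, q}" "q \<noteq> p"
proof -
  obtain x y where "A = {x, y}" "x \<noteq> y" using assms(1) by (auto simp: card_2_iff)
  then show thesis using assms(2) that[of x] that[of y] by (auto simp: insert_commute)
qed

text \<open>A graph on six vertices in which all degrees are 2 and which contains no triangle is a
  hexagon: a cycle has length at least 4, which leaves at most two vertices, too few for another
  cycle.\<close>
lemma six_cycle:
  assumes N: "card N = 6" and sub: "\<And>b. b \<in> N \<Longrightarrow> nb b \<subseteq> N" and two: "\<And>b. b \<in> N \<Longrightarrow> card (nb b) = 2"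
    and sym: "\<And>b c. c \<in> nb b \<Longrightarrow> b \<in> nb c" and irr: "\<And>b. b \<notin> nb b"
    and notri: "\<And>b c d. c \<in> nb b \<Longrightarrow> d \<in> nb c \<Longrightarrow> b \<notin> nb d"
  obtains x :: "nat \<Rightarrow> 'b" where "\<forall>i j. x i = x j \<longleftrightarrow> i mod 6 = j mod 6" "range x = N" "\<forall>i. nb (x i) = {x (i + 5), x (Suc i)}"
proof -
  have fin: "finite N" using N by (metis card.infinite zero_neq_numeral)
  obtain x0 where x0: "x0 \<in> N" using N by fastforce
  obtain x1 x5 where n0: "nb x0 = {x1, x5}" "x1 \<noteq> x5" using two[OF x0] by (auto simp: card_2_iff)
  have x15: "x1 \<in> N" "x5 \<in> N" "x0 \<in> nb x1" "x0 \<in> nb x5" using n0 sub[OF x0] sym[of _ x0] by auto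
  obtain x2 where n1: "nb x1 = {x0, x2}" "x2 \<noteq> x0" using card_two_other[OF two[OF x15(1)] x15(3)] .
  obtain x4 where n5: "nb x5 = {x0, x4}" "x4 \<noteq> x0" using card_two_other[OF two[OF x15(2)] x15(4)] .
  have x24: "x2 \<in> N" "x4 \<in> N" "x1 \<in> nb x2" "x5 \<in> nb x4" using n1 n5 sub[OF x15(1)] sub[OF x15(2)] sym[of _ x1] sym[of _ x5] by auto
  have d1: "x0 \<noteq> x1" "x0 \<noteq> x5" "x1 \<noteq> x2" "x5 \<noteq> x4" using irr[of x0] irr[of x1] irr[of x5] n0 n1 n5 by auto
  have d2: "x2 \<noteq> x5"
  proof
    assume "x2 = x5"
    then show False using notri[of x1 x0 x5] n0 n1 n5 by auto
  qed
  have d3: "x4 \<noteq> x1"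
  proof
    assume "x4 = x1"
    then show False using notri[of x5 x0 x1] n0 n1 n5 by auto
  qed
  have d4: "x4 \<noteq> x2"
  proof
    assume e: "x4 = x2"
    have "nb x2 = {x1, x5}"
      using card_two_other[OF two[OF x24(1)] x24(3)] x24(4) n0(2) e by (metis insertE singletonD)
    \<comment> \<open>A cycle of length 4; each of the two remaining vertices could only be adjacent to the other one.\<close>
    define R where "R = N - {x0, x1, x2, x5}"
    have "card R = 2" unfolding R_def using x0 x15 x24 d1 d2 n0(2) n1(2) N fin by (subst card_Diff_subset) auto
    then obtain y z where yz: "R = {y, z}" "y \<noteq> z" by (auto simp: card_2_iff)
    have yN: "y \<in> N" "y \<notin> {x0, x1, x2, x5}" using yz by (auto simp: R_def)
    have "nb y \<subseteq> {z}"
    proof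
      fix c assume c: "c \<in> nb y"
      have "y \<in> nb c" using sym[OF c] .
      then have "c \<notin> {x0, x1, x2, x5}" using yN n0 n1 n5 \<open>nb x2 = {x1, x5}\<close> e by auto
      moreover have "c \<in> N" using c sub[OF yN(1)] by blast
      ultimately have "c \<in> R" by (simp add: R_def)
      moreover have "c \<noteq> y" using c irr by blast
      ultimately show "c \<in> {z}" using yz by blast
    qed
    then have "card (nb y) \<le> 1" using card_mono[of "{z}" "nb y"] by simp
    then show False using two[OF yN(1)] by simp
  qed
  define F where "F = {x0, x1, x2, x4, x5}"
  have cF: "card F = 5" unfolding F_def using d1 d2 d3 d4 n0(2) n1(2) n5(2) by (simp add: card_insert_if)
  have "F \<subseteq> N" unfolding F_def using x0 x15 x24 by blast
  then have "card (N - F) = 1" using N cF fin by (subst card_Diff_subset) (auto simp: F_def)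
  then obtain x3 where x3: "N - F = {x3}" by (auto simp: card_1_singleton_iff)
  then have x3N: "x3 \<in> N" "x3 \<notin> F" by blast+
  have NF: "N = insert x3 F" using x3 \<open>F \<subseteq> N\<close> by blast
  have "nb x3 \<subseteq> {x2, x4}"
  proof
    fix c assume c: "c \<in> nb x3"
    have "x3 \<in> nb c" using sym[OF c] .
    then have "c \<noteq> x0" "c \<noteq> x1" "c \<noteq> x5" using n0 n1 n5 x3N by (auto simp: F_def)
    moreover have "c \<noteq> x3" using c irr by blast
    moreover have "c \<in> N" using c sub[OF x3N(1)] by blast
    ultimately show "c \<in> {x2, x4}" unfolding NF F_def by blast
  qed
  then have n3: "nb x3 = {x2, x4}" using two[OF x3N(1)] d4 by (intro card_subset_eq) auto
  then have "x3 \<in> nb x2" "x3 \<in> nb x4" using sym[of _ x3] by auto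
  then have n2: "nb x2 = {x1, x3}" and n4: "nb x4 = {x5, x3}"
    using card_two_other[OF two[OF x24(1)] x24(3)] card_two_other[OF two[OF x24(2)] x24(4)] x3N(2) unfolding F_def
    by (metis insertE insertI1 insertI2 singletonD)+
  define xs where "xs = [x0, x1, x2, x3, x4, x5]"
  define x where "x i = xs ! (i mod 6)" for i
  have dist: "distinct xs" using d1 d2 d3 d4 n0(2) n1(2) n5(2) x3N(2) by (auto simp: xs_def F_def)
  have six: "i mod 6 < length xs" for i by (simp add: xs_def)
  have 1: "x i = x j \<longleftrightarrow> i mod 6 = j mod 6" for i j
    unfolding x_def using nth_eq_iff_index_eq[OF dist six six] .
  have "set xs = N" using NF by (auto simp: xs_def F_def)
  moreover have "range x = set xs"
  proof (intro subset_antisym subsetI)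
    fix c assume "c \<in> set xs"
    then obtain k where "k < length xs" "c = xs ! k" unfolding in_set_conv_nth by blast
    moreover have "length xs = 6" by (simp add: xs_def)
    ultimately have "k < 6" "c = xs ! k" by simp_all
    then have "c = x k" by (simp add: x_def)
    then show "c \<in> range x" by simp
  qed (use six in \<open>auto simp: x_def\<close>)
  moreover have "nb (x i) = {x (i + 5), x (Suc i)}" for i
  proof -
    have "i mod 6 < 6" by simp
    moreover have "(i + 5) mod 6 = (i mod 6 + 5) mod 6" "Suc i mod 6 = Suc (i mod 6) mod 6" by presburger+
    ultimately show ?thesis unfolding x_def
      by (elim less6_cases) (simp_all add: xs_def n0 n1 n2 n3 n4 n5 insert_commute)
  qed
  ultimately show thesis using that 1 by metis
qed

context triangulated_surface begin

definition T where "T = {s \<in> K. card s = 3}"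
definition E where "E = {e \<in> K. card e = 2}"

lemma finite_K: "finite K" using complex by (simp add: abstract_complex_def)
lemma finite_V: "finite (vertices K)" unfolding vertices_def using finite_K face_finite by blast
lemma finite_T: "finite T" "finite E" using finite_K by (auto simp: T_def E_def)

lemma vertex_face: "v \<in> vertices K \<Longrightarrow> {v} \<in> K"
proof -
  assume "v \<in> vertices K"
  then obtain s where "s \<in> K" "v \<in> s" by (auto simp: vertices_def)
  then show "{v} \<in> K" using face_sub[of s "{v}"] by simp
qed

lemma face_in_triangle:
  assumes "s \<in> K" shows "\<exists>t\<in>T. s \<subseteq> t"
proof -
  have edge: "\<exists>t\<in>T. {u, v} \<subseteq> t" if uv: "{u, v} \<in> K" "u \<noteq> v" for u v
  proof -
    obtain w where "w \<noteq> u" "w \<noteq> v" "{u, v, w} \<in> K" using edge_in_triangle[OF uv] by blast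
    then show ?thesis using uv(2) by (intro bexI[of _ "{u, v, w}"]) (auto simp: T_def)
  qed
  have "card s \<noteq> 0" using face_finite[OF assms] face_nonempty[OF assms] by simp
  then consider "card s = 1" | "card s = 2" | "card s = 3" using face_card[OF assms] by linarith
  then show ?thesis
  proof cases
    case 1
    then obtain v where s: "s = {v}" by (auto simp: card_1_singleton_iff)
    then obtain t where t: "t \<in> K" "v \<in> t" "t \<noteq> {v}" using vertex_in_edge assms by blast
    then obtain w where w: "w \<in> t" "w \<noteq> v" by blast
    then have "{v, w} \<in> K" using face_sub[OF t(1), of "{v, w}"] t(2) by simp
    then show ?thesis using edge[of v w] w(2) s by auto
  next
    case 2
    then obtain u v where "s = {u, v}" "u \<noteq> v" by (auto simp: card_2_iff)
    then show ?thesis using edge assms by blast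
  next
    case 3 then show ?thesis using assms by (auto simp: T_def)
  qed
qed

lemma K_generated: "K = generated_complex T"
proof (intro subset_antisym subsetI)
  fix s assume "s \<in> K"
  then show "s \<in> generated_complex T" using face_in_triangle face_nonempty by (simp add: generated_complex_def)
next
  fix s assume "s \<in> generated_complex T"
  then show "s \<in> K" using face_sub by (auto simp: generated_complex_def T_def)
qed

lemma Union_T: "\<Union>T = vertices K"
  using face_in_triangle unfolding vertices_def by (auto simp: T_def)

lemma edge_triangles:
  assumes uv: "{u, v} \<in> K" "u \<noteq> v"
  shows "card {w. w \<noteq> u \<and> w \<noteq> v \<and> {u, v, w} \<in> K} = 2"
proof -
  obtain w1 where w1: "w1 \<noteq> u" "w1 \<noteq> v" "{u, v, w1} \<in> K" using edge_in_triangle[OF uv] by blast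
  obtain w2 where w2: "w2 \<noteq> u" "w2 \<noteq> v" "w2 \<noteq> w1" "{u, v, w2} \<in> K" using edge_second_triangle[OF w1(3) uv(2) w1(1,2)] by blast
  have "{w. w \<noteq> u \<and> w \<noteq> v \<and> {u, v, w} \<in> K} = {w1, w2}"
    using edge_two_triangles[OF w1(3) w2(4) _ uv(2) w1(1,2) w2(1,2)] w1 w2 by blast
  then show ?thesis using w2(3) by simp
qed

lemma edge_T_card:
  assumes "e \<in> E" shows "card {t \<in> T. e \<subseteq> t} = 2"
proof -
  obtain u v where e: "e = {u, v}" "u \<noteq> v" using assms by (auto simp: E_def card_2_iff)
  have uv: "{u, v} \<in> K" using assms e by (simp add: E_def)
  define W where "W = {w. w \<noteq> u \<and> w \<noteq> v \<and> {u, v, w} \<in> K}"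
  have "{t \<in> T. e \<subseteq> t} = (\<lambda>w. {u, v, w}) ` W"
  proof (intro subset_antisym subsetI)
    fix t assume t: "t \<in> {t \<in> T. e \<subseteq> t}"
    then have "card (t - {u, v}) = 1" using e by (simp add: T_def card_Diff_subset)
    then obtain w where "t - {u, v} = {w}" by (auto simp: card_1_singleton_iff)
    then have "t = {u, v, w}" "w \<noteq> u" "w \<noteq> v" using t e by auto
    then show "t \<in> (\<lambda>w. {u, v, w}) ` W" using t by (auto simp: W_def T_def)
  next
    fix t assume "t \<in> (\<lambda>w. {u, v, w}) ` W"
    then show "t \<in> {t \<in> T. e \<subseteq> t}" using e by (auto simp: W_def T_def)
  qed
  moreover have "inj_on (\<lambda>w. {u, v, w}) W" by (rule inj_onI) (auto simp: W_def)
  ultimately show ?thesis using edge_triangles[OF uv e(2)] by (simp add: card_image W_def)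
qed

text \<open>With \<open>n d = 2 f\<^sub>1\<close> and \<open>2 f\<^sub>1 = 3 f\<^sub>2\<close>, the
  equation \<open>n - f\<^sub>1 + f\<^sub>2 = 0\<close> becomes \<open>6 n = n d\<close>.\<close>
lemma degree_six:
  assumes deg: "\<And>v. v \<in> vertices K \<Longrightarrow> vertex_degree K v = d" and chi: "euler_char K = 0"
  shows "d = 6"
proof -
  define n where "n = card (vertices K)"
  have f0: "face_number K 0 = n"
  proof -
    have "{s \<in> K. card s = 1} = (\<lambda>v. {v}) ` vertices K"
      using vertex_face by (auto simp: card_1_singleton_iff vertices_def)
    then show ?thesis by (simp add: face_number_def n_def card_image)
  qed
  have f1: "face_number K 1 = card E" by (simp add: face_number_def E_def numeral_2_eq_2)
  have f2: "face_number K 2 = card T" by (simp add: face_number_def T_def)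
  have "(\<Sum>v\<in>vertices K. card {e \<in> E. v \<in> e}) = 2 * card E"
  proof (rule sum_multicount[OF finite_V finite_T(2)], rule ballI)
    fix e assume e: "e \<in> E"
    then have "{v \<in> vertices K. v \<in> e} = e" by (auto simp: E_def vertices_def)
    then show "card {v \<in> vertices K. v \<in> e} = 2" using e by (simp add: E_def)
  qed
  moreover have "card {e \<in> E. v \<in> e} = d" if "v \<in> vertices K" for v
  proof -
    have "{e \<in> E. v \<in> e} = {e \<in> K. card e = 2 \<and> v \<in> e}" by (auto simp: E_def)
    then show ?thesis using deg[OF that] by (simp add: vertex_degree_def)
  qed
  ultimately have 1: "n * d = 2 * card E" by (simp add: n_def)
  have "(\<Sum>e\<in>E. card {t \<in> T. e \<subseteq> t}) = 3 * card T"
  proof (rule sum_multicount[OF finite_T(2,1)], rule ballI)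
    fix t assume t: "t \<in> T"
    have "{e \<in> E. e \<subseteq> t} = {e. e \<subseteq> t \<and> card e = 2}"
    proof (intro subset_antisym subsetI)
      fix e assume e: "e \<in> {e. e \<subseteq> t \<and> card e = 2}"
      then have "e \<noteq> {}" by auto
      then show "e \<in> {e \<in> E. e \<subseteq> t}" using e t face_sub[of t e] by (simp add: E_def T_def)
    qed (auto simp: E_def)
    moreover have "finite t" "card t = 3" using t face_finite by (auto simp: T_def)
    ultimately show "card {e \<in> E. e \<subseteq> t} = 3" using n_subsets[of t 2] by (simp add: choose_two)
  qed
  then have 2: "card E * 2 = 3 * card T" using edge_T_card by simp
  obtain s where "s \<in> K" using dim2 unfolding two_dimensional_def by blast
  then have "vertices K \<noteq> {}" using face_nonempty unfolding vertices_def by blast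
  then have n0: "n \<noteq> 0" using finite_V by (simp add: n_def)
  have "int n - int (card E) + int (card T) = 0" using chi unfolding euler_char_def f0 f1 f2 .
  then have "n + card T = card E" by linarith
  then have "6 * n = n * d" using 1 2 by linarith
  then show ?thesis using n0 by simp
qed

text \<open>The link of a vertex is a graph on its six neighbours with all degrees 2. It contains no
  triangle, since this would be a closed fan of three triangles and leave no room for the other
  neighbours.\<close>
lemma hexagonal_T:
  assumes deg: "\<And>v. v \<in> vertices K \<Longrightarrow> vertex_degree K v = 6"
  shows "hexagonal T"
proof
  show "card t = 3" if "t \<in> T" for t using that by (simp add: T_def)
  fix a assume "a \<in> \<Union>T"
  then have a: "a \<in> vertices K" by (simp add: Union_T)
  define N where "N = {b. b \<noteq> a \<and> {a, b} \<in> K}"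
  define nb where "nb b = (if b \<in> N then {c. c \<noteq> a \<and> c \<noteq> b \<and> {a, b, c} \<in> K} else {})" for b
  have "{e \<in> K. card e = 2 \<and> a \<in> e} = (\<lambda>b. {a, b}) ` N"
  proof (intro subset_antisym subsetI)
    fix e assume e: "e \<in> {e \<in> K. card e = 2 \<and> a \<in> e}"
    then obtain b where "e = {a, b}" "b \<noteq> a" using card_two_other[of e a] by blast
    then show "e \<in> (\<lambda>b. {a, b}) ` N" using e by (auto simp: N_def)
  qed (auto simp: N_def)
  moreover have "inj_on (\<lambda>b. {a, b}) N" by (rule inj_onI) (auto simp: N_def doubleton_eq_iff)
  ultimately have cN: "card N = 6" using deg[OF a] by (simp add: vertex_degree_def card_image)
  have nbN: "nb b \<subseteq> N" if "b \<in> N" for b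
  proof
    fix c assume "c \<in> nb b"
    then have "c \<noteq> a" "{a, b, c} \<in> K" using that by (auto simp: nb_def)
    then show "c \<in> N" using face_sub[of "{a, b, c}" "{a, c}"] by (auto simp: N_def)
  qed
  have two: "card (nb b) = 2" if "b \<in> N" for b
    using edge_triangles[of a b] that by (auto simp: nb_def N_def)
  have sym: "b \<in> nb c" if "c \<in> nb b" for b c
  proof -
    have b: "b \<in> N" using that by (auto simp: nb_def split: if_splits)
    then have "c \<in> N" using nbN that by blast
    then show ?thesis using that b by (auto simp: nb_def N_def insert_commute)
  qed
  have notri: "b \<notin> nb d" if "c \<in> nb b" "d \<in> nb c" for b c d
  proof
    assume bd: "b \<in> nb d"
    have N3: "b \<in> N" "c \<in> N" "d \<in> N" using that bd by (auto simp: nb_def split: if_splits)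
    have t: "{a, b, c} \<in> K" "{a, c, d} \<in> K" "{a, b, d} \<in> K" "b \<noteq> c" "c \<noteq> d" "b \<noteq> d" "b \<noteq> a" "c \<noteq> a" "d \<noteq> a"
      using that bd N3 by (auto simp: nb_def insert_commute)
    have "N \<subseteq> {b, c, d}"
    proof
      fix y assume "y \<in> N"
      then show "y \<in> {b, c, d}" using closed_triangle_link[OF t(1-3), of y] t(4-) by (auto simp: N_def)
    qed
    then have "card N \<le> card {b, c, d}" by (intro card_mono) auto
    also have "\<dots> \<le> 3" by (simp add: card_insert_if)
    finally show False using cN by simp
  qed
  have irr: "b \<notin> nb b" for b by (simp add: nb_def)
  obtain x where x: "\<forall>i j. x i = x j \<longleftrightarrow> i mod 6 = j mod 6" "range x = N" "\<forall>i. nb (x i) = {x (i + 5), x (Suc i)}"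
  proof (rule six_cycle[of N nb])
    show "nb b \<subseteq> N" "card (nb b) = 2" if "b \<in> N" for b using nbN[OF that] two[OF that] .
    show "b \<in> nb c" if "c \<in> nb b" for b c by (rule sym[OF that])
    show "b \<notin> nb d" if "c \<in> nb b" "d \<in> nb c" for b c d by (rule notri[OF that])
  qed (use cN irr that in blast)+
  have "{t \<in> T. a \<in> t} = range (\<lambda>i. {a, x i, x (Suc i)})"
  proof (intro subset_antisym subsetI)
    fix t assume t: "t \<in> {t \<in> T. a \<in> t}"
    then have "card (t - {a}) = 2" by (simp add: T_def)
    then obtain b c where "t - {a} = {b, c}" "b \<noteq> c" by (auto simp: card_2_iff)
    then have bc: "t = {a, b, c}" "b \<noteq> a" "c \<noteq> a" "b \<noteq> c" using t by auto
    then have tK: "{a, b, c} \<in> K" using t by (simp add: T_def)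
    then have "{a, b} \<in> K" using face_sub[of "{a, b, c}" "{a, b}"] by auto
    then have "b \<in> N" using bc by (simp add: N_def)
    then obtain i where i: "b = x i" using x(2) by blast
    have "c \<in> nb b" using \<open>b \<in> N\<close> bc tK by (auto simp: nb_def)
    then have "c = x (i + 5) \<or> c = x (Suc i)" using x(3) i by blast
    then show "t \<in> range (\<lambda>i. {a, x i, x (Suc i)})"
    proof
      assume c: "c = x (i + 5)"
      have "x (Suc (i + 5)) = x i" using x(1) by simp
      then have "t = {a, x (i + 5), x (Suc (i + 5))}" using bc(1) c i by auto
      then show ?thesis by blast
    next
      assume "c = x (Suc i)" then show ?thesis using bc(1) i by blast
    qed
  next
    fix t assume "t \<in> range (\<lambda>i. {a, x i, x (Suc i)})"
    then obtain i where t: "t = {a, x i, x (Suc i)}" by blast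
    have "x i \<in> N" using x(2) by blast
    moreover have "x (Suc i) \<in> nb (x i)" using x(3) by blast
    ultimately have "x (Suc i) \<noteq> a" "x (Suc i) \<noteq> x i" "x i \<noteq> a" "{a, x i, x (Suc i)} \<in> K" by (auto simp: nb_def N_def)
    then show "t \<in> {t \<in> T. a \<in> t}" by (auto simp: t T_def)
  qed
  then show "\<exists>x::nat \<Rightarrow> 'a. (\<forall>i j. x i = x j \<longleftrightarrow> i mod 6 = j mod 6) \<and> {t \<in> T. a \<in> t} = range (\<lambda>i. {a, x i, x (Suc i)})"
    using x(1) by blast
qed

text \<open>The sum of the coordinates at the vertices of \<open>S\<close> is a continuous function on the
  carrier with values 0 and 1 only.\<close>
lemma connected_adjacency:
  assumes conn: "connected_space X" and S: "S \<noteq> {}" "S \<subseteq> \<Union>T"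
    and closed: "\<And>a b t. a \<in> S \<Longrightarrow> t \<in> T \<Longrightarrow> a \<in> t \<Longrightarrow> b \<in> t \<Longrightarrow> b \<in> S"
  shows "S = \<Union>T"
proof (rule ccontr)
  assume "S \<noteq> \<Union>T"
  then obtain w where w: "w \<in> \<Union>T" "w \<notin> S" using S(2) by blast
  obtain v where v: "v \<in> S" using S(1) by blast
  have finS: "finite S" using S(2) finite_V unfolding Union_T by (rule finite_subset)
  \<comment> \<open>By the closure property each triangle lies inside \<open>S\<close> or is disjoint from it.\<close>
  define h where "h x = (\<Sum>u\<in>S. x u)" for x :: "'a \<Rightarrow> real"
  have h01: "h x \<in> {0, 1}" if x: "x \<in> topspace X" for x
  proof -
    have s: "{u. x u \<noteq> 0} \<in> K" "(\<Sum>u | x u \<noteq> 0. x u) = 1" using x unfolding topX by blast+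
    obtain t where t: "t \<in> T" "{u. x u \<noteq> 0} \<subseteq> t" using face_in_triangle[OF s(1)] by blast
    show ?thesis
    proof (cases "t \<inter> S = {}")
      case True
      then have "h x = 0" unfolding h_def using t(2) by (intro sum.neutral) blast
      then show ?thesis by simp
    next
      case False
      then have "t \<subseteq> S" using closed t(1) by blast
      then have "h x = (\<Sum>u | x u \<noteq> 0. x u)" unfolding h_def using t(2) finS by (intro sum.mono_neutral_right) auto
      then show ?thesis using s(2) by simp
    qed
  qed
  have pt: "(\<lambda>u. if u = a then 1 else 0) \<in> topspace X" if "a \<in> \<Union>T" for a
    by (rule carrierI[OF vertex_face]) (use that Union_T in auto)
  have "continuous_map X euclideanreal h"
    unfolding h_def by (intro continuous_map_sum coordinate_continuous finS)
  then have "connectedin euclideanreal (h ` topspace X)"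
    using connectedin_continuous_map_image conn connectedin_topspace by blast
  then have "connected (h ` topspace X)" by simp
  moreover have "1 \<in> h ` topspace X"
    by (rule image_eqI[OF _ pt[of v]]) (use v finS S(2) in \<open>auto simp: h_def\<close>)
  moreover have "0 \<in> h ` topspace X"
    by (rule image_eqI[OF _ pt[OF w(1)]]) (use w(2) finS in \<open>auto simp: h_def\<close>)
  ultimately have "{0..1} \<subseteq> h ` topspace X" using connected_contains_Icc[of "h ` topspace X" 0 1] by blast
  then have "(1 / 2 :: real) \<in> h ` topspace X" by auto
  then obtain y where "y \<in> topspace X" "h y = 1 / 2" by auto
  then show False using h01[of y] by simp
qed

end

theorem degree_regular_surface_cover:
  assumes M: "combinatorial_2_manifold M" and reg: "degree_regular M" and chi: "euler_char M = 0"
  obtains \<phi> where "hex_cover \<phi> M"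
proof -
  interpret triangulated_surface M
    using M by unfold_locales (simp_all add: combinatorial_2_manifold_def)
  obtain d where d: "\<And>v. v \<in> vertices M \<Longrightarrow> vertex_degree M v = d" and conn: "connected_space (geometric_carrier M)"
    using reg unfolding degree_regular_def by blast
  have "d = 6" using degree_six[OF d chi] by simp
  then interpret hexagonal T using hexagonal_T d by blast
  have "T \<noteq> {}" using dim2 by (auto simp: two_dimensional_def T_def)
  then obtain \<phi> where "hex_cover \<phi> (generated_complex T)"
    using hex_cover_exists connected_adjacency[OF conn] by blast
  then show thesis using that K_generated by simp
qed


section \<open>The seventeen surfaces\<close>

lemma hex_cover_complex:
  assumes K: "hex_cover \<phi> K" and fin: "finite (vertices K)"
  shows "abstract_complex K" "two_dimensional K"
proof -
  define F where "F = (`) \<phi> ` lattice_triangles"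
  interpret hexagonal F unfolding F_def by (rule hex_cover_hexagonal[OF K])
  have Ke: "K = generated_complex F" using K by (simp add: hex_cover_def F_def)
  have "K \<subseteq> Pow (vertices K)" by (auto simp: vertices_def)
  then have "finite K" using fin by (metis finite_Pow_iff finite_subset)
  moreover have ff: "finite f" if "f \<in> F" for f using card3[OF that] by (simp add: card_ge_0_finite)
  then have "finite s" "s \<noteq> {}" if "s \<in> K" for s
    using that finite_subset unfolding Ke generated_complex_def by blast+
  moreover have "t \<in> K" if "s \<in> K" "t \<subseteq> s" "t \<noteq> {}" for s t
    using that unfolding Ke generated_complex_def by blast
  ultimately show "abstract_complex K" unfolding abstract_complex_def by blast
  have "card s \<le> 3" if "s \<in> K" for s
  proof -
    obtain f where "f \<in> F" "s \<subseteq> f" using \<open>s \<in> K\<close> unfolding Ke generated_complex_def by blast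
    then show ?thesis using card_mono[OF ff[of f], of s] card3[of f] by simp
  qed
  moreover have "\<exists>s\<in>K. card s = 3"
  proof
    have t: "tri1 0 \<in> lattice_triangles" by (auto simp: lattice_triangles_def)
    then have f: "\<phi> ` tri1 0 \<in> F" by (simp add: F_def)
    show "card (\<phi> ` tri1 0) = 3" by (rule card3[OF f])
    then have "\<phi> ` tri1 0 \<noteq> {}" by auto
    then show "\<phi> ` tri1 0 \<in> K" using f unfolding Ke generated_complex_def by blast
  qed
  ultimately show "two_dimensional K" unfolding two_dimensional_def by blast
qed

text \<open>The carrier is a quotient of the plane, by the topological description of the models.\<close>
lemma shape_surface:
  assumes X: "has_shape X k"
  shows "combinatorial_2_manifold X" "connected_space (geometric_carrier X)"
proof -
  have pq: "\<exists>\<Psi> G. plane_quotient (geometric_carrier X) \<Psi> G"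
  proof (cases k)
    case (Torus a b c)
    then have "torus_model X a b c" using X by simp
    then show ?thesis using torus_model_quotient by metis
  next
    case (Klein s a m)
    then have "klein_model X s a m" using X by simp
    then show ?thesis using klein_model_quotient by metis
  qed
  then obtain \<Psi> G where "plane_quotient (geometric_carrier X) \<Psi> G" by blast
  then interpret plane_quotient "geometric_carrier X" \<Psi> G .
  have "\<exists>\<phi>. hex_cover \<phi> X" using X by (cases k) (auto simp: torus_model_def klein_model_def)
  then obtain \<phi> where \<phi>: "hex_cover \<phi> X" ..
  have "finite (vertices X)" using has_shape_card[OF X] by (intro card_ge_0_finite) simp
  then show "combinatorial_2_manifold X"
    unfolding combinatorial_2_manifold_def using hex_cover_complex[OF \<phi>] closed_surface by blast
  show "connected_space (geometric_carrier X)" by (rule connected)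
qed

text \<open>Conjugating the glide reflection by the translation along \<open>d\<close> changes its
  translation part by a horizontal vector, which for even height of \<open>d\<close> is a
  multiple of the period \<open>(2,0)\<close>.\<close>
lemma klein_even_translation:
  assumes "krel 2 m p q" "even (snd d)"
  shows "krel 2 m (p + d) (q + d)"
proof -
  obtain i j where "q = p + (j * m + i * 2, 2 * j * m) \<or> q = kflip p + (j * m + i * 2, m + 2 * j * m)"
    using assms(1) unfolding krel_def by blast
  moreover obtain e where e: "snd d = 2 * e" using assms(2) by (elim evenE)
  ultimately have "q + d = p + d + (j * m + i * 2, 2 * j * m) \<or>
      q + d = kflip (p + d) + (j * m + (i + fst d - e) * 2, m + 2 * j * m)"
    by (auto simp: prod_eq_iff kflip_def)
  then show ?thesis unfolding krel_def by blast
qed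

text \<open>Half turns invert the glide reflection up to a horizontal translation, whose length is even if
  \<open>m\<close> and the height of \<open>d\<close> are both odd.\<close>
lemma klein_odd_inversion:
  assumes "krel 2 m p q" "odd (snd d)" "odd m"
  shows "krel 2 m (d - p) (d - q)"
proof -
  obtain i j where "q = p + (j * m + i * 2, 2 * j * m) \<or> q = kflip p + (j * m + i * 2, m + 2 * j * m)"
    using assms(1) unfolding krel_def by blast
  moreover have "even (m - snd d)" using assms(2,3) by simp
  then obtain e where e: "m - snd d = 2 * e" by (elim evenE)
  ultimately have "d - q = d - p + ((- j) * m + (- i) * 2, 2 * (- j) * m) \<or>
      d - q = kflip (d - p) + ((- j - 1) * m + (fst d - i + e) * 2, m + 2 * (- j - 1) * m)"
    by (auto simp: prod_eq_iff kflip_def algebra_simps)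
  then show ?thesis unfolding krel_def by blast
qed

text \<open>Each vertex is moved to any other one by a symmetry of the lattice that normalises the deck
  group: a translation if their heights have the same parity, and otherwise the half turn that
  exchanges them.\<close>
lemma klein_transitive:
  assumes X: "klein_model X s 2 m" and m: "odd m"
  shows "weakly_regular X"
  unfolding weakly_regular_def
proof (intro conjI ballI)
  have "has_shape X (Klein s 2 m)" using X by simp
  then show "connected_space (geometric_carrier X)" by (rule shape_surface(2))
  obtain \<phi> where m0: "0 < m" and \<phi>: "hex_cover \<phi> X" and ker: "\<And>z w. \<phi> z = \<phi> w \<longleftrightarrow> kred 2 m (frame s z) = kred 2 m (frame s w)"
    using X unfolding klein_model_def by blast
  fix u v assume "u \<in> vertices X" "v \<in> vertices X"
  then obtain z w where z: "u = \<phi> z" and w: "v = \<phi> w" unfolding hex_cover_vertices[OF \<phi>] by blast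
  have fdiff: "frame s (x - y) = frame s x - frame s y" for x y by (simp add: frame_def shear_def prod_eq_iff)
  show "\<exists>f. simplicial_iso f X X \<and> f u = v"
  proof (cases "even (snd (frame s (w - z)))")
    case True
    define \<psi> where "\<psi> x = \<phi> (id x + (w - z))" for x
    have \<psi>: "hex_cover \<psi> X" unfolding \<psi>_def by (rule hex_cover_reparam[OF \<phi> id_dihedral])
    have "\<phi> x = \<phi> y \<longleftrightarrow> \<psi> x = \<psi> y" for x y
    proof -
      have "krel 2 m p q \<longleftrightarrow> krel 2 m (p + frame s (w - z)) (q + frame s (w - z))" for p q
        using klein_even_translation[of m p q "frame s (w - z)"] True
          klein_even_translation[of m "p + frame s (w - z)" "q + frame s (w - z)" "- frame s (w - z)"] by auto
      then show ?thesis unfolding \<psi>_def ker kred_eq_iff[OF m0] frame_add id_apply .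
    qed
    then obtain f where f: "simplicial_iso f X X" "\<And>x. f (\<phi> x) = \<psi> x"
      using hex_cover_isomorphism[OF \<phi> \<psi>] by blast
    have "f u = v" using f(2)[of z] by (simp add: z w \<psi>_def)
    then show ?thesis using f(1) by blast
  next
    case False
    define r where "r = mat_app (-1, 0, 0, -1)"
    have rd: "r \<in> dihedral" unfolding r_def by (rule mat_app_dihedral) (simp add: dihedral_matrices_def)
    have r: "r x + (z + w) = (z + w) - x" for x by (simp add: r_def mat_app_def prod_eq_iff)
    define \<psi> where "\<psi> x = \<phi> (r x + (z + w))" for x
    have \<psi>: "hex_cover \<psi> X" unfolding \<psi>_def by (rule hex_cover_reparam[OF \<phi> rd])
    define d where "d = frame s (z + w)"
    have "snd d = snd (frame s (w - z)) + 2 * snd (frame s z)"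
      unfolding d_def fdiff frame_add by simp
    then have d: "odd (snd d)" using False by simp
    have "\<phi> x = \<phi> y \<longleftrightarrow> \<psi> x = \<psi> y" for x y
    proof -
      have "krel 2 m p q \<longleftrightarrow> krel 2 m (d - p) (d - q)" for p q
        using klein_odd_inversion[OF _ d m, of p q] klein_odd_inversion[OF _ d m, of "d - p" "d - q"] by auto
      then show ?thesis unfolding \<psi>_def r ker kred_eq_iff[OF m0] fdiff d_def[symmetric] .
    qed
    then obtain f where f: "simplicial_iso f X X" "\<And>x. f (\<phi> x) = \<psi> x"
      using hex_cover_isomorphism[OF \<phi> \<psi>] by blast
    have "f u = v" using f(2)[of z] by (simp add: z w \<psi>_def r)
    then show ?thesis using f(1) by blast
  qed
qed

definition torus_complexes :: "vertex set set list" where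
  "torus_complexes = [T1_complex 12 2, T1_complex 12 3, T1_complex 12 4, T2_complex 6 2,
     T1_complex 14 2, T1_complex 14 3, T1_complex 15 2, T1_complex 15 3, T1_complex 15 4, T1_complex 15 5]"

definition klein_complexes :: "vertex set set list" where
  "klein_complexes = [Q2_complex 3, Q_complex 2 3, B_complex 3 4, B_complex 4 3, B_complex 3 5, B_complex 5 3, K_complex 3 2]"

definition torus_shapes :: "shape list" where
  "torus_shapes = map (\<lambda>(a, b, c). Torus a b c) (torus_parameters 12 @ torus_parameters 14 @ torus_parameters 15)"

definition klein_shapes :: "shape list" where
  "klein_shapes = map (\<lambda>(s, a, m). Klein s a m) klein_parameters"

text \<open>The parameters are listed in the order of the complexes.\<close>
lemma have_shapes:
  "list_all2 has_shape torus_complexes torus_shapes" "list_all2 has_shape klein_complexes klein_shapes"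
  using torus_models klein_models
  by (simp_all add: torus_complexes_def klein_complexes_def torus_shapes_def klein_shapes_def torus_parameters_def klein_parameters_def)

lemma shapes_different:
  "list_all (\<lambda>j. list_all (\<lambda>i. different ((torus_shapes @ klein_shapes) ! i) ((torus_shapes @ klein_shapes) ! j)) [0..<j]) [0..<17]"
  by code_simp

lemma klein_shapes_separated: "list_all (\<lambda>k. list_ex (separated k k 0) test_points) (tl klein_shapes)"
  by code_simp

lemma complexes_not_isomorphic:
  assumes "i < 17" "j < 17" "i \<noteq> j"
  shows "\<not> isomorphic_complexes ((torus_complexes @ klein_complexes) ! i) ((torus_complexes @ klein_complexes) ! j)"
proof -
  let ?L = "torus_complexes @ klein_complexes" and ?S = "torus_shapes @ klein_shapes"
  have "list_all2 has_shape ?L ?S" using have_shapes by (rule list_all2_appendI)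
  moreover have "length ?L = 17" by (simp add: torus_complexes_def klein_complexes_def)
  ultimately have sh: "has_shape (?L ! k) (?S ! k)" if "k < 17" for k using that list_all2_nthD by metis
  have lt: "\<not> isomorphic_complexes (?L ! i) (?L ! j)" if "i < j" "j < 17" for i j
  proof (rule different_shapes[OF sh sh])
    have "list_all (\<lambda>i. different (?S ! i) (?S ! j)) [0..<j]" using shapes_different that(2) unfolding list_all_iff by simp
    then show "different (?S ! i) (?S ! j)" using that(1) unfolding list_all_iff by simp
  qed (use that in auto)
  have sym: "isomorphic_complexes (?L ! i) (?L ! j) \<Longrightarrow> isomorphic_complexes (?L ! j) (?L ! i)" for i j
    unfolding isomorphic_complexes_def using simplicial_iso_sym by blast
  show ?thesis using lt[of i j] lt[of j i] sym[of i j] assms by (cases i j rule: linorder_cases) auto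
qed

lemma list_all2_tl: "list_all2 P xs ys \<Longrightarrow> list_all2 P (tl xs) (tl ys)"
  by (cases xs; cases ys) auto
lemma list_all2_set1: "list_all2 P xs ys \<Longrightarrow> x \<in> set xs \<Longrightarrow> \<exists>y\<in>set ys. P x y"
  by (induction rule: list_all2_induct) auto
lemma list_all2_set2: "list_all2 P xs ys \<Longrightarrow> y \<in> set ys \<Longrightarrow> \<exists>x\<in>set xs. P x y"
  by (induction rule: list_all2_induct) auto

text \<open>The surface and one of the listed complexes are quotients of the lattice by the same group.\<close>
lemma classification:
  assumes M: "combinatorial_2_manifold M" "degree_regular M" "euler_char M = 0" and n: "card (vertices M) \<in> {12, 14, 15}"
  shows "\<exists>X\<in>set (torus_complexes @ klein_complexes). isomorphic_complexes M X"
proof -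
  obtain \<phi> where \<phi>: "hex_cover \<phi> M" using degree_regular_surface_cover[OF M] .
  show ?thesis
  proof (rule small_covers[OF \<phi> n])
    fix \<psi> a b c
    assume torus: "hex_cover \<psi> M" "(a, b, c) \<in> set (torus_parameters (int (card (vertices M))))"
      "\<And>z w. \<psi> z = \<psi> w \<longleftrightarrow> shape_red (Torus a b c) z = shape_red (Torus a b c) w"
    have "(a, b, c) \<in> set (torus_parameters 12 @ torus_parameters 14 @ torus_parameters 15)"
      using torus(2) n by auto
    then have "(\<lambda>(a, b, c). Torus a b c) (a, b, c) \<in> set torus_shapes"
      unfolding torus_shapes_def set_map by (rule imageI)
    then have "Torus a b c \<in> set torus_shapes" by simp
    then obtain X where "X \<in> set torus_complexes" "has_shape X (Torus a b c)" using list_all2_set2[OF have_shapes(1)] by blast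
    then show ?thesis using has_shape_isomorphic[OF torus(1) torus(3)] by auto
  next
    fix \<psi> s a m
    assume klein: "hex_cover \<psi> M" "(s, a, m) \<in> set klein_parameters"
      "\<And>z w. \<psi> z = \<psi> w \<longleftrightarrow> shape_red (Klein s a m) z = shape_red (Klein s a m) w"
    have "(\<lambda>(s, a, m). Klein s a m) (s, a, m) \<in> set klein_shapes"
      unfolding klein_shapes_def set_map using klein(2) by (rule imageI)
    then have "Klein s a m \<in> set klein_shapes" by simp
    then obtain X where "X \<in> set klein_complexes" "has_shape X (Klein s a m)" using list_all2_set2[OF have_shapes(2)] by blast
    then show ?thesis using has_shape_isomorphic[OF klein(1) klein(3)] by auto
  qed
qed

lemma torus_triangulations: "X \<in> set torus_complexes \<Longrightarrow> triangulates X torus"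
proof -
  assume "X \<in> set torus_complexes"
  then obtain k where "k \<in> set torus_shapes" "has_shape X k" using list_all2_set1[OF have_shapes(1)] by blast
  then obtain a b c where "torus_model X a b c" by (auto simp: torus_shapes_def)
  then show ?thesis unfolding triangulates_def using torus_model_quotient torus_homeomorphic by metis
qed

lemma klein_triangulations: "X \<in> set klein_complexes \<Longrightarrow> triangulates X klein_bottle"
proof -
  assume "X \<in> set klein_complexes"
  then obtain k where "k \<in> set klein_shapes" "has_shape X k" using list_all2_set1[OF have_shapes(2)] by blast
  then obtain s a m where "klein_model X s a m" by (auto simp: klein_shapes_def)
  then show ?thesis unfolding triangulates_def using klein_model_quotient klein_homeomorphic by metis
qed

text \<open>The first complex in the list is \<open>Q\<^bsub>7,2\<^esub>\<close>. In each of the others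
  the vertex over the origin cannot be moved to one of the test points.\<close>
lemma klein_weakly_regular:
  assumes X: "X \<in> set klein_complexes"
  shows "weakly_regular X \<longleftrightarrow> X = Q2_complex 3"
proof
  assume "X = Q2_complex 3"
  then have "klein_model X True 2 7" using klein_models by simp
  then show "weakly_regular X" by (rule klein_transitive) simp
next
  assume wr: "weakly_regular X"
  show "X = Q2_complex 3"
  proof (rule ccontr)
    assume "X \<noteq> Q2_complex 3"
    then have tl: "X \<in> set (tl klein_complexes)" using X by (simp add: klein_complexes_def)
    have "list_all2 has_shape (tl klein_complexes) (tl klein_shapes)" using have_shapes(2) by (rule list_all2_tl)
    from list_all2_set1[OF this tl] obtain k where k: "k \<in> set (tl klein_shapes)" "has_shape X k" ..
    have "list_ex (separated k k 0) test_points"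
      using klein_shapes_separated k(1) unfolding list_all_iff by (rule bspec)
    then obtain b where "separated k k 0 b" unfolding list_ex_iff ..
    then show False using separated_not_transitive[OF k(2)] wr by blast
  qed
qed


theorem theorem6:
  shows "let Ts = [T1_complex 12 2, T1_complex 12 3, T1_complex 12 4, T2_complex 6 2,
                   T1_complex 14 2, T1_complex 14 3, T1_complex 15 2, T1_complex 15 3,
                   T1_complex 15 4, T1_complex 15 5];
             Ks = [Q2_complex 3, Q_complex 2 3, B_complex 3 4, B_complex 4 3,
                   B_complex 3 5, B_complex 5 3, K_complex 3 2];
             L = Ts @ Ks
         in
           (\<forall>(M :: 'a set set) n.
              combinatorial_2_manifold M \<and> degree_regular M \<and> card (vertices M) = n \<and>
              euler_char M = 0 \<and> (n = 12 \<or> n = 14 \<or> n = 15)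
              \<longrightarrow> (\<exists>X\<in>set L. isomorphic_complexes M X)) \<and>
           (\<forall>X\<in>set L. combinatorial_2_manifold X) \<and>
           (\<forall>i<length L. \<forall>j<length L. i \<noteq> j \<longrightarrow> \<not> isomorphic_complexes (L ! i) (L ! j)) \<and>
           (\<forall>X\<in>set Ts. triangulates X torus) \<and>
           (\<forall>X\<in>set Ks. triangulates X klein_bottle) \<and>
           (\<forall>X\<in>set Ks. weakly_regular X \<longleftrightarrow> X = Q2_complex 3)"
  unfolding Let_def torus_complexes_def[symmetric] klein_complexes_def[symmetric]
proof (intro conjI allI ballI impI)
  fix M :: "'a set set" and n
  assume "combinatorial_2_manifold M \<and> degree_regular M \<and> card (vertices M) = n \<and>
              euler_char M = 0 \<and> (n = 12 \<or> n = 14 \<or> n = 15)"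
  then show "\<exists>X\<in>set (torus_complexes @ klein_complexes). isomorphic_complexes M X"
    by (intro classification) auto
next
  fix X assume "X \<in> set (torus_complexes @ klein_complexes)"
  then obtain k where "has_shape X k"
    using list_all2_set1[OF list_all2_appendI[OF have_shapes]] by blast
  then show "combinatorial_2_manifold X" by (rule shape_surface)
next
  fix i j assume "i < length (torus_complexes @ klein_complexes)" "j < length (torus_complexes @ klein_complexes)" "i \<noteq> j"
  moreover have "length (torus_complexes @ klein_complexes) = 17"
    by (simp add: torus_complexes_def klein_complexes_def)
  ultimately show "\<not> isomorphic_complexes ((torus_complexes @ klein_complexes) ! i) ((torus_complexes @ klein_complexes) ! j)"
    by (intro complexes_not_isomorphic) simp_all
next
  fix X assume "X \<in> set torus_complexes"
  then show "triangulates X torus" by (rule torus_triangulations)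
next
  fix X assume X: "X \<in> set klein_complexes"
  show "triangulates X klein_bottle" by (rule klein_triangulations[OF X])
  show "weakly_regular X \<longleftrightarrow> X = Q2_complex 3" by (rule klein_weakly_regular[OF X])
qed

end
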